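(* Let $N\ge 1$, let $(r_\delta)_{\delta\mid N}$ be integers, and let $$f(\tau)=\prod_{\delta\mid N}\eta(\delta\tau)^{-r_\delta}=\sum_{n\ge 0}a(n)q^{n-\frac tw},\qquad \frac tw:=\frac{\sum_{\delta\mid N}\delta r_\delta}{24}.$$ Assume: (1) there is no common factor among the $\delta$ for which $r_\delta\neq 0$ (i.e. $f$ is a primitive eta-quotient); (2) $g:=1/f$ is a holomorphic modular form of weight $1/2$ and level $N$: there is a multiplier $\nu$ such that for every $\gamma=\begin{pmatrix}a&b\\c&d\end{pmatrix}\in\Gamma_0(N)$, $g\left(\frac{a\tau+b}{c\tau+d}\right)=\nu(\gamma)(c\tau+d)^{1/2}g(\tau)$; (3) the Fourier expansion of $g$ is $g(\tau)=\sum_{m\in\mathbb Z}b(m)q^{m^2/w}$, and $b(\ell m)=\chi(\ell)b(m)$ for every $m\in\mathbb{Z}$ and every prime $\ell\ge5$, where $\chi(\ell)$ is a number depending only on $\ell$. Then for every prime $\ell\ge 5$, $$\chi(\ell)\cdot\prod_{\delta\mid N}(q^{\ell\delta};q^{\ell\delta})_\infty^{r_\delta}\sum_{n\ge 0}a\left(\ell n-\tfrac tw(\ell^2-1)\right)q^n\equiv 1-\left(\frac{-w}{\ell}\right)\frac83\cdot[f(\tau),g(\tau)]_{(\ell-1)/2}\,\big|\,U_\ell\pmod\ell,$$ and $[f(\tau),g(\tau)]_{(\ell-1)/2}$ is a holomorphic modular form in $M_{\ell-1}(\Gamma_0(N))$.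
   Context: $q=e^{2\pi i\tau}$ with $\tau$ in the upper half-plane; $\eta(\tau)=q^{1/24}\prod_{n\ge1}(1-q^n)$ is the Dedekind eta function; $(q^k;q^k)_\infty=\prod_{n\ge1}(1-q^{kn})$. $t,w$ are integers with $w>0$. Convention: $a(n)=0$ for $n<0$. $\left(\frac{\cdot}{\ell}\right)$ is the Legendre symbol. The operator $U_\ell$ is $\left(\sum c(n)q^n\right)|U_\ell=\sum c(\ell n)q^n$. With $D=\frac{1}{2\pi i}\frac{d}{d\tau}=q\frac{d}{dq}$, the $v$-th Rankin–Cohen bracket of $f$ (of weight $a$) and $g$ (of weight $b$), $a,b\in\frac12\mathbb Z$, is $$[f,g]_v=\sum_{0\le j\le v}(-1)^j\binom{a+v-1}{v-j}\binom{b+v-1}{j}D^jf\,D^{v-j}g;$$ here $f$ has weight $-1/2$ and $g$ has weight $1/2$. Congruences modulo $\ell$ of $q$-series are coefficientwise, for coefficients in $\mathbb Z_{(\ell)}$. $M_k(\Gamma_0(N))$ is the space of holomorphic modular forms of weight $k$ on $\Gamma_0(N)$ with trivial character. *)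

theory Defs
  imports
    "HOL-Complex_Analysis.Complex_Analysis"
    "HOL-Computational_Algebra.Computational_Algebra"
    "HOL-Number_Theory.Number_Theory"
begin

definition upper_half_plane :: "complex set" where
  "upper_half_plane = {\<tau>. Im \<tau> > 0}"

(* q^x with q = exp(2 pi i tau), for real exponents x *)
definition q_pow :: "real \<Rightarrow> complex \<Rightarrow> complex" where
  "q_pow x \<tau> = exp (2 * of_real pi * \<i> * of_real x * \<tau>)"

definition dedekind_eta :: "complex \<Rightarrow> complex" where
  "dedekind_eta \<tau> = q_pow (1 / 24) \<tau> * (\<Prod>n. 1 - q_pow (real (Suc n)) \<tau>)"

definition eta_quotient :: "nat \<Rightarrow> (nat \<Rightarrow> int) \<Rightarrow> complex \<Rightarrow> complex" where
  "eta_quotient N s \<tau> = (\<Prod>\<delta> | \<delta> dvd N. dedekind_eta (of_nat \<delta> * \<tau>) powi s \<delta>)"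

definition SL2Z :: "(int^2^2) set" where
  "SL2Z = {\<gamma>. det \<gamma> = 1}"

definition Gamma0 :: "nat \<Rightarrow> (int^2^2) set" where
  "Gamma0 N = {\<gamma> \<in> SL2Z. int N dvd \<gamma> $ 2 $ 1}"

definition aut_denom :: "int^2^2 \<Rightarrow> complex \<Rightarrow> complex" where
  "aut_denom \<gamma> \<tau> = of_int (\<gamma> $ 2 $ 1) * \<tau> + of_int (\<gamma> $ 2 $ 2)"

definition moebius_act :: "int^2^2 \<Rightarrow> complex \<Rightarrow> complex" where
  "moebius_act \<gamma> =
     moebius (of_int (\<gamma> $ 1 $ 1)) (of_int (\<gamma> $ 1 $ 2)) (of_int (\<gamma> $ 2 $ 1)) (of_int (\<gamma> $ 2 $ 2))"

(* Holomorphic modular forms of real weight k for Gamma0 N with multiplier nu.  The factor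
   (c tau + d)^k uses the principal branch; for integral k it is the ordinary power.
   The last clause is holomorphy at all cusps: every F|gamma, gamma in SL2Z, stays bounded as
   Im tau tends to infinity. *)
definition modular_form ::
    "real \<Rightarrow> nat \<Rightarrow> (int^2^2 \<Rightarrow> complex) \<Rightarrow> (complex \<Rightarrow> complex) \<Rightarrow> bool" where
  "modular_form k N \<nu> F \<longleftrightarrow>
     F holomorphic_on upper_half_plane \<and>
     (\<forall>\<gamma> \<in> Gamma0 N. \<forall>\<tau> \<in> upper_half_plane.
        F (moebius_act \<gamma> \<tau>) = \<nu> \<gamma> * aut_denom \<gamma> \<tau> powr of_real k * F \<tau>) \<and>
     (\<forall>\<gamma> \<in> SL2Z. \<exists>B C. \<forall>\<tau>. Im \<tau> > max 0 C \<longrightarrow>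
        norm (aut_denom \<gamma> \<tau> powr of_real (- k) * F (moebius_act \<gamma> \<tau>)) \<le> B)"

definition M_Gamma0 :: "nat \<Rightarrow> nat \<Rightarrow> (complex \<Rightarrow> complex) set" where
  "M_Gamma0 k N = {F. modular_form (real k) N (\<lambda>_. 1) F}"

definition D_op :: "(complex \<Rightarrow> complex) \<Rightarrow> complex \<Rightarrow> complex" where
  "D_op F \<tau> = deriv F \<tau> / (2 * of_real pi * \<i>)"

definition rankin_cohen ::
    "real \<Rightarrow> (complex \<Rightarrow> complex) \<Rightarrow> real \<Rightarrow> (complex \<Rightarrow> complex) \<Rightarrow> nat \<Rightarrow> complex \<Rightarrow> complex" where
  "rankin_cohen a F b G v \<tau> =
     (\<Sum>j\<le>v. (-1) ^ j * of_real ((a + real v - 1) gchoose (v - j)) * of_real ((b + real v - 1) gchoose j)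
        * (D_op ^^ j) F \<tau> * (D_op ^^ (v - j)) G \<tau>)"

(* At most one P satisfies this for a given F. *)
definition has_q_expansion :: "(complex \<Rightarrow> complex) \<Rightarrow> complex fps \<Rightarrow> bool" where
  "has_q_expansion F P \<longleftrightarrow> (\<forall>\<tau> \<in> upper_half_plane. (\<lambda>n. fps_nth P n * q_pow (real n) \<tau>) sums F \<tau>)"

definition U_op :: "nat \<Rightarrow> complex fps \<Rightarrow> complex fps" where
  "U_op l P = Abs_fps (\<lambda>n. fps_nth P (l * n))"

(* (q^k; q^k)_oo; for k > 0 the product converges in the X-adic topology on power series *)
definition q_poch_inf :: "nat \<Rightarrow> complex fps" where
  "q_poch_inf k = (\<Prod>n. 1 - fps_X ^ (k * Suc n))"

(* Z_(l), inside the complex numbers *)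
definition Z_localized :: "nat \<Rightarrow> complex set" where
  "Z_localized l = {of_int a / of_int b | a b. \<not> int l dvd b}"

definition fps_cong_mod :: "nat \<Rightarrow> complex fps \<Rightarrow> complex fps \<Rightarrow> bool" where
  "fps_cong_mod l P Q \<longleftrightarrow>
     (\<forall>n. fps_nth P n \<in> Z_localized l \<and> fps_nth Q n \<in> Z_localized l \<and>
          (\<exists>z \<in> Z_localized l. fps_nth P n - fps_nth Q n = of_nat l * z))"

end

theory Submission
  imports Defs
begin

text \<open>
  Write \<open>\<alpha> = t / w\<close>, \<open>v = (l - 1) / 2\<close>, \<open>f = q\<^sup>-\<^sup>\<alpha> A(q)\<close> and \<open>g = q\<^sup>\<alpha> B(q)\<close> with \<open>A B = 1\<close>. The coefficient of
  \<open>q\<^sup>n\<close> in the bracket is the sum of \<open>A\<^sub>i B\<^sub>k R(i - \<alpha>, k + \<alpha>)\<close> over \<open>i + k = n\<close>, where \<open>R\<close> is an explicit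
  form of degree \<open>v\<close>. If \<open>l\<close> divides \<open>n\<close>, the two arguments of \<open>R\<close> are negatives of each other modulo \<open>l\<close>,
  and the sum defining \<open>R(- y, y)\<close> collapses to \<open>(3 / 8) (- y)\<^sup>v\<close>. When \<open>B\<^sub>k\<close> is nonzero, \<open>w y = m\<^sup>2\<close>
  for an integer \<open>m\<close>, so by Euler's criterion the twisted symbol is \<open>1\<close> or \<open>0\<close> according to whether \<open>m\<close> is prime to
  \<open>l\<close>. Subtracting from \<open>A B = 1\<close> leaves the terms with \<open>l\<close> dividing \<open>m\<close>, which the relation
  \<open>b(l m) = \<chi>(l) b(m)\<close> turns into the left-hand side. Here \<open>l\<close> cannot divide \<open>w\<close>: otherwise a descent with
  the same relation would force \<open>g = 1\<close>, which does not have weight \<open>1/2\<close>.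

  Modularity of the bracket is Cohen's covariance identity. At a cusp, \<open>g\<close> has no zeros nearby, so its logarithmic
  derivative is bounded there, and \<open>D\<^sup>j f \<cdot> D\<^sup>i g\<close> is a polynomial in the derivatives of that logarithmic
  derivative, because \<open>f g = 1\<close>.
\<close>

text \<open>Two of the given data resist direct treatment. The number \<chi>(l) is an arbitrary
  complex number, so the left-hand side has no visible integrality and is never reduced modulo l: an
  exact identity rewrites it as part of the convolution of A and B, whose terms are integers, and
  only the symbol R is computed modulo l. And the expansion of g determines only b(m) + b(-m), so b
  enters through its sums over the fibres of m -> m^2, which inherit the relation b(l m) = \<chi>(l)
  b(m). The constants fit because \<alpha> is an integer divided by 24: this makes \<alpha> integral
  at every prime l \<ge> 5, and 24 divides l^2 - 1, so the shift t (l^2 - 1) / w is an integer. The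
  opposite weights of f and g cancel in the bracket, as do their multipliers, leaving weight 2 v = l
  - 1 and trivial character. The data are functions of \<tau>, for which q never vanishes; passing
  to power series goes through the punctured disc and continuity at 0.\<close>

no_notation fps_nth (infixl "$" 75)

subsection \<open>Rankin--Cohen brackets and Moebius transformations\<close>

lemma upper_half_plane_iff: "\<tau> \<in> upper_half_plane \<longleftrightarrow> Im \<tau> > 0"
  by (simp add: upper_half_plane_def)

lemma open_upper_half_plane [simp]: "open upper_half_plane"
  unfolding upper_half_plane_def by (rule open_halfspace_Im_gt)

lemma D_op_altdef: "D_op F = (\<lambda>\<tau>. deriv F \<tau> / (2 * of_real pi * \<i>))"
  by (rule ext) (simp add: D_op_def)

lemma holomorphic_D_op:
  "F holomorphic_on upper_half_plane \<Longrightarrow> D_op F holomorphic_on upper_half_plane"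
  unfolding D_op_altdef by (intro holomorphic_intros) auto

lemma holomorphic_D_op_funpow:
  "F holomorphic_on upper_half_plane \<Longrightarrow> (D_op ^^ n) F holomorphic_on upper_half_plane"
  by (induction n) (auto intro: holomorphic_D_op)

lemma D_op_cong:
  assumes "\<And>\<tau>. \<tau> \<in> upper_half_plane \<Longrightarrow> F \<tau> = G \<tau>" "\<tau> \<in> upper_half_plane"
  shows "D_op F \<tau> = D_op G \<tau>"
proof -
  have "eventually (\<lambda>z. z \<in> upper_half_plane) (nhds \<tau>)"
    by (rule eventually_nhds_in_open) (use assms in auto)
  hence "eventually (\<lambda>z. F z = G z) (nhds \<tau>)"
    by eventually_elim (use assms in auto)
  thus ?thesis by (auto simp: D_op_def intro: deriv_cong_ev)
qed

lemma D_op_eqI: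
  assumes "(F has_field_derivative F') (at \<tau>)"
  shows "D_op F \<tau> = F' / (2 * of_real pi * \<i>)"
  using assms by (simp add: D_op_def DERIV_imp_deriv)

lemma has_field_derivative_D_op:
  assumes "F holomorphic_on upper_half_plane" "\<tau> \<in> upper_half_plane"
  shows "(F has_field_derivative (2 * of_real pi * \<i> * D_op F \<tau>)) (at \<tau>)"
  using holomorphic_derivI[OF assms(1) open_upper_half_plane assms(2)] by (simp add: D_op_def)

lemma D_op_mult:
  assumes "F holomorphic_on upper_half_plane" "G holomorphic_on upper_half_plane" "\<tau> \<in> upper_half_plane"
  shows "D_op (\<lambda>\<tau>. F \<tau> * G \<tau>) \<tau> = D_op F \<tau> * G \<tau> + F \<tau> * D_op G \<tau>"
  by (subst D_op_eqI[OF DERIV_mult[OF has_field_derivative_D_op[OF assms(1,3)]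
        has_field_derivative_D_op[OF assms(2,3)]]]) (simp add: field_simps)

lemma D_op_add:
  assumes "F holomorphic_on upper_half_plane" "G holomorphic_on upper_half_plane" "\<tau> \<in> upper_half_plane"
  shows "D_op (\<lambda>\<tau>. F \<tau> + G \<tau>) \<tau> = D_op F \<tau> + D_op G \<tau>"
  by (subst D_op_eqI[OF DERIV_add[OF has_field_derivative_D_op[OF assms(1,3)]
        has_field_derivative_D_op[OF assms(2,3)]]]) (simp add: field_simps)

lemma D_op_cmult:
  assumes "F holomorphic_on upper_half_plane" "\<tau> \<in> upper_half_plane"
  shows "D_op (\<lambda>\<tau>. c * F \<tau>) \<tau> = c * D_op F \<tau>"
  by (subst D_op_eqI[OF DERIV_cmult[OF has_field_derivative_D_op[OF assms]]]) (simp add: field_simps)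

lemma D_op_funpow_cmult:
  assumes "F holomorphic_on upper_half_plane" "\<tau> \<in> upper_half_plane"
  shows "(D_op ^^ n) (\<lambda>\<tau>. c * F \<tau>) \<tau> = c * (D_op ^^ n) F \<tau>"
  using assms(2)
proof (induction n arbitrary: \<tau>)
  case (Suc n)
  have "(D_op ^^ Suc n) (\<lambda>\<tau>. c * F \<tau>) \<tau> = D_op (\<lambda>\<tau>. c * (D_op ^^ n) F \<tau>) \<tau>"
    using D_op_cong[OF Suc.IH Suc.prems] by simp
  also have "\<dots> = c * D_op ((D_op ^^ n) F) \<tau>"
    by (rule D_op_cmult[OF holomorphic_D_op_funpow[OF assms(1)] Suc.prems])
  finally show ?case by simp
qed simp

lemma D_op_sum:
  assumes "finite A" "\<And>i. i \<in> A \<Longrightarrow> F i holomorphic_on upper_half_plane" "\<tau> \<in> upper_half_plane"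
  shows "D_op (\<lambda>\<tau>. \<Sum>i\<in>A. F i \<tau>) \<tau> = (\<Sum>i\<in>A. D_op (F i) \<tau>)"
  using assms(1,2)
proof (induction A rule: finite_induct)
  case empty
  show ?case by (simp add: D_op_def)
next
  case (insert x A)
  have "D_op (\<lambda>\<tau>. F x \<tau> + (\<Sum>i\<in>A. F i \<tau>)) \<tau> = D_op (F x) \<tau> + D_op (\<lambda>\<tau>. \<Sum>i\<in>A. F i \<tau>) \<tau>"
    by (rule D_op_add) (use insert assms(3) in \<open>auto intro!: holomorphic_intros\<close>)
  then show ?case using insert by simp
qed

section \<open>The Moebius action and its automorphy factor\<close>

lemma SL2Z_det:
  assumes "\<gamma> \<in> SL2Z"
  shows "\<gamma> $ 1 $ 1 * \<gamma> $ 2 $ 2 - \<gamma> $ 1 $ 2 * \<gamma> $ 2 $ 1 = 1"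
  using assms by (simp add: SL2Z_def det_2)

lemma Im_aut_denom: "Im (aut_denom \<gamma> \<tau>) = of_int (\<gamma> $ 2 $ 1) * Im \<tau>"
  by (simp add: aut_denom_def)

lemma aut_denom_nonzero:
  assumes "\<gamma> \<in> SL2Z" "\<tau> \<in> upper_half_plane"
  shows "aut_denom \<gamma> \<tau> \<noteq> 0"
proof
  assume 0: "aut_denom \<gamma> \<tau> = 0"
  hence "Im (aut_denom \<gamma> \<tau>) = 0" by simp
  hence c: "\<gamma> $ 2 $ 1 = 0" using assms(2) by (simp add: Im_aut_denom upper_half_plane_iff)
  with 0 have "\<gamma> $ 2 $ 2 = 0" by (simp add: aut_denom_def)
  with c SL2Z_det[OF assms(1)] show False by simp
qed

lemma moebius_act_eq:
  "moebius_act \<gamma> \<tau> = (of_int (\<gamma> $ 1 $ 1) * \<tau> + of_int (\<gamma> $ 1 $ 2)) / aut_denom \<gamma> \<tau>"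
  by (simp add: moebius_act_def moebius_def aut_denom_def)

lemma has_field_derivative_moebius_act:
  assumes "\<gamma> \<in> SL2Z" "\<tau> \<in> upper_half_plane"
  shows "(moebius_act \<gamma> has_field_derivative 1 / aut_denom \<gamma> \<tau> ^ 2) (at \<tau>)"
proof -
  have nz: "of_int (\<gamma> $ 2 $ 1) * \<tau> + of_int (\<gamma> $ 2 $ 2) \<noteq> 0"
    using aut_denom_nonzero[OF assms] by (simp add: aut_denom_def)
  have "of_int (\<gamma> $ 1 $ 1 * \<gamma> $ 2 $ 2 - \<gamma> $ 1 $ 2 * \<gamma> $ 2 $ 1) = (1::complex)"
    using SL2Z_det[OF assms(1)] by simp
  hence det: "of_int (\<gamma> $ 1 $ 1) * of_int (\<gamma> $ 2 $ 2) = 1 + (of_int (\<gamma> $ 1 $ 2) * of_int (\<gamma> $ 2 $ 1) :: complex)"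
    by (simp add: algebra_simps)
  show ?thesis
    unfolding moebius_act_def moebius_def aut_denom_def
    by (rule derivative_eq_intros refl nz)+
       (use nz in \<open>simp add: det divide_simps power2_eq_square\<close>,
        use nz det in \<open>simp add: algebra_simps\<close>)
qed

lemma Im_moebius_act:
  assumes "\<gamma> \<in> SL2Z" "\<tau> \<in> upper_half_plane"
  shows "Im (moebius_act \<gamma> \<tau>) = Im \<tau> / norm (aut_denom \<gamma> \<tau>) ^ 2"
proof -
  have "real_of_int (\<gamma> $ 1 $ 1 * \<gamma> $ 2 $ 2 - \<gamma> $ 1 $ 2 * \<gamma> $ 2 $ 1) = 1"
    using SL2Z_det[OF assms(1)] by simp
  hence det: "real_of_int (\<gamma> $ 1 $ 1) * of_int (\<gamma> $ 2 $ 2) = 1 + (of_int (\<gamma> $ 1 $ 2) * of_int (\<gamma> $ 2 $ 1))"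
    by (simp add: algebra_simps)
  have "Im (moebius_act \<gamma> \<tau>) =
     (Im \<tau> * (of_int (\<gamma> $ 1 $ 1) * of_int (\<gamma> $ 2 $ 2) - (of_int (\<gamma> $ 1 $ 2) * of_int (\<gamma> $ 2 $ 1)))) / norm (aut_denom \<gamma> \<tau>) ^ 2"
    unfolding moebius_act_eq Im_divide cmod_power2
    by (simp add: aut_denom_def algebra_simps)
  thus ?thesis by (simp add: det)
qed

lemma moebius_act_in_upper_half_plane:
  assumes "\<gamma> \<in> SL2Z" "\<tau> \<in> upper_half_plane"
  shows "moebius_act \<gamma> \<tau> \<in> upper_half_plane"
  using Im_moebius_act[OF assms] aut_denom_nonzero[OF assms] assms(2)
  by (simp add: upper_half_plane_iff)

text \<open>The principal power is not differentiable on the negative real axis. If c = 0 the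
  automorphy factor is constant and may lie on the cut; otherwise its imaginary part c Im \<tau>
  keeps it off.\<close>

lemma has_field_derivative_aut_denom_powr:
  assumes "\<gamma> \<in> SL2Z" "\<tau> \<in> upper_half_plane"
  shows "((\<lambda>\<tau>. aut_denom \<gamma> \<tau> powr s) has_field_derivative
           s * of_int (\<gamma> $ 2 $ 1) * aut_denom \<gamma> \<tau> powr s / aut_denom \<gamma> \<tau>) (at \<tau>)"
proof (cases "\<gamma> $ 2 $ 1 = 0")
  case True
  then show ?thesis by (simp add: aut_denom_def)
next
  case False
  have "Im (aut_denom \<gamma> \<tau>) \<noteq> 0"
    using False assms(2) by (simp add: Im_aut_denom upper_half_plane_iff)
  hence "aut_denom \<gamma> \<tau> \<notin> \<real>\<^sub>\<le>\<^sub>0" by (auto simp: complex_nonpos_Reals_iff)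
  moreover have "(aut_denom \<gamma> has_field_derivative of_int (\<gamma> $ 2 $ 1)) (at \<tau>)"
    unfolding aut_denom_def by (auto intro!: derivative_eq_intros)
  ultimately have "((\<lambda>\<tau>. aut_denom \<gamma> \<tau> powr s) has_field_derivative
           s * aut_denom \<gamma> \<tau> powr (s - 1) * of_int (\<gamma> $ 2 $ 1)) (at \<tau>)"
    by (intro DERIV_chain2[of "\<lambda>z. z powr s"] has_field_derivative_powr)
  moreover have "aut_denom \<gamma> \<tau> powr (s - 1) = aut_denom \<gamma> \<tau> powr s / aut_denom \<gamma> \<tau>"
    using aut_denom_nonzero[OF assms] by (simp add: powr_diff)
  ultimately show ?thesis by (simp add: mult_ac)
qed

lemma holomorphic_aut_denom_powr:
  assumes "\<gamma> \<in> SL2Z"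
  shows "(\<lambda>\<tau>. aut_denom \<gamma> \<tau> powr s) holomorphic_on upper_half_plane"
  using has_field_derivative_aut_denom_powr[OF assms] by (auto simp: holomorphic_on_open)

lemma holomorphic_compose_moebius_act:
  assumes "\<gamma> \<in> SL2Z" "F holomorphic_on upper_half_plane"
  shows "(\<lambda>\<tau>. F (moebius_act \<gamma> \<tau>)) holomorphic_on upper_half_plane"
proof -
  have "moebius_act \<gamma> holomorphic_on upper_half_plane"
    using has_field_derivative_moebius_act[OF assms(1)] by (auto simp: holomorphic_on_open)
  from holomorphic_on_compose_gen[OF this assms(2)] moebius_act_in_upper_half_plane[OF assms(1)]
  show ?thesis by (auto simp: o_def)
qed

section \<open>Higher derivatives of functions with a transformation law\<close>

definition slash_coeff :: "complex \<Rightarrow> nat \<Rightarrow> nat \<Rightarrow> complex" where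
  "slash_coeff s n r = of_nat (n choose r) * pochhammer (s + of_nat r) (n - r)"

lemma slash_coeff_Suc_0: "slash_coeff s (Suc n) 0 = slash_coeff s n 0 * (s + of_nat n)"
  by (simp add: slash_coeff_def pochhammer_Suc)

text \<open>This is the recurrence imposed by the product rule in \<open>D_op_funpow_slash\<close>:
  differentiating the power of the automorphy factor multiplies by its exponent s + n + r + 1, and
  differentiating the r-th derivative of \<open>G\<close> raises r.\<close>

lemma slash_coeff_Suc_Suc:
  "slash_coeff s (Suc n) (Suc r) =
     slash_coeff s n (Suc r) * (s + of_nat (n + Suc r)) + slash_coeff s n r"
proof (cases "Suc r \<le> n")
  case True
  define p where "p = pochhammer (s + of_nat (Suc r)) (n - Suc r)"
  have eq: "n - r = Suc (n - Suc r)" using True by simp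
  have p1: "pochhammer (s + of_nat (Suc r)) (n - r) = p * (s + of_nat n)"
    unfolding eq p_def pochhammer_Suc using True by (simp add: of_nat_diff algebra_simps)
  have p2: "pochhammer (s + of_nat r) (n - r) = (s + of_nat r) * p"
    unfolding eq p_def pochhammer_rec by (simp add: algebra_simps)
  have "Suc r * (n choose Suc r) = (n - r) * (n choose r)"
    by (metis binomial_absorb_comp binomial_absorption mult.commute Suc_diff_Suc diff_Suc_1 times_binomial_minus1_eq zero_less_Suc binomial_absorb_comp)
  hence "of_nat (Suc r * (n choose Suc r)) = (of_nat ((n - r) * (n choose r)) :: complex)"
    by simp
  hence b: "(1 + of_nat r) * of_nat (n choose Suc r) = (of_nat n - of_nat r) * (of_nat (n choose r) :: complex)"
    using True by (simp add: of_nat_diff algebra_simps)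
  have "slash_coeff s (Suc n) (Suc r) = (of_nat (n choose r) + of_nat (n choose Suc r)) * (p * (s + of_nat n))"
    by (simp add: slash_coeff_def p1[simplified])
  also have "\<dots> = p * (of_nat (n choose Suc r) * (s + of_nat n) + of_nat (n choose r) * (s + of_nat r)
        + (of_nat n - of_nat r) * of_nat (n choose r))"
    by (simp add: algebra_simps)
  also have "\<dots> = slash_coeff s n (Suc r) * (s + of_nat (n + Suc r)) + slash_coeff s n r"
    unfolding b[symmetric] by (simp add: slash_coeff_def p2) (simp add: p_def algebra_simps)
  finally show ?thesis .
next
  case False
  then show ?thesis by (cases "r = n") (auto simp: slash_coeff_def)
qed


text \<open>Each application of D gains a factor u^2 from the chain rule, and D u = \<kappa>, so a
  derivative not spent on \<open>G\<close> leaves one factor \<kappa>. \<open>F\<close> and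
  \<open>G\<close> may differ, which covers both a multiplier on Gamma_0(N) and the passage to
  another cusp.\<close>

lemma D_op_funpow_slash:
  fixes s :: complex
  assumes \<gamma>: "\<gamma> \<in> SL2Z"
    and F: "F holomorphic_on upper_half_plane" and G: "G holomorphic_on upper_half_plane"
    and FG: "\<And>\<tau>. \<tau> \<in> upper_half_plane \<Longrightarrow> F (moebius_act \<gamma> \<tau>) = aut_denom \<gamma> \<tau> powr s * G \<tau>"
    and \<tau>: "\<tau> \<in> upper_half_plane"
  defines "\<kappa> \<equiv> of_int (\<gamma> $ 2 $ 1) / (2 * of_real pi * \<i>)"
  shows "(D_op ^^ n) F (moebius_act \<gamma> \<tau>) =
           (\<Sum>r\<le>n. slash_coeff s n r * \<kappa> ^ (n - r) * aut_denom \<gamma> \<tau> powr s * aut_denom \<gamma> \<tau> ^ (n + r)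
              * (D_op ^^ r) G \<tau>)"
  using \<tau>
proof (induction n arbitrary: \<tau>)
  case 0
  then show ?case using FG by (simp add: slash_coeff_def)
next
  case (Suc n \<tau>)
  define u where "u = aut_denom \<gamma>"
  define T where "T = (\<lambda>r \<tau>. slash_coeff s n r * \<kappa> ^ (n - r) *
                     (u \<tau> powr s * u \<tau> ^ (n + r) * (D_op ^^ r) G \<tau>))"
  have u0: "u \<tau> \<noteq> 0" using aut_denom_nonzero[OF \<gamma> Suc.prems] by (simp add: u_def)
  have pi0: "2 * complex_of_real pi * \<i> \<noteq> 0" by simp
  have u_deriv: "(u has_field_derivative (2 * of_real pi * \<i> * \<kappa>)) (at z)" for z
    unfolding u_def aut_denom_def \<kappa>_def by (auto intro!: derivative_eq_intros)
  have hu: "u holomorphic_on upper_half_plane"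
    unfolding u_def aut_denom_def by (intro holomorphic_intros)
  have hus: "(\<lambda>\<tau>. u \<tau> powr s) holomorphic_on upper_half_plane"
    unfolding u_def by (rule holomorphic_aut_denom_powr[OF \<gamma>])
  note hDG = holomorphic_D_op_funpow[OF G]
  have hu': "(\<lambda>\<tau>. u \<tau> powr s * u \<tau> ^ m) holomorphic_on upper_half_plane" for m
    by (intro holomorphic_intros hu hus)
  have Du: "D_op (\<lambda>\<tau>. u \<tau> powr s * u \<tau> ^ m) \<tau> = \<kappa> * (s + of_nat m) * u \<tau> powr s * u \<tau> ^ m / u \<tau>" for m
  proof -
    have d1: "((\<lambda>\<tau>. u \<tau> powr s) has_field_derivative
                 s * of_int (\<gamma> $ 2 $ 1) * u \<tau> powr s / u \<tau>) (at \<tau>)"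
      unfolding u_def by (rule has_field_derivative_aut_denom_powr[OF \<gamma> Suc.prems])
    have "((\<lambda>\<tau>. u \<tau> powr s * u \<tau> ^ m) has_field_derivative
             (s * of_int (\<gamma> $ 2 $ 1) * u \<tau> powr s / u \<tau>) * u \<tau> ^ m
               + (of_nat m * u \<tau> ^ (m - 1) * (2 * of_real pi * \<i> * \<kappa>)) * u \<tau> powr s) (at \<tau>)"
      by (rule DERIV_mult[OF d1]) (rule derivative_eq_intros u_deriv refl | simp)+
    note eq = D_op_eqI[OF this]
    show ?thesis
      unfolding eq using u0 by (cases m) (auto simp: \<kappa>_def divide_simps algebra_simps)
  qed
  have DT: "D_op (T r) \<tau> * u \<tau> ^ 2 =
              slash_coeff s n r * \<kappa> ^ (n - r) * u \<tau> powr s *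
                (\<kappa> * (s + of_nat (n + r)) * u \<tau> ^ (Suc n + r) * (D_op ^^ r) G \<tau>
                 + u \<tau> ^ (Suc n + Suc r) * (D_op ^^ Suc r) G \<tau>)" for r
  proof -
    have "D_op (T r) \<tau> = slash_coeff s n r * \<kappa> ^ (n - r) *
            (D_op (\<lambda>\<tau>. u \<tau> powr s * u \<tau> ^ (n + r)) \<tau> * (D_op ^^ r) G \<tau>
             + u \<tau> powr s * u \<tau> ^ (n + r) * D_op ((D_op ^^ r) G) \<tau>)"
      unfolding T_def
      by (subst D_op_cmult[OF holomorphic_on_mult[OF hu' hDG] Suc.prems],
          subst D_op_mult[OF hu' hDG Suc.prems]) (rule refl)
    thus ?thesis using u0 by (simp add: Du field_simps power2_eq_square)
  qed
  have hT: "T r holomorphic_on upper_half_plane" for r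
    unfolding T_def by (intro holomorphic_on_mult holomorphic_on_const hDG hu')
  have hDF: "(D_op ^^ n) F holomorphic_on upper_half_plane" by (rule holomorphic_D_op_funpow[OF F])
  define H where "H = (\<lambda>\<tau>. (D_op ^^ n) F (moebius_act \<gamma> \<tau>))"
  have "((D_op ^^ n) F has_field_derivative (2 * of_real pi * \<i> * D_op ((D_op ^^ n) F) (moebius_act \<gamma> \<tau>)))
           (at (moebius_act \<gamma> \<tau>))"
    by (rule has_field_derivative_D_op[OF hDF moebius_act_in_upper_half_plane[OF \<gamma> Suc.prems]])
  from DERIV_chain2[OF this has_field_derivative_moebius_act[OF \<gamma> Suc.prems]]
  have "D_op H \<tau> = (D_op ^^ Suc n) F (moebius_act \<gamma> \<tau>) / u \<tau> ^ 2"
    unfolding H_def u_def by (subst D_op_eqI) (auto simp: field_simps)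
  hence "(D_op ^^ Suc n) F (moebius_act \<gamma> \<tau>) = D_op H \<tau> * u \<tau> ^ 2"
    using u0 by simp
  also have "D_op H \<tau> = D_op (\<lambda>\<tau>. \<Sum>r\<le>n. T r \<tau>) \<tau>"
    by (rule D_op_cong[OF _ Suc.prems])
       (unfold H_def T_def u_def, subst Suc.IH, auto simp: mult_ac)
  also have "\<dots> = (\<Sum>r\<le>n. D_op (T r) \<tau>)"
    by (rule D_op_sum[OF _ hT Suc.prems]) simp
  also have "\<dots> * u \<tau> ^ 2 = (\<Sum>r\<le>n. D_op (T r) \<tau> * u \<tau> ^ 2)"
    by (rule sum_distrib_right)
  also have "\<dots> = (\<Sum>r\<le>n. slash_coeff s n r * (s + of_nat (n + r)) * (\<kappa> ^ (Suc n - r) * u \<tau> powr s *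
                    u \<tau> ^ (Suc n + r) * (D_op ^^ r) G \<tau>))
                 + (\<Sum>r\<le>n. slash_coeff s n r * (\<kappa> ^ (Suc n - Suc r) * u \<tau> powr s *
                    u \<tau> ^ (Suc n + Suc r) * (D_op ^^ Suc r) G \<tau>))"
    unfolding DT sum.distrib[symmetric]
    by (intro sum.cong refl) (simp add: Suc_diff_le algebra_simps)
  \<comment> \<open>The added term r = n + 1 is 0 because n choose (n + 1) vanishes; with it the
    index shift matches the recurrence for \<open>slash_coeff\<close>.\<close>
  also have "(\<Sum>r\<le>n. slash_coeff s n r * (s + of_nat (n + r)) * (\<kappa> ^ (Suc n - r) * u \<tau> powr s *
                    u \<tau> ^ (Suc n + r) * (D_op ^^ r) G \<tau>)) =
             (\<Sum>r\<le>Suc n. slash_coeff s n r * (s + of_nat (n + r)) * (\<kappa> ^ (Suc n - r) * u \<tau> powr s *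
                    u \<tau> ^ (Suc n + r) * (D_op ^^ r) G \<tau>))"
    by (simp add: slash_coeff_def)
  also have "\<dots> = slash_coeff s n 0 * (s + of_nat n) * (\<kappa> ^ Suc n * u \<tau> powr s * u \<tau> ^ (Suc n) * G \<tau>)
        + (\<Sum>r\<le>n. slash_coeff s n (Suc r) * (s + of_nat (n + Suc r)) * (\<kappa> ^ (Suc n - Suc r) * u \<tau> powr s *
                    u \<tau> ^ (Suc n + Suc r) * (D_op ^^ Suc r) G \<tau>))"
    by (subst sum.atMost_Suc_shift) simp
  finally have "(D_op ^^ Suc n) F (moebius_act \<gamma> \<tau>) =
     slash_coeff s (Suc n) 0 * (\<kappa> ^ Suc n * u \<tau> powr s * u \<tau> ^ (Suc n) * G \<tau>)
     + (\<Sum>r\<le>n. slash_coeff s (Suc n) (Suc r) * (\<kappa> ^ (Suc n - Suc r) * u \<tau> powr s *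
                    u \<tau> ^ (Suc n + Suc r) * (D_op ^^ Suc r) G \<tau>))"
    unfolding slash_coeff_Suc_0 slash_coeff_Suc_Suc
    by (simp only: sum.distrib distrib_right ring_distribs add_ac)
  also have "\<dots> = (\<Sum>r\<le>Suc n. slash_coeff s (Suc n) r * (\<kappa> ^ (Suc n - r) * u \<tau> powr s *
                    u \<tau> ^ (Suc n + r) * (D_op ^^ r) G \<tau>))"
    by (subst sum.atMost_Suc_shift) simp
  finally show ?case by (simp only: u_def mult_ac)
qed

section \<open>Cohen's cancellation and the covariance of the bracket\<close>

lemma of_real_gbinomial: "of_real (x gchoose k) = (of_real x gchoose k :: complex)"
  by (simp add: gbinomial_prod_rev)

text \<open>Merging the two coefficients frees the Pochhammer symbol of j. What is left of j sits in
  factorials, which form a binomial coefficient in the sum over j.\<close>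

lemma gbinomial_shift_pochhammer:
  fixes a :: complex
  assumes "r \<le> j" "j \<le> v"
  shows "((a + of_nat v - 1) gchoose (v - j)) * slash_coeff a j r =
           pochhammer (a + of_nat r) (v - r) / (fact (v - j) * fact r * fact (j - r)) * fact j"
proof -
  have "(a + of_nat v - 1) gchoose (v - j) = pochhammer (a + of_nat j) (v - j) / fact (v - j)"
    using assms by (simp add: gbinomial_pochhammer' of_nat_diff algebra_simps)
  moreover have "pochhammer (a + of_nat r) (v - r) = pochhammer (a + of_nat r) (j - r) * pochhammer (a + of_nat j) (v - j)"
    using pochhammer_product'[of "a + of_nat r" "j - r" "v - j"] assms
    by (simp add: of_nat_diff)
  ultimately show ?thesis
    using assms by (simp add: slash_coeff_def binomial_fact field_simps)
qed

text \<open>For r + q < v the Pochhammer symbols factor out and leave the alternating sum of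
  \<open>(v - r - q) choose i\<close>, that is (1 - 1)^(v - r - q) = 0. For r + q = v only j = r
  survives, for r + q > v nothing does.\<close>

lemma rankin_cohen_coeff_sum:
  fixes a b :: complex
  shows "(\<Sum>j\<le>v. (-1) ^ j * ((a + of_nat v - 1) gchoose (v - j)) * ((b + of_nat v - 1) gchoose j)
            * slash_coeff a j r * slash_coeff b (v - j) q) =
         (if r + q = v then (-1) ^ r * ((a + of_nat v - 1) gchoose (v - r)) * ((b + of_nat v - 1) gchoose r) else 0)"
   (is "?S = _")
proof -
  define f where "f = (\<lambda>j. (-1) ^ j * ((a + of_nat v - 1) gchoose (v - j)) * ((b + of_nat v - 1) gchoose j)
            * slash_coeff a j r * slash_coeff b (v - j) q)"
  have f0: "f j = 0" if "j < r \<or> v - j < q" for j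
    using that by (auto simp: f_def slash_coeff_def)
  consider "r + q > v" | "r + q = v" | "r + q < v" by linarith
  thus ?thesis
  proof cases
    case 1
    have "sum f {..v} = 0" by (rule sum.neutral) (use 1 f0 in force)
    with 1 show ?thesis by (simp add: f_def)
  next
    case 2
    have "sum f {..v} = sum f {r}"
      by (rule sum.mono_neutral_right) (use 2 in \<open>auto intro!: f0\<close>)
    thus ?thesis using 2 by (auto simp: f_def slash_coeff_def)
  next
    case 3
    define C where "C = pochhammer (a + of_nat r) (v - r) * pochhammer (b + of_nat q) (v - q)
                        / (fact r * fact q * fact (v - r - q))"
    have "sum f {..v} = sum f {r..v - q}"
      by (rule sum.mono_neutral_right) (use 3 in \<open>auto intro!: f0\<close>)
    also have "\<dots> = (\<Sum>i\<le>v - r - q. f (i + r))"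
      by (rule sum.reindex_bij_witness[of _ "\<lambda>i. i + r" "\<lambda>i. i - r"]) (use 3 in auto)
    also have "\<dots> = (\<Sum>i\<le>v - r - q. (-1) ^ r * C * ((-1) ^ i * of_nat ((v - r - q) choose i)))"
    proof (rule sum.cong[OF refl])
      fix i assume i: "i \<in> {..v - r - q}"
      define j where "j = i + r"
      have j: "r \<le> j" "j \<le> v" "q \<le> v - j" "v - j \<le> v" using i 3 by (auto simp: j_def)
      have vj: "v - (v - j) = j" using j by simp
      have A: "((a + of_nat v - 1) gchoose (v - j)) * slash_coeff a j r =
           pochhammer (a + of_nat r) (v - r) / (fact (v - j) * fact r * fact (j - r)) * fact j"
        by (rule gbinomial_shift_pochhammer) (use j in auto)
      have B: "((b + of_nat v - 1) gchoose j) * slash_coeff b (v - j) q =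
           pochhammer (b + of_nat q) (v - q) / (fact j * fact q * fact (v - j - q)) * fact (v - j)"
        using gbinomial_shift_pochhammer[OF j(3,4), of b] unfolding vj .
      have "f j = (-1) ^ j * (((a + of_nat v - 1) gchoose (v - j)) * slash_coeff a j r)
                   * (((b + of_nat v - 1) gchoose j) * slash_coeff b (v - j) q)"
        by (simp add: f_def mult_ac)
      also have "\<dots> = (-1) ^ j * C * (fact (v - r - q) / (fact (j - r) * fact (v - j - q)))"
        unfolding A B C_def by (simp add: field_simps)
      also have "fact (v - r - q) / (fact (j - r) * fact (v - j - q)) = (of_nat ((v - r - q) choose i) :: complex)"
        using i 3 by (subst binomial_fact) (auto simp: j_def algebra_simps)
      finally show "f (i + r) = (-1) ^ r * C * ((-1) ^ i * of_nat ((v - r - q) choose i))"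
        by (simp add: j_def power_add mult_ac)
    qed
    also have "\<dots> = 0"
      unfolding sum_distrib_left[symmetric] using 3 by (subst choose_alternating_sum) auto
    finally show ?thesis using 3 by (simp add: f_def)
  qed
qed

text \<open>Only the pairs with r + q = v survive the sum over j. For them the power of \<kappa> is
  trivial and the power of the automorphy factor is always v + r + q = 2 v, so it factors
  out.\<close>

lemma rankin_cohen_slash:
  fixes a b :: real
  assumes \<gamma>: "\<gamma> \<in> SL2Z"
    and hol: "F1 holomorphic_on upper_half_plane" "G1 holomorphic_on upper_half_plane"
             "F2 holomorphic_on upper_half_plane" "G2 holomorphic_on upper_half_plane"
    and FG1: "\<And>\<tau>. \<tau> \<in> upper_half_plane \<Longrightarrow> F1 (moebius_act \<gamma> \<tau>) = aut_denom \<gamma> \<tau> powr of_real a * G1 \<tau>"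
    and FG2: "\<And>\<tau>. \<tau> \<in> upper_half_plane \<Longrightarrow> F2 (moebius_act \<gamma> \<tau>) = aut_denom \<gamma> \<tau> powr of_real b * G2 \<tau>"
    and \<tau>: "\<tau> \<in> upper_half_plane"
  shows "rankin_cohen a F1 b F2 v (moebius_act \<gamma> \<tau>) =
           aut_denom \<gamma> \<tau> powr of_real a * aut_denom \<gamma> \<tau> powr of_real b * aut_denom \<gamma> \<tau> ^ (2 * v)
             * rankin_cohen a G1 b G2 v \<tau>"
proof -
  define \<kappa> :: complex where "\<kappa> = of_int (\<gamma> $ 2 $ 1) / (2 * of_real pi * \<i>)"
  define u where "u = aut_denom \<gamma> \<tau>"
  define c where "c = (\<lambda>j. (-1) ^ j * ((of_real a + of_nat v - 1) gchoose (v - j))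
                            * ((of_real b + of_nat v - 1) gchoose j) :: complex)"
  define U where "U = u powr of_real a * u powr of_real b"
  define A where "A = slash_coeff (of_real a)"
  define B where "B = slash_coeff (of_real b)"
  have rc: "rankin_cohen a F b G v z = (\<Sum>j\<le>v. c j * ((D_op ^^ j) F z * (D_op ^^ (v - j)) G z))" for F G z
    by (simp add: rankin_cohen_def c_def of_real_gbinomial mult_ac)
  have D1: "(D_op ^^ j) F1 (moebius_act \<gamma> \<tau>) =
       (\<Sum>r\<le>v. A j r * \<kappa> ^ (j - r) * u powr of_real a * u ^ (j + r) * (D_op ^^ r) G1 \<tau>)" if "j \<le> v" for j
    unfolding A_def \<kappa>_def u_def
    by (subst D_op_funpow_slash[OF \<gamma> hol(1,2) FG1 \<tau>], assumption, rule sum.mono_neutral_left)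
       (use that in \<open>auto simp: slash_coeff_def\<close>)
  have D2: "(D_op ^^ j) F2 (moebius_act \<gamma> \<tau>) =
       (\<Sum>r\<le>v. B j r * \<kappa> ^ (j - r) * u powr of_real b * u ^ (j + r) * (D_op ^^ r) G2 \<tau>)" if "j \<le> v" for j
    unfolding B_def \<kappa>_def u_def
    by (subst D_op_funpow_slash[OF \<gamma> hol(3,4) FG2 \<tau>], assumption, rule sum.mono_neutral_left)
       (use that in \<open>auto simp: slash_coeff_def\<close>)
  have "rankin_cohen a F1 b F2 v (moebius_act \<gamma> \<tau>) =
     (\<Sum>j\<le>v. c j * ((\<Sum>r\<le>v. A j r * \<kappa> ^ (j - r) * u powr of_real a * u ^ (j + r) * (D_op ^^ r) G1 \<tau>)
        * (\<Sum>q\<le>v. B (v - j) q * \<kappa> ^ (v - j - q) * u powr of_real b * u ^ (v - j + q) * (D_op ^^ q) G2 \<tau>)))"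
    unfolding rc by (intro sum.cong refl) (simp add: D1 D2)
  also have "\<dots> = (\<Sum>j\<le>v. \<Sum>r\<le>v. \<Sum>q\<le>v. c j * A j r * B (v - j) q *
                   (U * \<kappa> ^ (v - r - q) * u ^ (v + r + q) * (D_op ^^ r) G1 \<tau> * (D_op ^^ q) G2 \<tau>))"
  proof (intro sum.cong refl)
    fix j assume j: "j \<in> {..v}"
    \<comment> \<open>Natural subtraction truncates, so the exponents of \<kappa> and u combine only
      when r \<le> j and q \<le> v - j; otherwise one of the two coefficients is 0.\<close>
    have eq: "A j r * \<kappa> ^ (j - r) * x * u ^ (j + r) * y * (B (v - j) q * \<kappa> ^ (v - j - q) * x' * u ^ (v - j + q) * z)
       = A j r * B (v - j) q * (x * x' * \<kappa> ^ (v - r - q) * u ^ (v + r + q) * y * z)" for r q x x' y z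
    proof (cases "r \<le> j \<and> q \<le> v - j")
      case True
      have k: "\<kappa> ^ (v - r - q) = \<kappa> ^ (j - r) * \<kappa> ^ (v - j - q)"
        unfolding power_add[symmetric] by (rule arg_cong[of _ _ "\<lambda>n. \<kappa> ^ n"]) (use True j in auto)
      have e: "v + r + q = (j + r) + (v - j + q)" using True j by simp
      have u: "u ^ (v + r + q) = u ^ (j + r) * u ^ (v - j + q)"
        unfolding e by (rule power_add)
      show ?thesis unfolding k u by (simp only: mult_ac)
    next
      case False
      hence "A j r = 0 \<or> B (v - j) q = 0" by (auto simp: A_def B_def slash_coeff_def)
      thus ?thesis by auto
    qed
    show "c j * ((\<Sum>r\<le>v. A j r * \<kappa> ^ (j - r) * u powr of_real a * u ^ (j + r) * (D_op ^^ r) G1 \<tau>)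
        * (\<Sum>q\<le>v. B (v - j) q * \<kappa> ^ (v - j - q) * u powr of_real b * u ^ (v - j + q) * (D_op ^^ q) G2 \<tau>))
       = (\<Sum>r\<le>v. \<Sum>q\<le>v. c j * A j r * B (v - j) q *
                   (U * \<kappa> ^ (v - r - q) * u ^ (v + r + q) * (D_op ^^ r) G1 \<tau> * (D_op ^^ q) G2 \<tau>))"
      by (subst sum_product, unfold sum_distrib_left, intro sum.cong refl, subst eq)
         (simp only: U_def mult_ac)
  qed
  also have "\<dots> = (\<Sum>r\<le>v. \<Sum>q\<le>v. (\<Sum>j\<le>v. c j * A j r * B (v - j) q) *
                   (U * \<kappa> ^ (v - r - q) * u ^ (v + r + q) * (D_op ^^ r) G1 \<tau> * (D_op ^^ q) G2 \<tau>))"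
    unfolding sum_distrib_right
    by (subst sum.swap, rule sum.cong[OF refl], rule sum.swap)
  also have "\<dots> = (\<Sum>r\<le>v. \<Sum>q\<le>v. if q = v - r then c r *
                   (U * u ^ (2 * v) * (D_op ^^ r) G1 \<tau> * (D_op ^^ (v - r)) G2 \<tau>) else 0)"
  proof (intro sum.cong refl)
    fix r q assume rq: "r \<in> {..v}" "q \<in> {..v}"
    have "(\<Sum>j\<le>v. c j * A j r * B (v - j) q) = (if r + q = v then c r else 0)"
      unfolding c_def A_def B_def by (rule rankin_cohen_coeff_sum)
    thus "(\<Sum>j\<le>v. c j * A j r * B (v - j) q) *
                   (U * \<kappa> ^ (v - r - q) * u ^ (v + r + q) * (D_op ^^ r) G1 \<tau> * (D_op ^^ q) G2 \<tau>)
        = (if q = v - r then c r *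
                   (U * u ^ (2 * v) * (D_op ^^ r) G1 \<tau> * (D_op ^^ (v - r)) G2 \<tau>) else 0)"
      using rq by (auto simp: mult_2)
  qed
  also have "\<dots> = U * u ^ (2 * v) * rankin_cohen a G1 b G2 v \<tau>"
    unfolding rc sum_distrib_left by (simp add: mult_ac)
  finally show ?thesis by (simp only: U_def u_def)
qed

subsection \<open>Behaviour at the cusps\<close>

lemma periodic_int_shift:
  fixes p :: "complex \<Rightarrow> complex" and \<omega> :: real
  assumes "\<And>\<tau>. \<tau> \<in> upper_half_plane \<Longrightarrow> p (\<tau> + of_real \<omega>) = p \<tau>" "\<tau> \<in> upper_half_plane"
  shows "p (\<tau> + of_int n * of_real \<omega>) = p \<tau>"
proof -
  have nat: "p (\<tau> + of_nat n * of_real \<omega>) = p \<tau>" if "\<tau> \<in> upper_half_plane" for n \<tau>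
  proof (induction n)
    case (Suc n)
    have "p ((\<tau> + of_nat n * of_real \<omega>) + of_real \<omega>) = p (\<tau> + of_nat n * of_real \<omega>)"
      by (rule assms(1)) (use that in \<open>simp add: upper_half_plane_iff\<close>)
    with Suc show ?case by (simp add: algebra_simps)
  qed auto
  show ?thesis
  proof (cases "n \<ge> 0")
    case True
    then show ?thesis using nat[OF assms(2), of "nat n"] by simp
  next
    case False
    have "p ((\<tau> + of_int n * of_real \<omega>) + of_nat (nat (-n)) * of_real \<omega>) = p (\<tau> + of_int n * of_real \<omega>)"
      by (rule nat) (use assms(2) in \<open>simp add: upper_half_plane_iff\<close>)
    thus ?thesis using False by simp
  qed
qed

text \<open>\<open>Ln\<close> alone gives holomorphy only off the negative axis. A second branch of
  the logarithm is holomorphic across it, and periodicity of \<open>p\<close> makes both branches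
  yield the same function, so the cut disappears.\<close>

lemma periodic_factors_through_exp:
  fixes p :: "complex \<Rightarrow> complex" and \<omega> :: real
  assumes hol: "p holomorphic_on upper_half_plane" and \<omega>: "\<omega> > 0"
    and per: "\<And>\<tau>. \<tau> \<in> upper_half_plane \<Longrightarrow> p (\<tau> + of_real \<omega>) = p \<tau>"
  defines "L \<equiv> (\<lambda>z. of_real \<omega> * Ln z / (2 * of_real pi * \<i>))"
  shows "(\<lambda>z. p (L z)) holomorphic_on ball 0 1 - {0}"
    and "\<And>\<tau>. \<tau> \<in> upper_half_plane \<Longrightarrow> p (L (exp (2 * of_real pi * \<i> * \<tau> / of_real \<omega>))) = p \<tau>"
proof -
  have ImL: "Im (of_real \<omega> * w / (2 * of_real pi * \<i>)) = - \<omega> * Re w / (2 * pi)" for w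
    by (simp add: Im_divide power2_eq_square field_simps)
  have L_upper: "of_real \<omega> * Ln z / (2 * of_real pi * \<i>) \<in> upper_half_plane" if "z \<in> ball 0 1 - {0}" for z
  proof -
    have "ln (norm z) < 0" using that by simp
    hence "\<omega> * ln (norm z) < 0" using \<omega> by (rule mult_pos_neg[rotated])
    thus ?thesis using that unfolding upper_half_plane_iff ImL by (simp add: Re_Ln field_simps)
  qed
  have key: "p (L z) = p \<tau>"
    if "\<tau> \<in> upper_half_plane" "exp (2 * of_real pi * \<i> * \<tau> / of_real \<omega>) = z" for z \<tau>
  proof -
    have "z \<noteq> 0" using that(2) by auto
    hence "exp (2 * of_real pi * \<i> * \<tau> / of_real \<omega>) = exp (Ln z)" using that(2) by simp
    then obtain n where n: "2 * of_real pi * \<i> * \<tau> / of_real \<omega> = Ln z + of_real (of_int (2 * n) * pi) * \<i>"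
      by (auto simp: exp_eq)
    have "L z = of_real \<omega> * (2 * of_real pi * \<i> * \<tau> / of_real \<omega> - of_real (of_int (2 * n) * pi) * \<i>) / (2 * of_real pi * \<i>)"
      unfolding L_def n by simp
    also have "\<dots> = \<tau> + of_int (-n) * of_real \<omega>"
      using \<omega> by (simp add: field_simps)
    finally have "L z = \<tau> + of_int (-n) * of_real \<omega>" .
    with periodic_int_shift[where p = p and \<omega> = \<omega>, OF per that(1), of "- n"] show ?thesis by simp
  qed
  show "p (L (exp (2 * of_real pi * \<i> * \<tau> / of_real \<omega>))) = p \<tau>" if "\<tau> \<in> upper_half_plane" for \<tau>
    using key[OF that refl] .
  define A where "A = ball (0::complex) 1 - \<real>\<^sub>\<le>\<^sub>0"
  define B where "B = ball (0::complex) 1 - \<real>\<^sub>\<ge>\<^sub>0"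
  have A: "(\<lambda>z. p (L z)) holomorphic_on A"
  proof -
    have "L holomorphic_on A" unfolding L_def A_def by (intro holomorphic_intros) auto
    from holomorphic_on_compose_gen[OF this hol] show ?thesis
      using L_upper by (force simp: A_def o_def L_def)
  qed
  \<comment> \<open>Ln (-z) + i pi is a logarithm of z with its cut on the positive axis; the
    summand i pi turns into the half period \<omega> / 2.\<close>
  define L' where "L' = (\<lambda>z. of_real \<omega> * Ln (-z) / (2 * of_real pi * \<i>) + of_real \<omega> / 2)"
  have L'_upper: "L' z \<in> upper_half_plane" if "z \<in> B" for z
  proof -
    have "z \<noteq> 0" using that by (auto simp: B_def)
    thus ?thesis using L_upper[of "-z"] that by (auto simp: L'_def B_def upper_half_plane_iff)
  qed
  have "(\<lambda>z. p (L' z)) holomorphic_on B"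
  proof -
    have "L' holomorphic_on B" unfolding L'_def B_def
      by (intro holomorphic_intros) (auto simp: complex_nonpos_Reals_iff complex_nonneg_Reals_iff)
    from holomorphic_on_compose_gen[OF this hol] show ?thesis
      using L'_upper by (force simp: o_def)
  qed
  also have "?this \<longleftrightarrow> (\<lambda>z. p (L z)) holomorphic_on B"
  proof (rule holomorphic_cong[OF refl])
    fix z assume z: "z \<in> B"
    hence z0: "z \<noteq> 0" by (auto simp: B_def)
    have "2 * of_real pi * \<i> * L' z / of_real \<omega> = Ln (-z) + of_real pi * \<i>"
      using \<omega> by (simp add: L'_def field_simps)
    hence "exp (2 * of_real pi * \<i> * L' z / of_real \<omega>) = z"
      using z0 by (simp add: exp_add)
    from key[OF L'_upper[OF z] this] show "p (L' z) = p (L z)" ..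
  qed
  finally have B: "(\<lambda>z. p (L z)) holomorphic_on B" .
  have "(\<lambda>z. p (L z)) holomorphic_on A \<union> B"
    by (rule holomorphic_on_Un[OF A B])
       (auto simp: A_def B_def intro!: open_Diff closed_nonpos_Reals_complex closed_nonneg_Reals_complex)
  also have "A \<union> B = ball 0 1 - {0}"
    by (auto simp: A_def B_def complex_nonpos_Reals_iff complex_nonneg_Reals_iff complex_eq_iff)
  finally show "(\<lambda>z. p (L z)) holomorphic_on ball 0 1 - {0}" .
qed

text \<open>\<open>g\<close> may vanish at 0 to some order n. Writing g = h z^n with h(0) nonzero
  gives z g'/g = n + z h'/h, and the last term is continuous on a closed disc.\<close>

lemma logderiv_bounded_at_puncture:
  assumes hol: "g holomorphic_on ball 0 1" and nz: "\<And>z. z \<in> ball 0 1 - {0} \<Longrightarrow> g z \<noteq> 0"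
  shows "\<exists>r B. r > 0 \<and> r < 1 \<and> (\<forall>z. z \<noteq> 0 \<and> norm z < r \<longrightarrow> norm (z * deriv g z / g z) \<le> B)"
proof -
  have an: "g analytic_on {0}"
    using hol by (auto simp: analytic_at intro!: exI[of _ "ball 0 1"])
  have "\<exists>\<^sub>F w in at 0. g w \<noteq> 0"
  proof (rule eventually_frequently)
    have "eventually (\<lambda>w. w \<in> ball 0 1 - {0}) (at (0::complex))"
      by (intro eventually_at_in_open) auto
    thus "eventually (\<lambda>w. g w \<noteq> 0) (at 0)" by eventually_elim (use nz in auto)
  qed auto
  from zorder_exist[OF isolated_singularity_at_analytic[OF an] not_essential_analytic[OF an] this]
  obtain h r n where r: "r > 0" and h: "h holomorphic_on cball 0 r" "h 0 \<noteq> 0"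
    and gh: "\<And>w. w \<in> cball 0 r - {0} \<Longrightarrow> g w = h w * w powi n \<and> h w \<noteq> 0" by force
  define s where "s = min (r / 2) (1 / 2)"
  have s: "s > 0" "s < r" "s < 1" using r by (auto simp: s_def)
  have holb: "h holomorphic_on ball 0 r" using h(1) by (rule holomorphic_on_subset) auto
  have hnz: "h w \<noteq> 0" if "w \<in> cball 0 s" for w
    using gh[of w] that s h(2) by (cases "w = 0") auto
  have "compact ((\<lambda>z. z * deriv h z / h z) ` cball 0 s)"
  proof (rule compact_continuous_image)
    have "(\<lambda>z. z * deriv h z) holomorphic_on ball 0 r" using holb by (intro holomorphic_intros) auto
    hence "continuous_on (ball 0 r) (\<lambda>z. z * deriv h z)" "continuous_on (ball 0 r) h"
      using holb by (auto intro: holomorphic_on_imp_continuous_on)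
    moreover have "cball 0 s \<subseteq> ball (0::complex) r" using s by auto
    ultimately have "continuous_on (cball 0 s) (\<lambda>z. z * deriv h z)" "continuous_on (cball 0 s) h"
      by (blast intro: continuous_on_subset)+
    thus "continuous_on (cball 0 s) (\<lambda>z. z * deriv h z / h z)"
      using hnz by (intro continuous_on_divide) auto
  qed auto
  hence "bounded ((\<lambda>z. z * deriv h z / h z) ` cball 0 s)" by (rule compact_imp_bounded)
  then obtain B where B: "\<And>z. z \<in> cball 0 s \<Longrightarrow> norm (z * deriv h z / h z) \<le> B"
    by (force simp: bounded_iff)
  have "norm (z * deriv g z / g z) \<le> \<bar>of_int n\<bar> + B" if z: "z \<noteq> 0" "norm z < s" for z
  proof -
    have dh: "(h has_field_derivative deriv h z) (at z)"
      by (rule holomorphic_derivI[OF holb]) (use z s in auto)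
    have "eventually (\<lambda>w. w \<in> ball 0 r - {0}) (nhds z)"
      by (rule eventually_nhds_in_open) (use z s in auto)
    hence ev: "eventually (\<lambda>w. h w * w powi n = g w) (nhds z)"
      by eventually_elim (use gh in auto)
    have "(g has_field_derivative
             (deriv h z * z powi n + (of_int n * z powi (n - 1) * 1) * h z)) (at z)"
      by (rule iffD1[OF DERIV_cong_ev[OF refl ev refl] DERIV_mult[OF dh DERIV_power_int[OF DERIV_ident disjI2[OF z(1)]]]])
    hence "deriv g z = deriv h z * z powi n + (of_int n * z powi (n - 1)) * h z"
      by (simp add: DERIV_imp_deriv)
    moreover have "g z = h z * z powi n" "h z \<noteq> 0" using gh[of z] z s by auto
    moreover have "z powi (n - 1) = z powi n / z" using z by (simp add: power_int_diff)
    ultimately have "z * deriv g z / g z = of_int n + z * deriv h z / h z"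
      using z by (simp add: field_simps)
    also have "norm \<dots> \<le> norm (of_int n :: complex) + norm (z * deriv h z / h z)" by (rule norm_triangle_ineq)
    also have "\<dots> \<le> \<bar>of_int n\<bar> + B" using B[of z] z by (intro add_mono) auto
    finally show ?thesis .
  qed
  thus ?thesis using s by blast
qed

text \<open>Dividing \<open>H\<close> by exp(2 pi i \<kappa> \<tau> / \<omega>) makes it periodic,
  hence a function g of z = exp(2 pi i \<tau> / \<omega>). Boundedness makes the singularity at z =
  0 removable, and D H / H = (z g'/g + \<kappa>) / \<omega>.\<close>

lemma logderiv_bounded_at_ii_infinity:
  fixes H :: "complex \<Rightarrow> complex" and \<omega> B C :: real
  assumes hol: "H holomorphic_on upper_half_plane" and nz: "\<And>\<tau>. \<tau> \<in> upper_half_plane \<Longrightarrow> H \<tau> \<noteq> 0"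
    and \<omega>: "\<omega> > 0"
    and per: "\<And>\<tau>. \<tau> \<in> upper_half_plane \<Longrightarrow> H (\<tau> + of_real \<omega>) = \<epsilon> * H \<tau>"
    and bdd: "\<And>\<tau>. Im \<tau> > max 0 C \<Longrightarrow> norm (H \<tau>) \<le> B"
  shows "\<exists>B' C'. \<forall>\<tau>. Im \<tau> > max 0 C' \<longrightarrow> norm (D_op H \<tau> / H \<tau>) \<le> B'"
proof -
  define e where "e = (\<lambda>\<tau>. exp (2 * of_real pi * \<i> * \<tau> / of_real \<omega>))"
  have "\<i> \<in> upper_half_plane" "\<i> + of_real \<omega> \<in> upper_half_plane" by (auto simp: upper_half_plane_iff)
  hence \<epsilon>: "\<epsilon> \<noteq> 0" using per[of \<i>] nz by auto
  (* subtracting 1 makes Re \<kappa> nonpositive, so that p below is bounded near the cusp *)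
  define \<kappa> where "\<kappa> = Ln \<epsilon> / (2 * of_real pi * \<i>) - 1"
  have exp\<kappa>: "exp (2 * of_real pi * \<i> * \<kappa>) = \<epsilon>"
    using \<epsilon> by (simp add: \<kappa>_def right_diff_distrib exp_diff)
  have "Re \<kappa> = Im (Ln \<epsilon>) / (2 * pi) - 1"
    by (simp add: \<kappa>_def Re_divide power2_eq_square field_simps)
  moreover have "Im (Ln \<epsilon>) \<le> 2 * pi"
    using Im_Ln_le_pi[OF \<epsilon>] pi_gt_zero by linarith
  hence "Im (Ln \<epsilon>) / (2 * pi) \<le> 1" by simp
  ultimately have Re\<kappa>: "Re \<kappa> \<le> 0" by simp
  define p where "p = (\<lambda>\<tau>. H \<tau> * exp (- (2 * of_real pi * \<i> * \<kappa> * \<tau> / of_real \<omega>)))"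
  have p_hol: "p holomorphic_on upper_half_plane"
    unfolding p_def using hol \<omega> by (intro holomorphic_intros) auto
  have p_per: "p (\<tau> + of_real \<omega>) = p \<tau>" if "\<tau> \<in> upper_half_plane" for \<tau>
  proof -
    have "exp (- (2 * of_real pi * \<i> * \<kappa> * (\<tau> + of_real \<omega>) / of_real \<omega>)) =
          exp (- (2 * of_real pi * \<i> * \<kappa> * \<tau> / of_real \<omega>)) / exp (2 * of_real pi * \<i> * \<kappa>)"
    proof -
      have "- (2 * of_real pi * \<i> * \<kappa> * (\<tau> + of_real \<omega>) / of_real \<omega>) =
            - (2 * of_real pi * \<i> * \<kappa> * \<tau> / of_real \<omega>) - 2 * of_real pi * \<i> * \<kappa>"
        using \<omega> by (simp add: distrib_left add_divide_distrib)
      thus ?thesis by (simp only: exp_diff)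
    qed
    thus ?thesis using \<epsilon> per[OF that] by (simp add: p_def exp\<kappa>)
  qed
  define L where "L = (\<lambda>z. of_real \<omega> * Ln z / (2 * of_real pi * \<i>))"
  define G where "G = (\<lambda>z. p (L z))"
  have G_hol: "G holomorphic_on ball 0 1 - {0}" and G: "\<And>\<tau>. \<tau> \<in> upper_half_plane \<Longrightarrow> G (e \<tau>) = p \<tau>"
    unfolding G_def L_def e_def using periodic_factors_through_exp[OF p_hol \<omega> p_per] by auto
  have ImL: "Im (L z) = - \<omega> * ln (norm z) / (2 * pi)" if "z \<noteq> 0" for z
    using that by (simp add: L_def Im_divide power2_eq_square field_simps)
  have G_bdd: "norm (G z) \<le> B * exp (\<bar>Im \<kappa>\<bar> * pi)"
    if z: "z \<noteq> 0" "norm z < 1" "norm z < exp (- 2 * pi * max 0 C / \<omega>)" for z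
  proof -
    define M where "M = max 0 C"
    have "ln (norm z) < - 2 * pi * M / \<omega>"
      unfolding M_def
      using z by (metis ln_exp ln_less_cancel_iff zero_less_norm_iff exp_gt_zero)
    hence "Im (L z) > M" using z \<omega> by (simp add: ImL field_simps)
    hence Im: "Im (L z) > max 0 C" by (simp only: M_def)
    have eq: "- (2 * of_real pi * \<i> * \<kappa> * L z / of_real \<omega>) = - \<kappa> * Ln z"
      using \<omega> by (simp add: L_def field_simps)
    \<comment> \<open>Re (-\<kappa> Ln z) splits into a part with ln |z|, where the signs of Re
      \<kappa> and ln |z| help, and a part with the argument of z, which is at most pi in absolute
      value.\<close>
    have "- Re \<kappa> * ln (norm z) \<le> 0"
      using Re\<kappa> z by (intro mult_nonneg_nonpos) auto
    moreover have "Im \<kappa> * Im (Ln z) \<le> \<bar>Im \<kappa>\<bar> * pi"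
    proof -
      have "\<bar>Im (Ln z)\<bar> \<le> pi" using mpi_less_Im_Ln[OF z(1)] Im_Ln_le_pi[OF z(1)] by linarith
      hence "\<bar>Im \<kappa>\<bar> * \<bar>Im (Ln z)\<bar> \<le> \<bar>Im \<kappa>\<bar> * pi" by (intro mult_left_mono) auto
      thus ?thesis by (metis abs_le_D1 abs_mult)
    qed
    ultimately have "Re (- \<kappa> * Ln z) \<le> \<bar>Im \<kappa>\<bar> * pi" using z by (simp add: Re_Ln)
    hence "norm (exp (- \<kappa> * Ln z)) \<le> exp (\<bar>Im \<kappa>\<bar> * pi)" by simp
    moreover have "norm (H (L z)) \<le> B" using bdd[OF Im] .
    moreover have "0 \<le> B" using bdd[OF Im] norm_ge_zero order_trans by blast
    ultimately have "norm (H (L z)) * norm (exp (- \<kappa> * Ln z)) \<le> B * exp (\<bar>Im \<kappa>\<bar> * pi)"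
      by (intro mult_mono) auto
    thus ?thesis by (simp only: G_def p_def eq norm_mult)
  qed
  have "\<exists>g. g holomorphic_on ball 0 1 \<and> (\<forall>z \<in> ball 0 1 - {0}. g z = G z)"
  proof (subst holomorphic_on_extend_bounded[OF G_hol])
    define d where "d = min 1 (exp (- 2 * pi * max 0 C / \<omega>))"
    have "eventually (\<lambda>z. z \<in> ball 0 d - {0}) (at (0::complex))"
      by (rule eventually_at_in_open) (auto simp: d_def)
    hence "eventually (\<lambda>z. norm (G z) \<le> B * exp (\<bar>Im \<kappa>\<bar> * pi)) (at 0)"
      by eventually_elim (auto simp: d_def intro!: G_bdd)
    thus "\<exists>B. eventually (\<lambda>z. norm (G z) \<le> B) (at 0)" by blast
  qed auto
  then obtain g where g: "g holomorphic_on ball 0 1" and gG: "\<And>z. z \<in> ball 0 1 - {0} \<Longrightarrow> g z = G z"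
    by blast
  have e_ball: "e \<tau> \<in> ball 0 1 - {0}" if "\<tau> \<in> upper_half_plane" for \<tau>
    using that \<omega> by (simp add: e_def upper_half_plane_iff norm_exp_eq_Re)
  have ge: "g (e \<tau>) = p \<tau>" if "\<tau> \<in> upper_half_plane" for \<tau>
    using gG[OF e_ball[OF that]] G[OF that] by simp
  have "g z \<noteq> 0" if "z \<in> ball 0 1 - {0}" for z
  proof -
    have "ln (norm z) < 0" using that by simp
    hence "\<omega> * ln (norm z) < 0" using \<omega> by (rule mult_pos_neg[rotated])
    hence "L z \<in> upper_half_plane" using that by (simp add: upper_half_plane_iff ImL divide_neg_pos)
    thus ?thesis using gG[OF that] nz by (simp add: G_def p_def)
  qed
  from logderiv_bounded_at_puncture[OF g this] obtain r B1 where r: "r > 0" "r < 1"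
    and B1: "\<And>z. z \<noteq> 0 \<Longrightarrow> norm z < r \<Longrightarrow> norm (z * deriv g z / g z) \<le> B1" by blast
  have "norm (D_op H \<tau> / H \<tau>) \<le> B1 / \<omega> + norm (\<kappa> / of_real \<omega>)"
    if \<tau>: "Im \<tau> > max 0 (- \<omega> * ln r / (2 * pi))" for \<tau>
  proof -
    have up: "\<tau> \<in> upper_half_plane" using \<tau> by (simp add: upper_half_plane_iff)
    define z where "z = e \<tau>"
    have z: "z \<noteq> 0" "norm z < 1" using e_ball[OF up] by (auto simp: z_def)
    have zr: "norm z < r"
    proof -
      have "- 2 * pi * Im \<tau> / \<omega> < ln r" using \<tau> \<omega> by (simp add: field_simps)
      hence "exp (- 2 * pi * Im \<tau> / \<omega>) < exp (ln r)" by simp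
      thus ?thesis using r by (simp add: z_def e_def norm_exp_eq_Re)
    qed
    define E where "E = (\<lambda>\<tau>. exp (2 * of_real pi * \<i> * \<kappa> * \<tau> / of_real \<omega>))"
    have H: "H \<tau> = g (e \<tau>) * E \<tau>" if "\<tau> \<in> upper_half_plane" for \<tau>
      using ge[OF that] by (simp add: p_def E_def exp_minus)
    have dg: "(g has_field_derivative deriv g z) (at (e \<tau>))"
      unfolding z_def by (rule holomorphic_derivI[OF g]) (use e_ball[OF up] in auto)
    have de: "(e has_field_derivative (2 * of_real pi * \<i> / of_real \<omega>) * z) (at \<tau>)"
      unfolding e_def z_def by (rule derivative_eq_intros refl | use \<omega> in simp)+
    have dE: "(E has_field_derivative (2 * of_real pi * \<i> * \<kappa> / of_real \<omega>) * E \<tau>) (at \<tau>)"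
      unfolding E_def by (rule derivative_eq_intros refl | use \<omega> in simp)+
    have "D_op H \<tau> = D_op (\<lambda>\<tau>. g (e \<tau>) * E \<tau>) \<tau>"
      by (rule D_op_cong[OF H up])
    also have "\<dots> = (deriv g z * ((2 * of_real pi * \<i> / of_real \<omega>) * z) * E \<tau> +
                     (2 * of_real pi * \<i> * \<kappa> / of_real \<omega>) * E \<tau> * g (e \<tau>)) / (2 * of_real pi * \<i>)"
      by (rule D_op_eqI[OF DERIV_mult[OF DERIV_chain2[OF dg de] dE]])
    also have "\<dots> = E \<tau> * (z * deriv g z / of_real \<omega> + \<kappa> / of_real \<omega> * g z)"
      using \<omega> by (simp add: field_simps z_def)
    finally have "D_op H \<tau> / H \<tau> = (z * deriv g z / g z) / of_real \<omega> + \<kappa> / of_real \<omega>"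
      using H[OF up] nz[OF up] \<omega> by (simp add: z_def[symmetric] field_simps)
    also have "norm \<dots> \<le> norm (z * deriv g z / g z) / \<omega> + norm (\<kappa> / of_real \<omega>)"
      using \<omega> by (intro order_trans[OF norm_triangle_ineq]) (simp add: norm_divide norm_mult)
    also have "\<dots> \<le> B1 / \<omega> + norm (\<kappa> / of_real \<omega>)"
      using B1[OF z(1) zr] \<omega> by (intro add_mono divide_right_mono) auto
    finally show ?thesis .
  qed
  thus ?thesis by blast
qed

section \<open>An algebra of functions bounded near infinity, stable under D\<close>

definition bounded_at_ii_infinity :: "(complex \<Rightarrow> complex) \<Rightarrow> bool" where
  "bounded_at_ii_infinity p \<longleftrightarrow> p holomorphic_on upper_half_plane \<and>
     (\<exists>B C. \<forall>\<tau>. Im \<tau> > max 0 C \<longrightarrow> norm (p \<tau>) \<le> B)"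

lemma bounded_at_ii_infinity_const: "bounded_at_ii_infinity (\<lambda>_. c)"
  by (auto simp: bounded_at_ii_infinity_def)

lemma bounded_at_ii_infinity_add:
  assumes "bounded_at_ii_infinity p" "bounded_at_ii_infinity q"
  shows "bounded_at_ii_infinity (\<lambda>\<tau>. p \<tau> + q \<tau>)"
proof -
  from assms obtain B C B' C' where
    *: "\<And>\<tau>. Im \<tau> > max 0 C \<Longrightarrow> norm (p \<tau>) \<le> B" "\<And>\<tau>. Im \<tau> > max 0 C' \<Longrightarrow> norm (q \<tau>) \<le> B'"
    unfolding bounded_at_ii_infinity_def by blast
  have "norm (p \<tau> + q \<tau>) \<le> B + B'" if "Im \<tau> > max 0 (max C C')" for \<tau>
    by (rule norm_triangle_mono) (use * that in auto)
  moreover have "(\<lambda>\<tau>. p \<tau> + q \<tau>) holomorphic_on upper_half_plane"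
    using assms by (auto simp: bounded_at_ii_infinity_def intro: holomorphic_intros)
  ultimately show ?thesis unfolding bounded_at_ii_infinity_def by blast
qed

lemma bounded_at_ii_infinity_mult:
  assumes "bounded_at_ii_infinity p" "bounded_at_ii_infinity q"
  shows "bounded_at_ii_infinity (\<lambda>\<tau>. p \<tau> * q \<tau>)"
proof -
  from assms obtain B C B' C' where
    *: "\<And>\<tau>. Im \<tau> > max 0 C \<Longrightarrow> norm (p \<tau>) \<le> B" "\<And>\<tau>. Im \<tau> > max 0 C' \<Longrightarrow> norm (q \<tau>) \<le> B'"
    unfolding bounded_at_ii_infinity_def by blast
  have "norm (p \<tau> * q \<tau>) \<le> B * B'" if \<tau>: "Im \<tau> > max 0 (max C C')" for \<tau>
    unfolding norm_mult
  proof (rule mult_mono)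
    show 1: "norm (p \<tau>) \<le> B" and "norm (q \<tau>) \<le> B'" using * \<tau> by auto
    show "0 \<le> B" using order_trans[OF norm_ge_zero 1] .
  qed auto
  moreover have "(\<lambda>\<tau>. p \<tau> * q \<tau>) holomorphic_on upper_half_plane"
    using assms by (auto simp: bounded_at_ii_infinity_def intro: holomorphic_intros)
  ultimately show ?thesis unfolding bounded_at_ii_infinity_def by blast
qed

lemma bounded_at_ii_infinity_sum:
  assumes "\<And>i. i \<in> A \<Longrightarrow> bounded_at_ii_infinity (p i)"
  shows "bounded_at_ii_infinity (\<lambda>\<tau>. \<Sum>i\<in>A. p i \<tau>)"
  using assms by (induction A rule: infinite_finite_induct)
    (auto intro: bounded_at_ii_infinity_const bounded_at_ii_infinity_add)

text \<open>Cauchy's estimate on the disc of radius 1 around \<tau>; the threshold grows by 1 so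
  that the disc stays in the region of boundedness. Holomorphy is part of
  \<open>bounded_at_ii_infinity\<close> for the sake of this step.\<close>

lemma bounded_at_ii_infinity_D_op:
  assumes "bounded_at_ii_infinity p"
  shows "bounded_at_ii_infinity (D_op p)"
proof -
  from assms obtain B C where hol: "p holomorphic_on upper_half_plane"
    and *: "\<And>\<tau>. Im \<tau> > max 0 C \<Longrightarrow> norm (p \<tau>) \<le> B"
    unfolding bounded_at_ii_infinity_def by blast
  have "norm (D_op p \<tau>) \<le> B / (2 * pi)" if \<tau>: "Im \<tau> > max 0 (max 0 C + 1)" for \<tau>
  proof -
    have Im: "Im w > max 0 C" if "w \<in> cball \<tau> 1" for w
      using abs_Im_le_cmod[of "\<tau> - w"] that \<tau> by (auto simp: dist_norm)
    hence sub: "cball \<tau> 1 \<subseteq> upper_half_plane" by (force simp: upper_half_plane_iff)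
    have "norm ((deriv ^^ 1) p \<tau>) \<le> fact 1 * B / 1 ^ 1"
    proof (rule Cauchy_inequality)
      show "p holomorphic_on ball \<tau> 1" using hol by (rule holomorphic_on_subset) (use sub in auto)
      show "continuous_on (cball \<tau> 1) p"
        using holomorphic_on_imp_continuous_on[OF hol] sub by (rule continuous_on_subset)
      show "norm (p x) \<le> B" if "norm (\<tau> - x) = 1" for x
        using Im[of x] that by (intro *) (auto simp: dist_norm)
    qed auto
    thus ?thesis by (simp add: D_op_def norm_divide norm_mult divide_right_mono)
  qed
  thus ?thesis using holomorphic_D_op[OF hol] unfolding bounded_at_ii_infinity_def by blast
qed

text \<open>D (h P) = h (\<phi> P + D P), so the cofactor of \<open>h\<close> stays in the algebra.
  The hypothesis has a form that 1 / h also satisfies, with -\<phi> in place of \<phi>.\<close>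

lemma D_op_funpow_quotient_bounded:
  assumes h: "h holomorphic_on upper_half_plane" and \<phi>: "bounded_at_ii_infinity \<phi>"
    and D: "\<And>\<tau>. \<tau> \<in> upper_half_plane \<Longrightarrow> D_op h \<tau> = h \<tau> * \<phi> \<tau>"
  shows "\<exists>P. bounded_at_ii_infinity P \<and> (\<forall>\<tau>\<in>upper_half_plane. (D_op ^^ n) h \<tau> = h \<tau> * P \<tau>)"
proof (induction n)
  case 0
  show ?case by (rule exI[of _ "\<lambda>_. 1"]) (auto intro: bounded_at_ii_infinity_const)
next
  case (Suc n)
  then obtain P where P: "bounded_at_ii_infinity P"
    and eq: "\<And>\<tau>. \<tau>\<in>upper_half_plane \<Longrightarrow> (D_op ^^ n) h \<tau> = h \<tau> * P \<tau>" by blast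
  have "(D_op ^^ Suc n) h \<tau> = h \<tau> * (\<phi> \<tau> * P \<tau> + D_op P \<tau>)" if "\<tau> \<in> upper_half_plane" for \<tau>
  proof -
    have "(D_op ^^ Suc n) h \<tau> = D_op (\<lambda>\<tau>. h \<tau> * P \<tau>) \<tau>"
      using D_op_cong[OF eq that] by simp
    also have "\<dots> = D_op h \<tau> * P \<tau> + h \<tau> * D_op P \<tau>"
      by (rule D_op_mult[OF h _ that]) (use P in \<open>simp add: bounded_at_ii_infinity_def\<close>)
    finally show ?thesis by (simp add: D[OF that] algebra_simps)
  qed
  moreover have "bounded_at_ii_infinity (\<lambda>\<tau>. \<phi> \<tau> * P \<tau> + D_op P \<tau>)"
    by (intro bounded_at_ii_infinity_add bounded_at_ii_infinity_mult bounded_at_ii_infinity_D_op P \<phi>)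
  ultimately show ?case by blast
qed

lemma D_op_reciprocal:
  assumes "h holomorphic_on upper_half_plane" "\<And>\<tau>. \<tau> \<in> upper_half_plane \<Longrightarrow> h \<tau> \<noteq> 0"
    "\<tau> \<in> upper_half_plane"
  shows "D_op (\<lambda>\<tau>. 1 / h \<tau>) \<tau> = 1 / h \<tau> * - (D_op h \<tau> / h \<tau>)"
proof -
  have "((\<lambda>\<tau>. 1 / h \<tau>) has_field_derivative (- (2 * of_real pi * \<i> * D_op h \<tau>) / (h \<tau> * h \<tau>))) (at \<tau>)"
    using DERIV_divide[OF DERIV_const has_field_derivative_D_op[OF assms(1,3)] assms(2)[OF assms(3)], of 1]
    by simp
  from D_op_eqI[OF this] show ?thesis by (simp add: field_simps)
qed

text \<open>1 / h may grow near infinity, so the two factors are not estimated separately: each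
  product of derivatives has the form (1/h) Q h P = Q P.\<close>

lemma rankin_cohen_reciprocal_bounded:
  assumes h: "h holomorphic_on upper_half_plane" and nz: "\<And>\<tau>. \<tau> \<in> upper_half_plane \<Longrightarrow> h \<tau> \<noteq> 0"
    and bdd: "\<exists>B C. \<forall>\<tau>. Im \<tau> > max 0 C \<longrightarrow> norm (D_op h \<tau> / h \<tau>) \<le> B"
  shows "\<exists>B C. \<forall>\<tau>. Im \<tau> > max 0 C \<longrightarrow> norm (rankin_cohen a (\<lambda>\<tau>. 1 / h \<tau>) b h v \<tau>) \<le> B"
proof -
  define \<phi> where "\<phi> = (\<lambda>\<tau>. D_op h \<tau> / h \<tau>)"
  have \<phi>: "bounded_at_ii_infinity \<phi>"
    unfolding bounded_at_ii_infinity_def \<phi>_def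
    using bdd by (intro conjI holomorphic_on_divide holomorphic_D_op h nz)
  have \<phi>': "bounded_at_ii_infinity (\<lambda>\<tau>. - 1 * \<phi> \<tau>)"
    by (intro bounded_at_ii_infinity_mult bounded_at_ii_infinity_const \<phi>)
  have "\<exists>P. bounded_at_ii_infinity P \<and> (\<forall>\<tau>\<in>upper_half_plane. (D_op ^^ n) h \<tau> = h \<tau> * P \<tau>)" for n
    by (rule D_op_funpow_quotient_bounded[OF h \<phi>]) (use nz in \<open>auto simp: \<phi>_def\<close>)
  then obtain P where P: "\<And>n. bounded_at_ii_infinity (P n)"
    "\<And>n \<tau>. \<tau> \<in> upper_half_plane \<Longrightarrow> (D_op ^^ n) h \<tau> = h \<tau> * P n \<tau>" by metis
  have "\<exists>Q. bounded_at_ii_infinity Q \<and> (\<forall>\<tau>\<in>upper_half_plane. (D_op ^^ n) (\<lambda>\<tau>. 1 / h \<tau>) \<tau> = 1 / h \<tau> * Q \<tau>)" for n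
    by (rule D_op_funpow_quotient_bounded[OF _ \<phi>'])
       (use nz D_op_reciprocal[OF h nz] in \<open>auto simp: \<phi>_def intro!: holomorphic_intros h\<close>)
  then obtain Q where Q: "\<And>n. bounded_at_ii_infinity (Q n)"
    "\<And>n \<tau>. \<tau> \<in> upper_half_plane \<Longrightarrow> (D_op ^^ n) (\<lambda>\<tau>. 1 / h \<tau>) \<tau> = 1 / h \<tau> * Q n \<tau>" by metis
  define R where "R = (\<lambda>\<tau>. \<Sum>j\<le>v. (-1) ^ j * of_real ((a + real v - 1) gchoose (v - j))
      * of_real ((b + real v - 1) gchoose j) * (Q j \<tau> * P (v - j) \<tau>))"
  have "bounded_at_ii_infinity R"
    unfolding R_def
    by (intro bounded_at_ii_infinity_sum bounded_at_ii_infinity_mult bounded_at_ii_infinity_const P Q)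
  then obtain B C where BC: "\<And>\<tau>. Im \<tau> > max 0 C \<Longrightarrow> norm (R \<tau>) \<le> B"
    unfolding bounded_at_ii_infinity_def by blast
  have "rankin_cohen a (\<lambda>\<tau>. 1 / h \<tau>) b h v \<tau> = R \<tau>" if "\<tau> \<in> upper_half_plane" for \<tau>
    unfolding rankin_cohen_def R_def
    by (intro sum.cong refl) (use nz[OF that] in \<open>simp add: P(2)[OF that] Q(2)[OF that]\<close>)
  hence "norm (rankin_cohen a (\<lambda>\<tau>. 1 / h \<tau>) b h v \<tau>) \<le> B" if "Im \<tau> > max 0 C" for \<tau>
    using BC[OF that] that by (simp add: upper_half_plane_iff)
  thus ?thesis by blast
qed

subsection \<open>The bracket of a form of weight 1/2 with its reciprocal\<close>

lemma holomorphic_rankin_cohen: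
  assumes "F holomorphic_on upper_half_plane" "G holomorphic_on upper_half_plane"
  shows "rankin_cohen a F b G v holomorphic_on upper_half_plane"
proof -
  have "rankin_cohen a F b G v = (\<lambda>\<tau>. \<Sum>j\<le>v. (-1) ^ j * of_real ((a + real v - 1) gchoose (v - j))
      * of_real ((b + real v - 1) gchoose j) * (D_op ^^ j) F \<tau> * (D_op ^^ (v - j)) G \<tau>)"
    by (rule ext) (simp add: rankin_cohen_def)
  thus ?thesis
    by (simp only:) (intro holomorphic_intros holomorphic_D_op_funpow assms)
qed

lemma rankin_cohen_cmult:
  assumes "F holomorphic_on upper_half_plane" "G holomorphic_on upper_half_plane" "\<tau> \<in> upper_half_plane"
  shows "rankin_cohen a (\<lambda>\<tau>. c * F \<tau>) b (\<lambda>\<tau>. d * G \<tau>) v \<tau> = c * d * rankin_cohen a F b G v \<tau>"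
  unfolding rankin_cohen_def sum_distrib_left
  by (intro sum.cong refl)
     (simp add: D_op_funpow_cmult[OF assms(1,3)] D_op_funpow_cmult[OF assms(2,3)] mult_ac)

lemma Gamma0_subset_SL2Z: "\<gamma> \<in> Gamma0 N \<Longrightarrow> \<gamma> \<in> SL2Z"
  by (simp add: Gamma0_def)

text \<open>The witness is \<open>\<gamma> T \<gamma>\<^sup>-\<^sup>1\<close>, where \<open>T\<close> is the translation by \<open>N\<close>.\<close>

lemma Gamma0_conjugate_translation:
  assumes \<gamma>: "\<gamma> \<in> SL2Z"
  obtains \<gamma>' where "\<gamma>' \<in> Gamma0 N"
    "\<And>\<tau>. \<tau> \<in> upper_half_plane \<Longrightarrow> moebius_act \<gamma> (\<tau> + of_nat N) = moebius_act \<gamma>' (moebius_act \<gamma> \<tau>)"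
    "\<And>\<tau>. \<tau> \<in> upper_half_plane \<Longrightarrow>
       aut_denom \<gamma> (\<tau> + of_nat N) = aut_denom \<gamma>' (moebius_act \<gamma> \<tau>) * aut_denom \<gamma> \<tau>"
proof -
  define a b c d where abcd: "a = \<gamma> $ 1 $ 1" "b = \<gamma> $ 1 $ 2" "c = \<gamma> $ 2 $ 1" "d = \<gamma> $ 2 $ 2"
  have det: "a * d - b * c = 1" using SL2Z_det[OF \<gamma>] by (simp add: abcd)
  have detc: "of_int a * of_int d - of_int b * of_int c = (1::complex)"
    using arg_cong[OF det, of "of_int :: int \<Rightarrow> complex"] by simp
  define \<gamma>' :: "int^2^2" where
    "\<gamma>' = vector [vector [1 - int N * a * c, int N * a\<^sup>2], vector [- int N * c\<^sup>2, 1 + int N * a * c]]"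
  have \<gamma>'_nth: "\<gamma>' $ 1 $ 1 = 1 - int N * a * c" "\<gamma>' $ 1 $ 2 = int N * a\<^sup>2"
    "\<gamma>' $ 2 $ 1 = - int N * c\<^sup>2" "\<gamma>' $ 2 $ 2 = 1 + int N * a * c"
    by (simp_all add: \<gamma>'_def vector_2)
  have "det \<gamma>' = 1" unfolding det_2 \<gamma>'_nth by (simp add: algebra_simps power2_eq_square)
  hence mem: "\<gamma>' \<in> Gamma0 N" by (simp add: Gamma0_def SL2Z_def \<gamma>'_nth)
  show ?thesis
  proof (rule that[OF mem])
    fix \<tau> assume \<tau>: "\<tau> \<in> upper_half_plane"
    have \<tau>N: "\<tau> + of_nat N \<in> upper_half_plane" using \<tau> by (simp add: upper_half_plane_iff)
    define A where "A = of_int a * \<tau> + of_int b"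
    define U where "U = of_int c * \<tau> + of_int d"
    have U: "U \<noteq> 0" using aut_denom_nonzero[OF \<gamma> \<tau>] by (simp add: aut_denom_def U_def abcd)
    have m: "moebius_act \<gamma> \<tau> = A / U"
      by (simp add: moebius_act_eq aut_denom_def A_def U_def abcd)
    \<comment> \<open>This is the determinant of \<gamma>. It collapses the terms with N below to N
      c and N a, exactly the effect of the translation by N on the denominator and numerator of
      \<gamma>.\<close>
    have AU: "of_int a * U - of_int c * A = 1"
      using detc by (simp add: A_def U_def algebra_simps)
    have den: "aut_denom \<gamma>' (A / U) * U = U + of_nat N * of_int c * (of_int a * U - of_int c * A)"
      using U by (simp add: aut_denom_def \<gamma>'_nth field_simps power2_eq_square)
    have num: "(of_int (\<gamma>' $ 1 $ 1) * (A / U) + of_int (\<gamma>' $ 1 $ 2)) * U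
                = A + of_nat N * of_int a * (of_int a * U - of_int c * A)"
      using U by (simp add: \<gamma>'_nth field_simps power2_eq_square)
    show den': "aut_denom \<gamma> (\<tau> + of_nat N) = aut_denom \<gamma>' (moebius_act \<gamma> \<tau>) * aut_denom \<gamma> \<tau>"
      using den unfolding AU m by (simp add: aut_denom_def U_def abcd algebra_simps)
    have "moebius_act \<gamma>' (A / U) = ((of_int (\<gamma>' $ 1 $ 1) * (A / U) + of_int (\<gamma>' $ 1 $ 2)) * U) / (aut_denom \<gamma>' (A / U) * U)"
      using U by (simp add: moebius_act_eq)
    also have "\<dots> = moebius_act \<gamma> (\<tau> + of_nat N)"
      unfolding num den AU moebius_act_eq
      by (simp add: aut_denom_def A_def U_def abcd algebra_simps)
    finally show "moebius_act \<gamma> (\<tau> + of_nat N) = moebius_act \<gamma>' (moebius_act \<gamma> \<tau>)"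
      by (simp add: m)
  qed
qed

text \<open>The weights -1/2 and 1/2 cancel, so the automorphy factor is an integral power and no
  branch of a square root is left; the multipliers of 1 / g and g cancel as well.\<close>

lemma rankin_cohen_reciprocal_modular:
  assumes N: "N \<ge> 1" and g: "modular_form (1 / 2) N \<nu> g"
    and nz: "\<And>\<tau>. \<tau> \<in> upper_half_plane \<Longrightarrow> g \<tau> \<noteq> 0"
  shows "rankin_cohen (- 1 / 2) (\<lambda>\<tau>. 1 / g \<tau>) (1 / 2) g v \<in> M_Gamma0 (2 * v) N"
proof -
  have hol: "g holomorphic_on upper_half_plane"
    and trans: "\<And>\<gamma> \<tau>. \<gamma> \<in> Gamma0 N \<Longrightarrow> \<tau> \<in> upper_half_plane \<Longrightarrow>
        g (moebius_act \<gamma> \<tau>) = \<nu> \<gamma> * aut_denom \<gamma> \<tau> powr (1 / 2) * g \<tau>"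
    and cusp: "\<And>\<gamma>. \<gamma> \<in> SL2Z \<Longrightarrow> \<exists>B C. \<forall>\<tau>. Im \<tau> > max 0 C \<longrightarrow>
        norm (aut_denom \<gamma> \<tau> powr (- 1 / 2) * g (moebius_act \<gamma> \<tau>)) \<le> B"
    using g unfolding modular_form_def by simp_all
  have hol': "(\<lambda>\<tau>. 1 / g \<tau>) holomorphic_on upper_half_plane"
    using nz by (intro holomorphic_intros hol) auto
  let ?R = "rankin_cohen (- 1 / 2) (\<lambda>\<tau>. 1 / g \<tau>) (1 / 2) g v"
  have half: "x powr (- 1 / 2) * x powr (1 / 2) = 1" if "x \<noteq> 0" for x :: complex
    using that by (simp flip: powr_add)
  have half': "1 / x powr (1 / 2) = x powr (- 1 / 2)" if "x \<noteq> 0" for x :: complex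
    using half[OF that] that by (simp add: field_simps)
  \<comment> \<open>The function \<open>h\<close> is left open so that this serves twice: with h =
    \<nu>(\<gamma>) g for \<gamma> in Gamma_0(N), and with the transform of g at the cusp of an
    arbitrary \<gamma>.\<close>
  have slash: "?R (moebius_act \<gamma> \<tau>) = aut_denom \<gamma> \<tau> ^ (2 * v) * rankin_cohen (- 1 / 2) (\<lambda>\<tau>. 1 / h \<tau>) (1 / 2) h v \<tau>"
    if "\<gamma> \<in> SL2Z" "h holomorphic_on upper_half_plane" "\<tau> \<in> upper_half_plane"
       "\<And>\<tau>. \<tau> \<in> upper_half_plane \<Longrightarrow> h \<tau> \<noteq> 0"
       "\<And>\<tau>. \<tau> \<in> upper_half_plane \<Longrightarrow> g (moebius_act \<gamma> \<tau>) = aut_denom \<gamma> \<tau> powr (1 / 2) * h \<tau>"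
     for \<gamma> h \<tau>
  proof -
    have "?R (moebius_act \<gamma> \<tau>) = aut_denom \<gamma> \<tau> powr of_real (- 1 / 2) * aut_denom \<gamma> \<tau> powr of_real (1 / 2)
            * aut_denom \<gamma> \<tau> ^ (2 * v) * rankin_cohen (- 1 / 2) (\<lambda>\<tau>. 1 / h \<tau>) (1 / 2) h v \<tau>"
    proof (rule rankin_cohen_slash[OF that(1) hol' _ hol that(2) _ _ that(3)])
      show "(\<lambda>\<tau>. 1 / h \<tau>) holomorphic_on upper_half_plane"
        using that(4) by (intro holomorphic_intros that(2)) auto
      fix \<tau> assume \<tau>: "\<tau> \<in> upper_half_plane"
      show "g (moebius_act \<gamma> \<tau>) = aut_denom \<gamma> \<tau> powr of_real (1 / 2) * h \<tau>"
        using that(5)[OF \<tau>] by simp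
      show "1 / g (moebius_act \<gamma> \<tau>) = aut_denom \<gamma> \<tau> powr of_real (- 1 / 2) * (1 / h \<tau>)"
        using half'[OF aut_denom_nonzero[OF that(1) \<tau>]]
        unfolding that(5)[OF \<tau>]
        by (subst mult_1_left[of "1::complex", symmetric], subst times_divide_times_eq[symmetric]) simp
    qed
    thus ?thesis using half[OF aut_denom_nonzero[OF that(1,3)]] by simp
  qed
  have powr_eq: "x powr of_real (real (2 * v)) = x ^ (2 * v)"
    "x powr of_real (- real (2 * v)) = 1 / x ^ (2 * v)" if "x \<noteq> 0" for x :: complex
  proof -
    have "x powr of_nat (2 * v) = x ^ (2 * v)" using that by (subst powr_nat') auto
    thus "x powr of_real (real (2 * v)) = x ^ (2 * v)" by simp
    thus "x powr of_real (- real (2 * v)) = 1 / x ^ (2 * v)" by (simp add: powr_minus field_simps)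
  qed
  have transf: "?R (moebius_act \<gamma> \<tau>) = 1 * aut_denom \<gamma> \<tau> powr of_real (real (2 * v)) * ?R \<tau>"
    if \<gamma>: "\<gamma> \<in> Gamma0 N" and \<tau>: "\<tau> \<in> upper_half_plane" for \<gamma> \<tau>
  proof -
    note \<gamma>' = Gamma0_subset_SL2Z[OF \<gamma>]
    have \<nu>: "\<nu> \<gamma> \<noteq> 0"
      using trans[OF \<gamma> \<tau>] nz[OF moebius_act_in_upper_half_plane[OF \<gamma>' \<tau>]] by auto
    have "?R (moebius_act \<gamma> \<tau>) = aut_denom \<gamma> \<tau> ^ (2 * v)
            * rankin_cohen (- 1 / 2) (\<lambda>\<tau>. 1 / (\<nu> \<gamma> * g \<tau>)) (1 / 2) (\<lambda>\<tau>. \<nu> \<gamma> * g \<tau>) v \<tau>"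
      by (rule slash[OF \<gamma>' _ \<tau>]) (use trans[OF \<gamma>] nz \<nu> in \<open>auto intro!: holomorphic_intros hol\<close>)
    also have "(\<lambda>\<tau>. 1 / (\<nu> \<gamma> * g \<tau>)) = (\<lambda>\<tau>. (1 / \<nu> \<gamma>) * (1 / g \<tau>))" by simp
    also have "rankin_cohen (- 1 / 2) \<dots> (1 / 2) (\<lambda>\<tau>. \<nu> \<gamma> * g \<tau>) v \<tau> = (1 / \<nu> \<gamma>) * \<nu> \<gamma> * ?R \<tau>"
      by (rule rankin_cohen_cmult[OF hol' hol \<tau>])
    finally show ?thesis using \<nu> powr_eq(1)[OF aut_denom_nonzero[OF \<gamma>' \<tau>]] by simp
  qed
  have cusps: "\<exists>B C. \<forall>\<tau>. Im \<tau> > max 0 C \<longrightarrow>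
        norm (aut_denom \<gamma> \<tau> powr of_real (- real (2 * v)) * ?R (moebius_act \<gamma> \<tau>)) \<le> B"
    if \<gamma>: "\<gamma> \<in> SL2Z" for \<gamma>
  proof -
    define u where "u = aut_denom \<gamma>"
    have u: "u \<tau> \<noteq> 0" if "\<tau> \<in> upper_half_plane" for \<tau>
      using aut_denom_nonzero[OF \<gamma> that] by (simp add: u_def)
    define h where "h = (\<lambda>\<tau>. u \<tau> powr (- 1 / 2) * g (moebius_act \<gamma> \<tau>))"
    have h_hol: "h holomorphic_on upper_half_plane"
      unfolding h_def u_def
      by (intro holomorphic_on_mult holomorphic_aut_denom_powr[OF \<gamma>] holomorphic_compose_moebius_act[OF \<gamma> hol])
    have h_nz: "h \<tau> \<noteq> 0" if "\<tau> \<in> upper_half_plane" for \<tau>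
      using u[OF that] nz[OF moebius_act_in_upper_half_plane[OF \<gamma> that]] by (simp add: h_def)
    have gh: "g (moebius_act \<gamma> \<tau>) = aut_denom \<gamma> \<tau> powr (1 / 2) * h \<tau>" if "\<tau> \<in> upper_half_plane" for \<tau>
      using half[OF u[OF that]] by (simp add: h_def u_def mult_ac flip: mult.assoc)
    (* the square of h needs no choice of a branch of the square root of the automorphy factor *)
    define H where "H = (\<lambda>\<tau>. h \<tau> * h \<tau>)"
    have H: "H \<tau> = g (moebius_act \<gamma> \<tau>) ^ 2 / u \<tau>" if "\<tau> \<in> upper_half_plane" for \<tau>
    proof -
      have "u \<tau> powr (- 1 / 2) * u \<tau> powr (- 1 / 2) = 1 / u \<tau>"
        using u[OF that] by (simp add: powr_minus field_simps flip: powr_add)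
      thus ?thesis by (simp add: H_def h_def power2_eq_square mult_ac)
    qed
    \<comment> \<open>The width of every cusp of Gamma_0(N) divides N, so translation by N is
      available at each of them and \<open>H\<close> has period N up to a constant.\<close>
    obtain \<gamma>' where \<gamma>': "\<gamma>' \<in> Gamma0 N"
      "\<And>\<tau>. \<tau> \<in> upper_half_plane \<Longrightarrow> moebius_act \<gamma> (\<tau> + of_nat N) = moebius_act \<gamma>' (moebius_act \<gamma> \<tau>)"
      "\<And>\<tau>. \<tau> \<in> upper_half_plane \<Longrightarrow>
         aut_denom \<gamma> (\<tau> + of_nat N) = aut_denom \<gamma>' (moebius_act \<gamma> \<tau>) * aut_denom \<gamma> \<tau>"
      using Gamma0_conjugate_translation[OF \<gamma>] by metis
    obtain B C where BC: "\<And>\<tau>. Im \<tau> > max 0 C \<Longrightarrow> norm (h \<tau>) \<le> B"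
      using cusp[OF \<gamma>] unfolding h_def u_def by blast
    have "\<exists>B' C'. \<forall>\<tau>. Im \<tau> > max 0 C' \<longrightarrow> norm (D_op H \<tau> / H \<tau>) \<le> B'"
    proof (rule logderiv_bounded_at_ii_infinity)
      show "H holomorphic_on upper_half_plane" unfolding H_def by (intro holomorphic_on_mult h_hol)
      show "H \<tau> \<noteq> 0" if "\<tau> \<in> upper_half_plane" for \<tau> using h_nz[OF that] by (simp add: H_def)
      show "real N > 0" using N by simp
      fix \<tau>
      show "H (\<tau> + of_real (real N)) = \<nu> \<gamma>' ^ 2 * H \<tau>" if \<tau>: "\<tau> \<in> upper_half_plane"
      proof -
        have \<tau>N: "\<tau> + of_nat N \<in> upper_half_plane" using \<tau> by (simp add: upper_half_plane_iff)
        define J where "J = aut_denom \<gamma>' (moebius_act \<gamma> \<tau>)"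
        have J: "J \<noteq> 0" using \<gamma>'(3)[OF \<tau>] aut_denom_nonzero[OF \<gamma> \<tau>N] by (auto simp: J_def)
        have sq: "(J powr (1 / 2)) ^ 2 = J"
          using J by (simp add: power2_eq_square flip: powr_add)
        have "H (\<tau> + of_nat N) = (\<nu> \<gamma>' * J powr (1 / 2) * g (moebius_act \<gamma> \<tau>)) ^ 2 / (J * u \<tau>)"
          unfolding H[OF \<tau>N] \<gamma>'(2)[OF \<tau>] u_def \<gamma>'(3)[OF \<tau>] J_def
          by (subst trans[OF \<gamma>'(1) moebius_act_in_upper_half_plane[OF \<gamma> \<tau>]]) simp
        also have "\<dots> = \<nu> \<gamma>' ^ 2 * H \<tau>"
          unfolding power_mult_distrib sq H[OF \<tau>] using J by simp
        finally show ?thesis by simp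
      qed
      show "norm (H \<tau>) \<le> B * B" if "Im \<tau> > max 0 C"
        unfolding H_def norm_mult
        by (intro mult_mono BC that) (auto intro: order_trans[OF norm_ge_zero BC[OF that]])
    qed
    then obtain B' C' where B': "\<And>\<tau>. Im \<tau> > max 0 C' \<Longrightarrow> norm (D_op H \<tau> / H \<tau>) \<le> B'" by blast
    have "norm (D_op h \<tau> / h \<tau>) \<le> B'" if "Im \<tau> > max 0 C'" for \<tau>
    proof -
      have \<tau>: "\<tau> \<in> upper_half_plane" using that by (simp add: upper_half_plane_iff)
      have "D_op H \<tau> / H \<tau> = 2 * (D_op h \<tau> / h \<tau>)"
        unfolding H_def D_op_mult[OF h_hol h_hol \<tau>] using h_nz[OF \<tau>] by (simp add: field_simps)
      hence "2 * norm (D_op h \<tau> / h \<tau>) \<le> B'" using B'[OF that] by (simp add: norm_mult norm_divide)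
      thus ?thesis using norm_ge_zero[of "D_op h \<tau> / h \<tau>"] by linarith
    qed
    hence "\<exists>B C. \<forall>\<tau>. Im \<tau> > max 0 C \<longrightarrow> norm (D_op h \<tau> / h \<tau>) \<le> B" by blast
    from rankin_cohen_reciprocal_bounded[OF h_hol h_nz this, of "- 1 / 2" "1 / 2" v]
    obtain B2 C2 where B2: "\<And>\<tau>. Im \<tau> > max 0 C2 \<Longrightarrow>
         norm (rankin_cohen (- 1 / 2) (\<lambda>\<tau>. 1 / h \<tau>) (1 / 2) h v \<tau>) \<le> B2" by blast
    have "norm (aut_denom \<gamma> \<tau> powr of_real (- real (2 * v)) * ?R (moebius_act \<gamma> \<tau>)) \<le> B2"
      if "Im \<tau> > max 0 C2" for \<tau>
    proof -
      have \<tau>: "\<tau> \<in> upper_half_plane" using that by (simp add: upper_half_plane_iff)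
      note u0 = aut_denom_nonzero[OF \<gamma> \<tau>]
      have "aut_denom \<gamma> \<tau> powr of_real (- real (2 * v)) * ?R (moebius_act \<gamma> \<tau>) =
              rankin_cohen (- 1 / 2) (\<lambda>\<tau>. 1 / h \<tau>) (1 / 2) h v \<tau>"
        by (subst slash[OF \<gamma> h_hol \<tau> h_nz gh]) (use u0 in \<open>simp_all only: powr_eq(2)[OF u0], simp\<close>)
      thus ?thesis using B2[OF that] by simp
    qed
    thus ?thesis by blast
  qed
  show ?thesis
    unfolding M_Gamma0_def modular_form_def
    using holomorphic_rankin_cohen[OF hol' hol] transf cusps by simp
qed

subsection \<open>Eta quotients and their power series\<close>

lemma q_pow_add: "q_pow (x + y) \<tau> = q_pow x \<tau> * q_pow y \<tau>"
  by (simp add: q_pow_def ring_distribs exp_add)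

lemma q_pow_0 [simp]: "q_pow 0 \<tau> = 1"
  by (simp add: q_pow_def)

lemma q_pow_nonzero [simp]: "q_pow x \<tau> \<noteq> 0"
  by (simp add: q_pow_def)

lemma q_pow_minus: "q_pow (- x) \<tau> = 1 / q_pow x \<tau>"
  by (simp add: q_pow_def exp_minus field_simps)

lemma q_pow_power: "q_pow x \<tau> ^ n = q_pow (real n * x) \<tau>"
  by (simp add: q_pow_def exp_of_nat_mult[symmetric] mult_ac)

lemma q_pow_power_int: "q_pow x \<tau> powi n = q_pow (of_int n * x) \<tau>"
  by (cases "n \<ge> 0")
     (simp_all add: power_int_def q_pow_power q_pow_minus power_one_over inverse_eq_divide)

lemma q_pow_prod: "(\<Prod>i\<in>A. q_pow (x i) \<tau>) = q_pow (\<Sum>i\<in>A. x i) \<tau>"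
  by (induction A rule: infinite_finite_induct) (auto simp: q_pow_add)

lemma norm_q_pow: "norm (q_pow x \<tau>) = exp (- 2 * pi * x * Im \<tau>)"
  by (simp add: q_pow_def norm_exp_eq_Re)

lemma norm_q_pow_less_1: "x > 0 \<Longrightarrow> \<tau> \<in> upper_half_plane \<Longrightarrow> norm (q_pow x \<tau>) < 1"
  by (simp add: norm_q_pow upper_half_plane_def)

text \<open>Turns statements about all \<tau> into statements about the punctured unit disc. The
  choice x = 1 / w gives z = q^(1/w), in which the theta series has integral exponents.\<close>

lemma q_pow_surj:
  assumes "z \<noteq> 0" "norm z < 1" "x > 0"
  obtains \<tau> where "\<tau> \<in> upper_half_plane" "q_pow x \<tau> = z"
proof -
  define \<tau> where "\<tau> = - (\<i> * Ln z) / of_real (2 * pi * x)"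
  have "Im \<tau> = - Re (Ln z) / (2 * pi * x)"
    unfolding \<tau>_def Im_divide_of_real by simp
  moreover have "ln (norm z) < 0" using assms by simp
  ultimately have "Im \<tau> > 0" using assms by (simp add: Re_Ln divide_neg_pos)
  moreover have "2 * of_real pi * \<i> * of_real x * \<tau> = Ln z"
    using assms(3) by (simp add: \<tau>_def)
  hence "q_pow x \<tau> = z" using assms by (simp add: q_pow_def)
  ultimately show ?thesis using that by (auto simp: upper_half_plane_def)
qed

section \<open>Power series with integer coefficients and the formal Euler product\<close>

definition int_fps :: "complex fps \<Rightarrow> bool" where
  "int_fps F \<longleftrightarrow> (\<forall>n. fps_nth F n \<in> \<int>)"

lemma int_fps_1: "int_fps 1"
  by (simp add: int_fps_def)

lemma int_fps_mult: "int_fps F \<Longrightarrow> int_fps G \<Longrightarrow> int_fps (F * G)"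
  by (auto simp: int_fps_def fps_mult_nth intro!: Ints_sum Ints_mult)

lemma int_fps_power: "int_fps F \<Longrightarrow> int_fps (F ^ n)"
  by (induction n) (auto intro: int_fps_1 int_fps_mult)

lemma int_fps_prod: "(\<And>i. i \<in> A \<Longrightarrow> int_fps (F i)) \<Longrightarrow> int_fps (\<Prod>i\<in>A. F i)"
  by (induction A rule: infinite_finite_induct) (auto intro: int_fps_1 int_fps_mult)

text \<open>With constant term 1 the recursion for the coefficients of the inverse involves no
  division.\<close>

lemma int_fps_inverse:
  assumes "int_fps F" "fps_nth F 0 = 1"
  shows "int_fps (inverse F)"
proof -
  have "fps_nth (inverse F) n \<in> \<int>" for n
  proof (induction n rule: less_induct)
    case (less n)
    have 1: "F * inverse F = 1" using assms by (intro inverse_mult_eq_1') auto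
    show ?case
    proof (cases "n = 0")
      case True
      then show ?thesis using assms by (simp add: fps_inverse_def)
    next
      case False
      have "0 = fps_nth (F * inverse F) n" using False by (simp add: 1)
      also have "\<dots> = fps_nth (inverse F) n + (\<Sum>i = 1..n. fps_nth F i * fps_nth (inverse F) (n - i))"
        unfolding fps_mult_nth by (subst sum.atLeast_Suc_atMost) (simp_all add: assms(2))
      finally have "fps_nth (inverse F) n = - (\<Sum>i = 1..n. fps_nth F i * fps_nth (inverse F) (n - i))"
        by (simp add: add_eq_0_iff)
      also have "\<dots> \<in> \<int>"
        using assms(1) less False by (intro Ints_minus Ints_sum Ints_mult) (auto simp: int_fps_def)
      finally show ?thesis .
    qed
  qed
  thus ?thesis by (simp add: int_fps_def)
qed

lemma fps_nth_0_power_int: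
  fixes F :: "complex fps"
  shows "fps_nth F 0 = 1 \<Longrightarrow> fps_nth (F powi n) 0 = 1"
  by (simp add: power_int_def fps_power_zeroth)

lemma int_fps_power_int: "int_fps F \<Longrightarrow> fps_nth F 0 = 1 \<Longrightarrow> int_fps (F powi n)"
  by (auto simp: power_int_def intro: int_fps_power int_fps_inverse)

lemma prod_fps_nth_0: "fps_nth (\<Prod>i\<in>A. F i) 0 = (\<Prod>i\<in>A. fps_nth (F i :: complex fps) 0)"
  by (induction A rule: infinite_finite_induct) auto

text \<open>Coefficient n is settled after n factors, since the later ones differ from 1 only in
  degrees above n.\<close>

lemma q_poch_inf_limit:
  assumes "k > 0"
  shows "(\<lambda>M. \<Prod>n<M. 1 - fps_X ^ (k * Suc n)) \<longlonglongrightarrow> q_poch_inf k"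
    and "int_fps (q_poch_inf k)" and "fps_nth (q_poch_inf k) 0 = 1"
proof -
  define P :: "nat \<Rightarrow> complex fps" where "P = (\<lambda>M. \<Prod>n<M. 1 - fps_X ^ (k * Suc n))"
  have P_Suc: "P (Suc M) = P M - fps_X ^ (k * Suc M) * P M" for M
    by (simp add: P_def algebra_simps)
  have stab: "fps_nth (P (n + i)) n = fps_nth (P n) n" for n i
  proof (induction i)
    case (Suc i)
    have "n + i < k * Suc (n + i)" using assms by (cases k) auto
    hence "fps_nth (P (n + Suc i)) n = fps_nth (P (n + i)) n"
      by (simp add: P_Suc fps_X_power_mult_nth)
    with Suc show ?case by simp
  qed auto
  have stab': "fps_nth (P M) n = fps_nth (P n) n" if "M \<ge> n" for M n
    using stab[of n "M - n"] that by simp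
  define Q where "Q = Abs_fps (\<lambda>n. fps_nth (P n) n)"
  have int: "int_fps (P M)" for M
    unfolding P_def by (intro int_fps_prod) (auto simp: int_fps_def)
  have lim: "P \<longlonglongrightarrow> Q"
  proof (rule tendsto_fpsI, rule eventually_sequentiallyI)
    fix n M :: nat assume "M \<ge> n"
    thus "fps_nth (P M) n = fps_nth Q n" unfolding Q_def fps_nth_Abs_fps by (rule stab')
  qed
  have Q0: "fps_nth Q 0 = 1" by (simp add: Q_def P_def)
  \<comment> \<open>Convergence of an infinite product in the sense of \<open>raw_has_prod\<close>
    includes a nonzero limit.\<close>
  hence "Q \<noteq> 0" by auto
  hence "raw_has_prod (\<lambda>n. 1 - fps_X ^ (k * Suc n)) 0 Q"
    using lim unfolding raw_has_prod_def P_def by (simp add: LIMSEQ_lessThan_iff_atMost)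
  hence "(\<lambda>n. 1 - fps_X ^ (k * Suc n)) has_prod Q" unfolding has_prod_def by blast
  hence eq: "q_poch_inf k = Q" unfolding q_poch_inf_def by (rule has_prod_unique[symmetric])
  show "(\<lambda>M. \<Prod>n<M. 1 - fps_X ^ (k * Suc n)) \<longlonglongrightarrow> q_poch_inf k"
    using lim by (simp add: eq P_def)
  show "int_fps (q_poch_inf k)" using int by (simp add: eq Q_def int_fps_def)
  show "fps_nth (q_poch_inf k) 0 = 1" using Q0 by (simp add: eq)
qed

section \<open>Euler's function phi(z^k) on the unit disc and quotients of such functions\<close>

definition euler_fun :: "nat \<Rightarrow> complex \<Rightarrow> complex" where
  "euler_fun k z = (\<Prod>n. 1 - z ^ (k * Suc n))"

lemma euler_fun_factor_nonzero:
  assumes "k > 0" "norm (z::complex) < 1"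
  shows "1 - z ^ (k * Suc n) \<noteq> 0"
proof
  assume "1 - z ^ (k * Suc n) = 0"
  hence "norm z ^ (k * Suc n) = 1" by (metis norm_one norm_power right_minus_eq)
  moreover have "norm z ^ (k * Suc n) < 1"
    using assms by (intro power_less_one_iff[THEN iffD2]) auto
  ultimately show False by simp
qed

lemma norm_power_le_geometric:
  assumes "k > 0" "norm (z::complex) \<le> r" "r \<le> 1"
  shows "norm (z ^ (k * Suc n)) \<le> r ^ n"
proof -
  have r: "r \<ge> 0" using assms(2) norm_ge_zero order_trans by blast
  have "norm (z ^ (k * Suc n)) \<le> r ^ (k * Suc n)"
    unfolding norm_power using assms by (intro power_mono) auto
  also have "\<dots> \<le> r ^ n"
    using assms r by (intro power_decreasing) (cases k; auto)+
  finally show ?thesis .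
qed

lemma euler_fun_convergent:
  assumes "k > 0" "norm (z::complex) < 1"
  shows "convergent_prod (\<lambda>n. 1 - z ^ (k * Suc n))"
proof -
  have "summable (\<lambda>n. norm (- (z ^ (k * Suc n))))"
    by (rule summable_comparison_test'[of "\<lambda>n. norm z ^ n" 0])
       (use assms norm_power_le_geometric[OF assms(1) order_refl, of z] in auto)
  moreover have "- (z ^ (k * Suc n)) \<noteq> -1" for n
    using euler_fun_factor_nonzero[OF assms, of n] by auto
  ultimately have "convergent_prod (\<lambda>n. 1 + - (z ^ (k * Suc n)))"
    by (rule summable_imp_convergent_prod_complex)
  thus ?thesis by simp
qed

lemma euler_fun_nonzero:
  assumes "k > 0" "norm z < 1"
  shows "euler_fun k z \<noteq> 0"
  unfolding euler_fun_def
  using euler_fun_convergent[OF assms] euler_fun_factor_nonzero[OF assms] by (rule prodinf_nonzero)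

text \<open>The n-th factor differs from 1 by at most r^n. Uniformity on closed discs makes the
  limit holomorphic and its Taylor coefficients the limits of those of the partial products.\<close>

lemma euler_fun_uniform_limit:
  assumes k: "k > 0" and r: "r < 1"
  shows "uniform_limit (cball 0 r) (\<lambda>M z. \<Prod>n<M. 1 - z ^ (k * Suc n)) (euler_fun k) sequentially"
proof -
  have "uniformly_convergent_on (cball 0 r) (\<lambda>M z. \<Prod>n<M. 1 - (z::complex) ^ (k * Suc n))"
  proof (rule uniformly_convergent_on_prod')
    show "uniformly_convergent_on (cball 0 r) (\<lambda>N x. \<Sum>n<N. norm (1 - x ^ (k * Suc n) - 1 :: complex))"
    proof (cases "r \<ge> 0")
      case True
      show ?thesis
      proof (rule Weierstrass_m_test'[where M = "\<lambda>n. r ^ n"])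
        fix n and z :: complex assume "z \<in> cball 0 r"
        hence "norm (z ^ (k * Suc n)) \<le> r ^ n"
          by (intro norm_power_le_geometric[OF k]) (use r in auto)
        moreover have "norm (norm (1 - y - 1)) = norm y" for y :: complex by simp
        ultimately show "norm (norm (1 - z ^ (k * Suc n) - 1)) \<le> r ^ n" by metis
      qed (use True r in auto)
    qed auto
  qed (auto intro!: continuous_intros)
  hence ul: "uniform_limit (cball 0 r) (\<lambda>M z. \<Prod>n<M. 1 - (z::complex) ^ (k * Suc n))
               (\<lambda>z. lim (\<lambda>M. \<Prod>n<M. 1 - z ^ (k * Suc n))) sequentially"
    by (rule uniformly_convergent_uniform_limit_iff[THEN iffD1])
  have eq: "lim (\<lambda>M. \<Prod>n<M. 1 - z ^ (k * Suc n)) = euler_fun k z" if "z \<in> cball 0 r" for z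
  proof -
    have z: "norm z < 1" using that r by simp
    show ?thesis unfolding euler_fun_def
      by (rule prodinf_eq_lim'[symmetric, OF euler_fun_convergent[OF k z] euler_fun_factor_nonzero[OF k z]])
  qed
  have "uniform_limit (cball 0 r) (\<lambda>M z. \<Prod>n<M. 1 - z ^ (k * Suc n)) (euler_fun k) sequentially \<longleftrightarrow>
        uniform_limit (cball 0 r) (\<lambda>M z. \<Prod>n<M. 1 - (z::complex) ^ (k * Suc n))
          (\<lambda>z. lim (\<lambda>M. \<Prod>n<M. 1 - z ^ (k * Suc n))) sequentially"
    by (rule uniform_limit_cong'[OF refl eq[symmetric]])
  with ul show ?thesis by blast
qed

lemma euler_fun_holomorphic:
  assumes k: "k > 0"
  shows "euler_fun k holomorphic_on ball 0 1"
proof -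
  have unif: "\<exists>d. 0 < d \<and> cball x d \<subseteq> ball 0 1 \<and>
          uniform_limit (cball x d) (\<lambda>M z. \<Prod>n<M. 1 - z ^ (k * Suc n)) (euler_fun k) sequentially"
    if "x \<in> ball 0 1" for x
  proof -
    have "norm x < 1" using that by simp
    then obtain r where r: "norm x < r" "r < 1" using dense by blast
    have sub: "cball x (r - norm x) \<subseteq> cball 0 r"
    proof
      fix y assume "y \<in> cball x (r - norm x)"
      thus "y \<in> cball 0 r" using norm_triangle_sub[of y x] by (simp add: dist_norm norm_minus_commute)
    qed
    hence "uniform_limit (cball x (r - norm x)) (\<lambda>M z. \<Prod>n<M. 1 - z ^ (k * Suc n)) (euler_fun k) sequentially"
      by (rule uniform_limit_on_subset[OF euler_fun_uniform_limit[OF k r(2)]])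
    moreover have "cball x (r - norm x) \<subseteq> ball 0 1" using sub r by force
    ultimately show ?thesis using r by (intro exI[of _ "r - norm x"]) auto
  qed
  show ?thesis
    by (rule holomorphic_uniform_sequence[OF open_ball _ unif]) (assumption | intro holomorphic_intros)+
qed

lemma has_fps_expansion_ball:
  fixes f :: "complex \<Rightarrow> complex"
  assumes "f holomorphic_on ball 0 1"
  shows "f has_fps_expansion fps_expansion f 0"
  by (rule has_fps_expansion_fps_expansion[of "ball 0 1"]) (use assms in auto)

text \<open>Links the analytic product to the formal one: under uniform convergence the Taylor
  coefficients converge, so they agree with the X-adic limit of the partial products.\<close>

lemma euler_fun_has_fps_expansion:
  assumes k: "k > 0"
  shows "euler_fun k has_fps_expansion q_poch_inf k"
proof -
  have "fps_expansion (euler_fun k) 0 = q_poch_inf k"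
  proof (rule uniform_limit_imp_fps_expansion_eq[OF q_poch_inf_limit(1)[OF k]])
    show "uniform_limit (ball 0 (1/2)) (\<lambda>M z. \<Prod>n<M. 1 - z ^ (k * Suc n)) (euler_fun k) sequentially"
      by (rule uniform_limit_on_subset[OF euler_fun_uniform_limit[OF k, of "1/2"]]) auto
    show "euler_fun k has_fps_expansion fps_expansion (euler_fun k) 0"
      by (rule has_fps_expansion_ball[OF euler_fun_holomorphic[OF k]])
    show "\<forall>\<^sub>F M in sequentially. (\<lambda>z. \<Prod>n<M. 1 - z ^ (k * Suc n)) has_fps_expansion
             (\<Prod>n<M. 1 - fps_X ^ (k * Suc n) :: complex fps)"
      by (rule always_eventually, rule allI, rule has_fps_expansion_prod, rule has_fps_expansion_diff)
         (rule has_fps_expansion_1 has_fps_expansion_fps_X_power)+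
    show "\<forall>\<^sub>F M in sequentially. (\<lambda>z. \<Prod>n<M. 1 - z ^ (k * Suc n) :: complex) holomorphic_on ball 0 (1/2)"
      by (rule always_eventually, rule allI, intro holomorphic_intros)
  qed auto
  thus ?thesis using has_fps_expansion_ball[OF euler_fun_holomorphic[OF k]] by simp
qed

lemma euler_fun_power: "euler_fun (l * k) z = euler_fun k (z ^ l)"
proof -
  have "z ^ (l * k * Suc n) = (z ^ l) ^ (k * Suc n)" for n
    by (simp only: power_mult[of z l, symmetric] mult.assoc)
  thus ?thesis by (simp only: euler_fun_def)
qed

lemma has_fps_expansion_power_nat:
  fixes F :: "complex fps"
  assumes "f has_fps_expansion F"
  shows "(\<lambda>z. f z ^ n) has_fps_expansion F ^ n"
proof (induction n)
  case (Suc n)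
  show ?case unfolding power_Suc by (rule has_fps_expansion_mult[OF assms Suc])
qed simp

lemma has_fps_expansion_power_int:
  fixes F :: "complex fps"
  assumes "f has_fps_expansion F" "fps_nth F 0 \<noteq> 0"
  shows "(\<lambda>z. f z powi n) has_fps_expansion F powi n"
proof (cases "n \<ge> 0")
  case True
  show ?thesis unfolding power_int_def if_P[OF True]
    by (rule has_fps_expansion_power_nat[OF assms(1)])
next
  case False
  show ?thesis unfolding power_int_def if_not_P[OF False]
    by (rule has_fps_expansion_power_nat[OF has_fps_expansion_inverse[OF assms]])
qed

lemma dedekind_eta_of_nat_mult:
  "dedekind_eta (of_nat k * \<tau>) = q_pow (real k / 24) \<tau> * euler_fun k (q_pow 1 \<tau>)"
proof -
  have "q_pow x (of_nat k * \<tau>) = q_pow (real k * x) \<tau>" for x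
    by (simp add: q_pow_def mult_ac)
  thus ?thesis by (simp add: dedekind_eta_def euler_fun_def q_pow_power ring_distribs)
qed

definition euler_quotient :: "nat \<Rightarrow> (nat \<Rightarrow> int) \<Rightarrow> complex \<Rightarrow> complex" where
  "euler_quotient N r z = (\<Prod>\<delta> | \<delta> dvd N. euler_fun \<delta> z powi r \<delta>)"

text \<open>The index \<open>l\<close> performs q -> q^l in every factor: l = 1 gives the eta
  quotient without its fractional power of q, the prime l gives the product on the left-hand side of
  the congruence.\<close>

definition euler_quotient_fps :: "nat \<Rightarrow> nat \<Rightarrow> (nat \<Rightarrow> int) \<Rightarrow> complex fps" where
  "euler_quotient_fps l N r = (\<Prod>\<delta> | \<delta> dvd N. q_poch_inf (l * \<delta>) powi r \<delta>)"

lemma eta_quotient_eq: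
  "eta_quotient N r \<tau> =
     q_pow ((\<Sum>\<delta> | \<delta> dvd N. real \<delta> * of_int (r \<delta>)) / 24) \<tau> * euler_quotient N r (q_pow 1 \<tau>)"
  unfolding eta_quotient_def dedekind_eta_of_nat_mult
  unfolding power_int_mult_distrib prod.distrib q_pow_power_int q_pow_prod euler_quotient_def
    sum_divide_distrib by (simp add: mult.commute)

context
  fixes N :: nat and r :: "nat \<Rightarrow> int"
  assumes N: "N \<ge> 1"
begin

lemma divisor_pos: "\<delta> dvd N \<Longrightarrow> \<delta> > 0"
  using N by (auto intro!: Nat.gr0I)

lemma euler_quotient_holomorphic: "euler_quotient N r holomorphic_on ball 0 1"
  unfolding euler_quotient_def
  by (intro holomorphic_intros euler_fun_holomorphic) (auto simp: divisor_pos euler_fun_nonzero)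

lemma euler_quotient_nonzero: "norm z < 1 \<Longrightarrow> euler_quotient N r z \<noteq> 0"
  using N by (auto simp: euler_quotient_def divisor_pos euler_fun_nonzero)

lemma euler_quotient_uminus: "euler_quotient N (\<lambda>\<delta>. - r \<delta>) z = 1 / euler_quotient N r z"
  by (simp add: euler_quotient_def power_int_minus inverse_eq_divide prod_dividef)

lemma euler_quotient_has_fps_expansion:
  assumes "l > 0"
  shows "(\<lambda>z. euler_quotient N r (z ^ l)) has_fps_expansion euler_quotient_fps l N r"
  unfolding euler_quotient_def euler_quotient_fps_def euler_fun_power[symmetric]
proof (rule has_fps_expansion_prod)
  fix \<delta> assume "\<delta> \<in> {\<delta>. \<delta> dvd N}"
  hence pos: "l * \<delta> > 0" using assms divisor_pos by auto
  show "(\<lambda>z. euler_fun (l * \<delta>) z powi r \<delta>) has_fps_expansion q_poch_inf (l * \<delta>) powi r \<delta>"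
    by (rule has_fps_expansion_power_int[OF euler_fun_has_fps_expansion[OF pos]])
       (simp add: q_poch_inf_limit(3)[OF pos])
qed

lemma int_euler_quotient_fps: "l > 0 \<Longrightarrow> int_fps (euler_quotient_fps l N r)"
  unfolding euler_quotient_fps_def
  using divisor_pos by (intro int_fps_prod int_fps_power_int q_poch_inf_limit) auto

lemma euler_quotient_fps_nth_0: "l > 0 \<Longrightarrow> fps_nth (euler_quotient_fps l N r) 0 = 1"
  unfolding euler_quotient_fps_def prod_fps_nth_0
  by (intro prod.neutral ballI fps_nth_0_power_int q_poch_inf_limit) (auto simp: divisor_pos)

end

section \<open>The substitution operator V_l and identification of power series on the punctured
  disc\<close>

definition fps_expand :: "nat \<Rightarrow> complex fps \<Rightarrow> complex fps" where
  "fps_expand l F = Abs_fps (\<lambda>n. if l dvd n then fps_nth F (n div l) else 0)"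

lemma sums_fps_expand:
  assumes "l > 0" "(\<lambda>n. fps_nth F n * (z ^ l) ^ n) sums s"
  shows "(\<lambda>n. fps_nth (fps_expand l F) n * z ^ n) sums s"
proof -
  have mono: "strict_mono (\<lambda>n. l * n)" using assms(1) by (auto intro!: strict_monoI)
  have "(\<lambda>n. fps_nth (fps_expand l F) (l * n) * z ^ (l * n)) sums s"
    using assms by (simp add: fps_expand_def power_mult)
  also have "?this \<longleftrightarrow> ?thesis"
    by (rule sums_mono_reindex[OF mono]) (auto simp: fps_expand_def)
  finally show ?thesis .
qed

lemma has_fps_expansion_sums_ball:
  assumes "f has_fps_expansion F" "f holomorphic_on ball 0 1" "norm z < 1"
  shows "(\<lambda>n. fps_nth F n * z ^ n) sums f z"
  by (rule has_fps_expansion_imp_sums_complex[OF assms(1), of 1]) (use assms in auto)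

lemma fps_conv_radius_ge_1I:
  fixes F :: "complex fps"
  assumes "\<And>z. z \<noteq> 0 \<Longrightarrow> norm z < 1 \<Longrightarrow> summable (\<lambda>n. fps_nth F n * z ^ n)"
  shows "fps_conv_radius F \<ge> 1"
  unfolding fps_conv_radius_def
proof (rule conv_radius_geI_ex)
  fix r :: real assume r: "0 < r" "ereal r < 1"
  have "summable (\<lambda>n. fps_nth F n * of_real r ^ n)"
    by (rule assms) (use r in auto)
  thus "\<exists>z. norm z = r \<and> summable (\<lambda>n. fps_nth F n * z ^ n)"
    using r by (intro exI[of _ "of_real r"]) auto
qed

lemma less_fps_conv_radius:
  "fps_conv_radius F \<ge> 1 \<Longrightarrow> norm z < 1 \<Longrightarrow> ereal (norm z) < fps_conv_radius F"
  by (rule less_le_trans[of _ 1]) auto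

lemma eval_fps_holomorphic_ball:
  fixes F :: "complex fps"
  shows "fps_conv_radius F \<ge> 1 \<Longrightarrow> eval_fps F holomorphic_on ball 0 1"
  by (rule holomorphic_on_eval_fps) (auto intro: less_fps_conv_radius)

text \<open>Convergence is assumed only for nonzero z because q is never 0; holomorphy of
  \<open>f\<close> supplies the value at 0 by continuity.\<close>

lemma sums_imp_has_fps_expansion:
  fixes F :: "complex fps"
  assumes "\<And>z. z \<noteq> 0 \<Longrightarrow> norm z < 1 \<Longrightarrow> (\<lambda>n. fps_nth F n * z ^ n) sums f z"
    and f: "f holomorphic_on ball 0 1"
  shows "f has_fps_expansion F"
proof -
  have R: "fps_conv_radius F \<ge> 1"
    by (rule fps_conv_radius_ge_1I) (use assms(1) in \<open>auto simp: sums_iff\<close>)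
  note hol = eval_fps_holomorphic_ball[OF R]
  have eq: "eval_fps F z = f z" if "z \<in> ball 0 1 - {0}" for z
    unfolding eval_fps_def by (rule sums_unique[symmetric], rule assms(1)) (use that in auto)
  have "eval_fps F 0 = f 0"
  proof (rule tendsto_unique[of "at (0::complex)"])
    have lim: "(h \<longlongrightarrow> h 0) (at 0)" if "h holomorphic_on ball 0 1" for h :: "complex \<Rightarrow> complex"
      using continuous_on_interior[OF holomorphic_on_imp_continuous_on[OF that], of 0]
      by (simp add: isCont_def)
    show "(eval_fps F \<longlongrightarrow> eval_fps F 0) (at 0)" by (rule lim[OF hol])
    have "eventually (\<lambda>z. z \<in> ball 0 1 - {0}) (at (0::complex))"
      by (rule eventually_at_in_open) auto
    hence "eventually (\<lambda>z. f z = eval_fps F z) (at 0)"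
      by eventually_elim (use eq in auto)
    thus "(eval_fps F \<longlongrightarrow> f 0) (at 0)" by (rule Lim_transform_eventually[OF lim[OF f]])
  qed auto
  hence "eval_fps F z = f z" if "z \<in> ball 0 1" for z using eq that by (cases "z = 0") auto
  moreover have "eventually (\<lambda>z. z \<in> ball 0 1) (nhds (0::complex))"
    by (rule eventually_nhds_in_open) auto
  ultimately have "eventually (\<lambda>z. eval_fps F z = f z) (nhds 0)"
    by (auto elim: eventually_mono)
  moreover have "fps_conv_radius F > 0" using R less_le_trans[of 0 1 "fps_conv_radius F"] by auto
  ultimately show ?thesis unfolding has_fps_expansion_def by blast
qed

text \<open>Both series are Taylor expansions at 0 of the same function, which avoids rearranging
  formal infinite products.\<close>

lemma euler_quotient_fps_expand:
  assumes "N \<ge> 1" "l > 0"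
  shows "euler_quotient_fps l N r = fps_expand l (euler_quotient_fps 1 N r)"
proof (rule fps_expansion_unique_complex)
  show "(\<lambda>z. euler_quotient N r (z ^ l)) has_fps_expansion euler_quotient_fps l N r"
    by (rule euler_quotient_has_fps_expansion[OF assms])
  have small: "norm (z ^ l) < 1" if "norm z < 1" for z :: complex
    using that assms by (simp add: norm_power power_less_one_iff)
  show "(\<lambda>z. euler_quotient N r (z ^ l)) has_fps_expansion fps_expand l (euler_quotient_fps 1 N r)"
  proof (rule sums_imp_has_fps_expansion)
    fix z :: complex assume z: "norm z < 1"
    have "(\<lambda>n. fps_nth (euler_quotient_fps 1 N r) n * (z ^ l) ^ n) sums euler_quotient N r (z ^ l)"
      using euler_quotient_has_fps_expansion[OF assms(1), of 1 r] small[OF z]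
      by (intro has_fps_expansion_sums_ball euler_quotient_holomorphic[OF assms(1)]) auto
    thus "(\<lambda>n. fps_nth (fps_expand l (euler_quotient_fps 1 N r)) n * z ^ n) sums euler_quotient N r (z ^ l)"
      by (rule sums_fps_expand[OF assms(2)])
  next
    show "(\<lambda>z. euler_quotient N r (z ^ l)) holomorphic_on ball 0 1"
    proof -
      have "(\<lambda>z. z ^ l) holomorphic_on ball (0::complex) 1" by (intro holomorphic_intros)
      moreover have "(\<lambda>z. z ^ l) ` ball (0::complex) 1 \<subseteq> ball 0 1" using small by auto
      ultimately show ?thesis
        using holomorphic_on_compose_gen[OF _ euler_quotient_holomorphic[OF assms(1)], of "\<lambda>z. z ^ l" _ r]
        by (simp add: o_def)
    qed
  qed
qed


lemma fps_eqI_sums: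
  fixes F G :: "complex fps"
  assumes "\<And>z. z \<noteq> 0 \<Longrightarrow> norm z < 1 \<Longrightarrow> (\<lambda>n. fps_nth F n * z ^ n) sums f z"
    and "\<And>z. z \<noteq> 0 \<Longrightarrow> norm z < 1 \<Longrightarrow> (\<lambda>n. fps_nth G n * z ^ n) sums f z"
  shows "F = G"
proof -
  have R: "fps_conv_radius G \<ge> 1"
    by (rule fps_conv_radius_ge_1I) (use assms(2) in \<open>auto simp: sums_iff\<close>)
  show ?thesis
  proof (rule fps_expansion_unique_complex)
    show "eval_fps G has_fps_expansion G"
      by (rule eval_fps_has_fps_expansion) (use R less_le_trans[of 0 1 "fps_conv_radius G"] in auto)
    show "eval_fps G has_fps_expansion F"
    proof (rule sums_imp_has_fps_expansion[OF _ eval_fps_holomorphic_ball[OF R]])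
      fix z :: complex assume z: "z \<noteq> 0" "norm z < 1"
      have "eval_fps G z = f z"
        unfolding eval_fps_def by (rule sums_unique[symmetric], rule assms(2)[OF z])
      thus "(\<lambda>n. fps_nth F n * z ^ n) sums eval_fps G z" using assms(1)[OF z] by simp
    qed
  qed
qed

lemma sums_fps_X_power_mult:
  fixes F :: "complex fps"
  assumes "(\<lambda>n. fps_nth F n * z ^ n) sums s"
  shows "(\<lambda>n. fps_nth (fps_X ^ m * F) n * z ^ n) sums (z ^ m * s)"
proof -
  have mono: "strict_mono (\<lambda>n. n + m)" by (auto intro!: strict_monoI)
  have "(\<lambda>n. z ^ m * (fps_nth F n * z ^ n)) sums (z ^ m * s)"
    by (rule sums_mult[OF assms])
  moreover have "fps_nth (fps_X ^ m * F) (n + m) = fps_nth F n" for n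
    by (simp add: fps_X_power_mult_nth)
  ultimately have "(\<lambda>n. fps_nth (fps_X ^ m * F) (n + m) * z ^ (n + m)) sums (z ^ m * s)"
    by (simp only: power_add) (simp only: mult_ac)
  also have "?this \<longleftrightarrow> ?thesis"
  proof (rule sums_mono_reindex[OF mono])
    fix n assume "n \<notin> range (\<lambda>n. n + m)"
    hence "n < m" by (metis le_add_diff_inverse2 not_le rangeI)
    thus "fps_nth (fps_X ^ m * F) n * z ^ n = 0" by (simp add: fps_X_power_mult_nth)
  qed
  finally show ?thesis .
qed

lemma euler_quotient_fps_inverse:
  assumes "N \<ge> 1"
  shows "euler_quotient_fps 1 N (\<lambda>\<delta>. - r \<delta>) * euler_quotient_fps 1 N r = 1"
proof (rule fps_expansion_unique_complex)
  have e: "euler_quotient N r has_fps_expansion euler_quotient_fps 1 N r" for r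
    using euler_quotient_has_fps_expansion[OF assms, of 1 r] by simp
  show "(\<lambda>z. euler_quotient N (\<lambda>\<delta>. - r \<delta>) z * euler_quotient N r z) has_fps_expansion
          euler_quotient_fps 1 N (\<lambda>\<delta>. - r \<delta>) * euler_quotient_fps 1 N r"
    by (rule has_fps_expansion_mult[OF e e])
  have "eventually (\<lambda>z. z \<in> ball 0 1) (nhds (0::complex))"
    by (rule eventually_nhds_in_open) auto
  hence "eventually (\<lambda>z. euler_quotient N (\<lambda>\<delta>. - r \<delta>) z * euler_quotient N r z = 1) (nhds 0)"
    by eventually_elim (use euler_quotient_nonzero[OF assms, of _ r] in \<open>auto simp: euler_quotient_uminus[OF assms]\<close>)
  thus "(\<lambda>z. euler_quotient N (\<lambda>\<delta>. - r \<delta>) z * euler_quotient N r z) has_fps_expansion 1"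
    by (subst has_fps_expansion_cong[OF _ refl]) auto
qed

lemma euler_quotient_sums:
  assumes "N \<ge> 1" "norm z < 1"
  shows "(\<lambda>n. fps_nth (euler_quotient_fps 1 N r) n * z ^ n) sums euler_quotient N r z"
  using euler_quotient_has_fps_expansion[OF assms(1), of 1 r] assms(2)
  by (intro has_fps_expansion_sums_ball euler_quotient_holomorphic[OF assms(1)]) auto

text \<open>The a(n) are given only through a convergent expansion. Identified with the coefficients
  of a product of integer series, they become accessible to congruences.\<close>

lemma eta_quotient_coefficients:
  fixes a :: "int \<Rightarrow> complex"
  assumes N: "N \<ge> 1"
    and \<alpha>: "\<alpha> = (\<Sum>\<delta> | \<delta> dvd N. real \<delta> * of_int (r \<delta>)) / 24"
    and a: "\<And>\<tau>. \<tau> \<in> upper_half_plane \<Longrightarrow>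
           ((\<lambda>n. a n * q_pow (of_int n + \<alpha>) \<tau>) has_sum eta_quotient N r \<tau>) {0..}"
  shows "Abs_fps (\<lambda>n. a (int n)) = euler_quotient_fps 1 N r"
proof (rule fps_eqI_sums[where f = "euler_quotient N r"])
  fix z :: complex assume z: "z \<noteq> 0" "norm z < 1"
  show "(\<lambda>n. fps_nth (euler_quotient_fps 1 N r) n * z ^ n) sums euler_quotient N r z"
    by (rule euler_quotient_sums[OF N z(2)])
  obtain \<tau> where \<tau>: "\<tau> \<in> upper_half_plane" "q_pow 1 \<tau> = z"
    using q_pow_surj[OF z, of 1] by auto
  have "bij_betw int UNIV {0..}"
    by (rule bij_betwI[of _ _ _ nat]) auto
  from has_sum_reindex_bij_betw[OF this, of "\<lambda>n. a n * q_pow (of_int n + \<alpha>) \<tau>" "eta_quotient N r \<tau>"] a[OF \<tau>(1)]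
  have "((\<lambda>n. a (int n) * q_pow (real n + \<alpha>) \<tau>) has_sum eta_quotient N r \<tau>) UNIV"
    by simp
  hence "(\<lambda>n. a (int n) * q_pow (real n + \<alpha>) \<tau>) sums eta_quotient N r \<tau>"
    by (rule has_sum_imp_sums)
  hence "(\<lambda>n. a (int n) * q_pow (real n + \<alpha>) \<tau> / q_pow \<alpha> \<tau>) sums (eta_quotient N r \<tau> / q_pow \<alpha> \<tau>)"
    by (rule sums_divide)
  moreover have "eta_quotient N r \<tau> / q_pow \<alpha> \<tau> = euler_quotient N r z"
    by (simp add: eta_quotient_eq \<alpha> \<tau>(2))
  moreover have "q_pow (real n) \<tau> = z ^ n" for n
    using q_pow_power[of 1 \<tau> n] by (simp add: \<tau>(2))
  ultimately show "(\<lambda>n. fps_nth (Abs_fps (\<lambda>n. a (int n))) n * z ^ n) sums euler_quotient N r z"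
    by (simp add: q_pow_add)
qed

section \<open>Theta series with square exponents\<close>

definition square_fibre_sum :: "(int \<Rightarrow> complex) \<Rightarrow> nat \<Rightarrow> complex" where
  "square_fibre_sum b e = (\<Sum>m | m\<^sup>2 = int e. b m)"

lemma finite_square_fibre: "finite {m::int. m\<^sup>2 = int e}"
proof (rule finite_subset)
  show "{m::int. m\<^sup>2 = int e} \<subseteq> {- int e..int e}"
  proof
    fix m :: int assume "m \<in> {m. m\<^sup>2 = int e}"
    hence "\<bar>m\<bar> * \<bar>m\<bar> = int e" by (simp add: power2_eq_square abs_mult_self_eq)
    moreover have "1 * \<bar>m\<bar> \<le> \<bar>m\<bar> * \<bar>m\<bar>"
      by (cases "m = 0") (simp, rule mult_right_mono, auto)
    ultimately show "m \<in> {- int e..int e}" by auto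
  qed
qed auto

lemma square_exponents_sums:
  assumes "((\<lambda>m. b m * z ^ nat (m\<^sup>2)) has_sum s) UNIV"
  shows "(\<lambda>e. square_fibre_sum b e * z ^ e) sums s"
proof -
  define S where "S = Sigma UNIV (\<lambda>e. {m::int. m\<^sup>2 = int e})"
  have bij: "bij_betw (\<lambda>m. (nat (m\<^sup>2), m)) UNIV S"
    by (rule bij_betwI[of _ _ _ snd]) (auto simp: S_def)
  have "((\<lambda>(e, m). b m * z ^ e) has_sum s) S"
    using has_sum_reindex_bij_betw[OF bij, of "\<lambda>(e, m). b m * z ^ e" s] assms by simp
  hence "((\<lambda>e. square_fibre_sum b e * z ^ e) has_sum s) UNIV"
    unfolding S_def
  proof (rule has_sum_SigmaD)
    fix e :: nat
    have "((\<lambda>m. b m * z ^ e) has_sum (\<Sum>m | m\<^sup>2 = int e. b m * z ^ e)) {m. m\<^sup>2 = int e}"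
      by (rule has_sum_finite[OF finite_square_fibre])
    thus "((\<lambda>y. case (e, y) of (e, m) \<Rightarrow> b m * z ^ e) has_sum square_fibre_sum b e * z ^ e) {m. m\<^sup>2 = int e}"
      by (simp add: square_fibre_sum_def sum_distrib_right)
  qed
  thus ?thesis by (rule has_sum_imp_sums)
qed

lemma square_fibre_sum_nonzero:
  "square_fibre_sum b e \<noteq> 0 \<Longrightarrow> \<exists>m::nat. e = m\<^sup>2"
proof -
  assume "square_fibre_sum b e \<noteq> 0"
  then obtain m :: int where "m\<^sup>2 = int e"
    unfolding square_fibre_sum_def by (metis (mono_tags, lifting) mem_Collect_eq sum.neutral)
  hence "int (nat \<bar>m\<bar> ^ 2) = int e" by simp
  thus ?thesis by (metis of_nat_eq_iff)
qed

text \<open>If p^2 divides m^2 then p divides m, so multiplication by p is a bijection from the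
  fibre over e to the fibre over p^2 e.\<close>

lemma square_fibre_sum_scale:
  assumes "p > 0" "\<And>m. b (int p * m) = c * b m"
  shows "square_fibre_sum b (p\<^sup>2 * e) = c * square_fibre_sum b e"
  unfolding square_fibre_sum_def sum_distrib_left
proof (rule sum.reindex_bij_witness[of _ "\<lambda>m. int p * m" "\<lambda>m. m div int p"])
  fix m :: int assume "m \<in> {m. m\<^sup>2 = int (p\<^sup>2 * e)}"
  hence m: "m\<^sup>2 = (int p)\<^sup>2 * int e" by simp
  hence "int p dvd m" by (metis dvd_triv_left pow_divides_pow_iff zero_less_numeral)
  then obtain k where k: "m = int p * k" by blast
  show "int p * (m div int p) = m" using k assms(1) by simp
  show "m div int p \<in> {m. m\<^sup>2 = int e}" using m k assms(1) by (simp add: power_mult_distrib)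
  show "c * b (m div int p) = b m" using k assms by simp
qed (use assms(1) in \<open>auto simp: power_mult_distrib\<close>)

text \<open>In z = q^(1/w) the theta series equals z^t times the Euler quotient at z^w; comparing
  coefficients places coefficient k of the quotient at the exponent t + w k. Where that coefficient
  is nonzero, t + w k is therefore a perfect square.\<close>

lemma theta_coefficients:
  fixes b :: "int \<Rightarrow> complex" and t w :: int
  assumes N: "N \<ge> 1" and w: "w > 0"
    and tw: "of_int t / of_int w = (\<Sum>\<delta> | \<delta> dvd N. real \<delta> * of_int (r \<delta>)) / 24"
    and b: "\<And>\<tau>. \<tau> \<in> upper_half_plane \<Longrightarrow>
           ((\<lambda>m. b m * q_pow (of_int (m ^ 2) / of_int w) \<tau>) has_sum eta_quotient N r \<tau>) UNIV"
  shows "t \<ge> 0"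
    and "square_fibre_sum b e = (if nat t \<le> e \<and> nat w dvd (e - nat t)
           then fps_nth (euler_quotient_fps 1 N r) ((e - nat t) div nat w) else 0)"
proof -
  define C where "C = Abs_fps (square_fibre_sum b)"
  define B where "B = fps_expand (nat w) (euler_quotient_fps 1 N r)"
  have sums: "(\<lambda>n. fps_nth C n * z ^ n) sums (z powi t * euler_quotient N r (z ^ nat w))"
       "(\<lambda>n. fps_nth B n * z ^ n) sums euler_quotient N r (z ^ nat w)"
    if z: "z \<noteq> 0" "norm z < 1" for z
  proof -
    obtain \<tau> where \<tau>: "\<tau> \<in> upper_half_plane" "q_pow (1 / of_int w) \<tau> = z"
      using q_pow_surj[OF z, of "1 / of_int w"] w by auto
    have "q_pow (of_int (m\<^sup>2) / of_int w) \<tau> = z ^ nat (m\<^sup>2)" for m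
      by (simp add: q_pow_power flip: \<tau>(2))
    with b[OF \<tau>(1)] have "((\<lambda>m. b m * z ^ nat (m\<^sup>2)) has_sum eta_quotient N r \<tau>) UNIV" by simp
    hence "(\<lambda>n. fps_nth C n * z ^ n) sums eta_quotient N r \<tau>"
      unfolding C_def fps_nth_Abs_fps by (rule square_exponents_sums)
    moreover have "q_pow (of_int t / of_int w) \<tau> = z powi t"
      by (simp add: q_pow_power_int flip: \<tau>(2))
    moreover have "q_pow 1 \<tau> = z ^ nat w"
      using w by (simp add: q_pow_power flip: \<tau>(2))
    ultimately show "(\<lambda>n. fps_nth C n * z ^ n) sums (z powi t * euler_quotient N r (z ^ nat w))"
      by (simp add: eta_quotient_eq flip: tw)
    have "norm (z ^ nat w) < 1" using z w by (simp add: norm_power power_less_one_iff)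
    from sums_fps_expand[OF _ euler_quotient_sums[OF N this]] w
    show "(\<lambda>n. fps_nth B n * z ^ n) sums euler_quotient N r (z ^ nat w)" by (simp add: B_def)
  qed
  show t: "t \<ge> 0"
  proof (rule ccontr)
    assume neg: "\<not> t \<ge> 0"
    \<comment> \<open>For negative t the factor z^t is moved to the side of the theta series, which
      then has constant term 0 while the Euler quotient has constant term 1.\<close>
    have "fps_X ^ nat (- t) * C = B"
    proof (rule fps_eqI_sums)
      fix z :: complex assume z: "z \<noteq> 0" "norm z < 1"
      have "z ^ nat (- t) * (z powi t * euler_quotient N r (z ^ nat w)) = euler_quotient N r (z ^ nat w)"
        using neg z by (simp add: power_int_def field_simps)
      with sums_fps_X_power_mult[OF sums(1)[OF z], of "nat (- t)"]
      show "(\<lambda>n. fps_nth (fps_X ^ nat (- t) * C) n * z ^ n) sums euler_quotient N r (z ^ nat w)" by simp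
      show "(\<lambda>n. fps_nth B n * z ^ n) sums euler_quotient N r (z ^ nat w)" by (rule sums(2)[OF z])
    qed
    hence "fps_nth (fps_X ^ nat (- t) * C) 0 = fps_nth B 0" by simp
    thus False using neg euler_quotient_fps_nth_0[OF N, of 1 r]
      by (simp add: B_def fps_expand_def fps_X_power_mult_nth)
  qed
  have "C = fps_X ^ nat t * B"
  proof (rule fps_eqI_sums)
    fix z :: complex assume z: "z \<noteq> 0" "norm z < 1"
    show "(\<lambda>n. fps_nth (fps_X ^ nat t * B) n * z ^ n) sums (z ^ nat t * euler_quotient N r (z ^ nat w))"
      by (rule sums_fps_X_power_mult[OF sums(2)[OF z]])
    show "(\<lambda>n. fps_nth C n * z ^ n) sums (z ^ nat t * euler_quotient N r (z ^ nat w))"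
      using sums(1)[OF z] t by (simp add: power_int_def)
  qed
  hence "fps_nth C e = fps_nth (fps_X ^ nat t * B) e" by simp
  thus "square_fibre_sum b e = (if nat t \<le> e \<and> nat w dvd (e - nat t)
           then fps_nth (euler_quotient_fps 1 N r) ((e - nat t) div nat w) else 0)"
    by (auto simp: C_def B_def fps_expand_def fps_X_power_mult_nth)
qed

subsection \<open>Fourier expansion of Rankin--Cohen brackets\<close>

text \<open>The operator D conjugated by q^\<alpha>: D (q^\<alpha> F) = q^\<alpha> (\<alpha> F + q
  F').\<close>

definition theta_fps :: "real \<Rightarrow> complex fps \<Rightarrow> complex fps" where
  "theta_fps \<alpha> F = fps_const (of_real \<alpha>) * F + fps_X * fps_deriv F"

lemma theta_fps_nth: "fps_nth (theta_fps \<alpha> F) n = (of_nat n + of_real \<alpha>) * fps_nth F n"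
  by (cases n) (simp_all add: theta_fps_def algebra_simps)

lemma theta_fps_funpow_nth:
  "fps_nth ((theta_fps \<alpha> ^^ j) F) n = (of_nat n + of_real \<alpha>) ^ j * fps_nth F n"
  by (induction j) (simp_all add: theta_fps_nth)

lemma fps_conv_radius_mult_ge_1:
  fixes F G :: "complex fps"
  shows "fps_conv_radius F \<ge> 1 \<Longrightarrow> fps_conv_radius G \<ge> 1 \<Longrightarrow> fps_conv_radius (F * G) \<ge> 1"
  by (rule order_trans[OF _ fps_conv_radius_mult]) simp

lemma fps_conv_radius_add_ge_1:
  fixes F G :: "complex fps"
  shows "fps_conv_radius F \<ge> 1 \<Longrightarrow> fps_conv_radius G \<ge> 1 \<Longrightarrow> fps_conv_radius (F + G) \<ge> 1"
  by (rule order_trans[OF _ fps_conv_radius_add]) simp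

lemma fps_conv_radius_theta:
  "fps_conv_radius F \<ge> 1 \<Longrightarrow> fps_conv_radius (theta_fps \<alpha> F) \<ge> 1"
  unfolding theta_fps_def
  by (intro fps_conv_radius_add_ge_1 fps_conv_radius_mult_ge_1) (auto intro: order_trans[OF _ fps_conv_radius_deriv])

lemma fps_conv_radius_theta_funpow:
  "fps_conv_radius F \<ge> 1 \<Longrightarrow> fps_conv_radius ((theta_fps \<alpha> ^^ j) F) \<ge> 1"
  by (induction j) (auto intro: fps_conv_radius_theta)

lemma fps_conv_radius_eval_sum:
  fixes F :: "'a \<Rightarrow> complex fps"
  assumes "finite A" "\<And>i. i \<in> A \<Longrightarrow> fps_conv_radius (F i) \<ge> 1" "norm z < 1"
  shows "fps_conv_radius (\<Sum>i\<in>A. F i) \<ge> 1 \<and> eval_fps (\<Sum>i\<in>A. F i) z = (\<Sum>i\<in>A. eval_fps (F i) z)"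
  using assms(1,2)
proof (induction A rule: finite_induct)
  case (insert x A)
  then show ?case
    using assms(3) by (auto simp: eval_fps_add less_fps_conv_radius intro: fps_conv_radius_add_ge_1)
qed simp

lemma D_op_q_series:
  assumes F: "fps_conv_radius F \<ge> 1" and \<tau>: "\<tau> \<in> upper_half_plane"
  shows "D_op (\<lambda>\<tau>. q_pow \<alpha> \<tau> * eval_fps F (q_pow 1 \<tau>)) \<tau> =
           q_pow \<alpha> \<tau> * eval_fps (theta_fps \<alpha> F) (q_pow 1 \<tau>)"
proof -
  define q where "q = q_pow 1 \<tau>"
  have q: "norm q < 1" using norm_q_pow_less_1[OF _ \<tau>, of 1] by (simp add: q_def)
  have d1: "(q_pow x has_field_derivative (2 * of_real pi * \<i> * of_real x) * q_pow x \<tau>) (at \<tau>)" for x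
    unfolding q_pow_def by (rule derivative_eq_intros refl | simp)+
  have d2: "(eval_fps F has_field_derivative eval_fps (fps_deriv F) q) (at (q_pow 1 \<tau>))"
    unfolding q_def
    by (rule has_field_derivative_eval_fps) (use less_fps_conv_radius[OF F] q in \<open>simp add: q_def\<close>)
  have "D_op (\<lambda>\<tau>. q_pow \<alpha> \<tau> * eval_fps F (q_pow 1 \<tau>)) \<tau> =
     ((2 * of_real pi * \<i> * of_real \<alpha>) * q_pow \<alpha> \<tau> * eval_fps F (q_pow 1 \<tau>) +
      eval_fps (fps_deriv F) q * ((2 * of_real pi * \<i> * of_real 1) * q_pow 1 \<tau>) * q_pow \<alpha> \<tau>) / (2 * of_real pi * \<i>)"
    by (rule D_op_eqI[OF DERIV_mult[OF d1 DERIV_chain2[OF d2 d1]]])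
  also have "\<dots> = q_pow \<alpha> \<tau> * (of_real \<alpha> * eval_fps F q + q * eval_fps (fps_deriv F) q)"
    by (simp add: q_def field_simps)
  also have "of_real \<alpha> * eval_fps F q + q * eval_fps (fps_deriv F) q = eval_fps (theta_fps \<alpha> F) q"
  proof -
    have R: "fps_conv_radius (fps_deriv F) \<ge> 1" using F fps_conv_radius_deriv by (rule order_trans)
    have R1: "fps_conv_radius (fps_const (of_real \<alpha>) * F) \<ge> 1"
      by (intro fps_conv_radius_mult_ge_1 F) simp
    have R2: "fps_conv_radius (fps_X * fps_deriv F) \<ge> 1"
      by (intro fps_conv_radius_mult_ge_1 R) simp
    show ?thesis
      unfolding theta_fps_def using q F R R1 R2
      by (subst eval_fps_add) (simp_all add: less_fps_conv_radius eval_fps_mult)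
  qed
  finally show ?thesis by (simp add: q_def)
qed

lemma D_op_funpow_q_series:
  assumes F: "fps_conv_radius F \<ge> 1" and \<tau>: "\<tau> \<in> upper_half_plane"
    and f: "\<And>\<tau>. \<tau> \<in> upper_half_plane \<Longrightarrow> f \<tau> = q_pow \<alpha> \<tau> * eval_fps F (q_pow 1 \<tau>)"
  shows "(D_op ^^ j) f \<tau> = q_pow \<alpha> \<tau> * eval_fps ((theta_fps \<alpha> ^^ j) F) (q_pow 1 \<tau>)"
  using \<tau>
proof (induction j arbitrary: \<tau>)
  case (Suc j)
  have "(D_op ^^ Suc j) f \<tau> = D_op (\<lambda>\<tau>. q_pow \<alpha> \<tau> * eval_fps ((theta_fps \<alpha> ^^ j) F) (q_pow 1 \<tau>)) \<tau>"
    using D_op_cong[OF Suc.IH Suc.prems] by simp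
  also have "\<dots> = q_pow \<alpha> \<tau> * eval_fps ((theta_fps \<alpha> ^^ Suc j) F) (q_pow 1 \<tau>)"
    by (simp add: D_op_q_series[OF fps_conv_radius_theta_funpow[OF F] Suc.prems])
  finally show ?case .
qed (simp add: f)

text \<open>The bracket of q^x and q^y is q^(x + y) times this value.\<close>

definition rankin_cohen_symbol :: "real \<Rightarrow> real \<Rightarrow> nat \<Rightarrow> complex \<Rightarrow> complex \<Rightarrow> complex" where
  "rankin_cohen_symbol a b v x y =
     (\<Sum>j\<le>v. (-1) ^ j * of_real ((a + real v - 1) gchoose (v - j)) * of_real ((b + real v - 1) gchoose j)
        * x ^ j * y ^ (v - j))"

text \<open>The exponents -\<alpha> and \<alpha> of the two factors cancel in every product, so the
  bracket is a power series in q although neither factor need be one.\<close>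

definition rankin_cohen_fps ::
    "real \<Rightarrow> real \<Rightarrow> nat \<Rightarrow> real \<Rightarrow> complex fps \<Rightarrow> complex fps \<Rightarrow> complex fps" where
  "rankin_cohen_fps a b v \<alpha> F G = Abs_fps (\<lambda>n. \<Sum>i\<le>n. fps_nth F i * fps_nth G (n - i) *
      rankin_cohen_symbol a b v (of_nat i - of_real \<alpha>) (of_nat (n - i) + of_real \<alpha>))"

lemma rankin_cohen_has_q_expansion:
  assumes F: "fps_conv_radius F \<ge> 1" and G: "fps_conv_radius G \<ge> 1"
    and f: "\<And>\<tau>. \<tau> \<in> upper_half_plane \<Longrightarrow> f \<tau> = q_pow (- \<alpha>) \<tau> * eval_fps F (q_pow 1 \<tau>)"
    and g: "\<And>\<tau>. \<tau> \<in> upper_half_plane \<Longrightarrow> g \<tau> = q_pow \<alpha> \<tau> * eval_fps G (q_pow 1 \<tau>)"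
  shows "has_q_expansion (rankin_cohen a f b g v) (rankin_cohen_fps a b v \<alpha> F G)"
  unfolding has_q_expansion_def
proof
  fix \<tau> assume \<tau>: "\<tau> \<in> upper_half_plane"
  define q where "q = q_pow 1 \<tau>"
  have q: "norm q < 1" using norm_q_pow_less_1[OF _ \<tau>, of 1] by (simp add: q_def)
  define c :: "nat \<Rightarrow> complex" where "c = (\<lambda>j. (-1) ^ j * of_real ((a + real v - 1) gchoose (v - j)) * of_real ((b + real v - 1) gchoose j))"
  define T where "T = (\<lambda>j. fps_const (c j) * ((theta_fps (- \<alpha>) ^^ j) F * (theta_fps \<alpha> ^^ (v - j)) G))"
  note R = fps_conv_radius_theta_funpow[OF F] fps_conv_radius_theta_funpow[OF G]
  have RT: "fps_conv_radius (T j) \<ge> 1" for j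
    unfolding T_def by (intro fps_conv_radius_mult_ge_1 R) simp
  have eT: "eval_fps (T j) q = c j * (D_op ^^ j) f \<tau> * (D_op ^^ (v - j)) g \<tau>" for j
  proof -
    have "eval_fps (T j) q = c j * (eval_fps ((theta_fps (- \<alpha>) ^^ j) F) q * eval_fps ((theta_fps \<alpha> ^^ (v - j)) G) q)"
      unfolding T_def using q R
      by (subst eval_fps_mult) (simp_all add: less_fps_conv_radius eval_fps_mult fps_conv_radius_mult_ge_1)
    thus ?thesis
      by (simp add: D_op_funpow_q_series[OF F \<tau> f] D_op_funpow_q_series[OF G \<tau> g] q_def q_pow_minus)
  qed
  have PT: "rankin_cohen_fps a b v \<alpha> F G = (\<Sum>j\<le>v. T j)"
  proof (rule fps_ext)
    fix n
    have "fps_nth (\<Sum>j\<le>v. T j) n = (\<Sum>j\<le>v. \<Sum>i\<le>n. c j *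
       (((of_nat i - of_real \<alpha>) ^ j * fps_nth F i) * ((of_nat (n - i) + of_real \<alpha>) ^ (v - j) * fps_nth G (n - i))))"
      unfolding fps_sum_nth T_def fps_mult_left_const_nth
      unfolding fps_mult_nth theta_fps_funpow_nth sum_distrib_left atLeast0AtMost by simp
    also have "\<dots> = (\<Sum>i\<le>n. fps_nth F i * fps_nth G (n - i) *
      rankin_cohen_symbol a b v (of_nat i - of_real \<alpha>) (of_nat (n - i) + of_real \<alpha>))"
      unfolding rankin_cohen_symbol_def sum_distrib_left c_def
      by (subst sum.swap) (intro sum.cong refl, simp only: mult_ac)
    finally show "fps_nth (rankin_cohen_fps a b v \<alpha> F G) n = fps_nth (\<Sum>j\<le>v. T j) n"
      by (simp add: rankin_cohen_fps_def)
  qed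
  have "fps_conv_radius (\<Sum>j\<le>v. T j) \<ge> 1" "eval_fps (\<Sum>j\<le>v. T j) q = rankin_cohen a f b g v \<tau>"
    using fps_conv_radius_eval_sum[of "{..v}" T q] RT q by (auto simp: rankin_cohen_def eT c_def)
  from sums_eval_fps[of q "\<Sum>j\<le>v. T j", OF less_fps_conv_radius[OF this(1) q]] this(2)
  have "(\<lambda>n. fps_nth (\<Sum>j\<le>v. T j) n * q ^ n) sums rankin_cohen a f b g v \<tau>" by simp
  moreover have "q ^ n = q_pow (real n) \<tau>" for n by (simp add: q_def q_pow_power)
  ultimately show "(\<lambda>n. fps_nth (rankin_cohen_fps a b v \<alpha> F G) n * q_pow (real n) \<tau>) sums rankin_cohen a f b g v \<tau>"
    by (simp add: PT)
qed

subsection \<open>Congruences modulo a prime\<close>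

lemma Z_localizedI: "\<not> int l dvd d \<Longrightarrow> x = of_int a / of_int d \<Longrightarrow> x \<in> Z_localized l"
  unfolding Z_localized_def by blast

lemma Z_localizedE:
  assumes "x \<in> Z_localized l"
  obtains a d where "\<not> int l dvd d" "x = of_int a / of_int d" "d \<noteq> 0"
  using assms unfolding Z_localized_def by auto

context
  fixes l :: nat
  assumes prime_l: "prime l"
begin

lemma Z_localized_of_int: "of_int n \<in> Z_localized l"
  by (rule Z_localizedI[of l 1 _ n]) (use prime_l in \<open>auto dest: prime_gt_1_nat\<close>)

lemma Z_localized_add:
  assumes "x \<in> Z_localized l" "y \<in> Z_localized l"
  shows "x + y \<in> Z_localized l"
proof -
  obtain a d where 1: "\<not> int l dvd d" "x = of_int a / of_int d" "d \<noteq> 0" using assms(1) by (rule Z_localizedE)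
  obtain b e where 2: "\<not> int l dvd e" "y = of_int b / of_int e" "e \<noteq> 0" using assms(2) by (rule Z_localizedE)
  show ?thesis
    by (rule Z_localizedI[of l "d * e" _ "a * e + b * d"])
       (use 1 2 prime_l in \<open>auto simp: prime_dvd_mult_iff field_simps\<close>)
qed

lemma Z_localized_mult:
  assumes "x \<in> Z_localized l" "y \<in> Z_localized l"
  shows "x * y \<in> Z_localized l"
proof -
  obtain a d where 1: "\<not> int l dvd d" "x = of_int a / of_int d" "d \<noteq> 0" using assms(1) by (rule Z_localizedE)
  obtain b e where 2: "\<not> int l dvd e" "y = of_int b / of_int e" "e \<noteq> 0" using assms(2) by (rule Z_localizedE)
  show ?thesis
    by (rule Z_localizedI[of l "d * e" _ "a * b"])
       (use 1 2 prime_l in \<open>auto simp: prime_dvd_mult_iff\<close>)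
qed

lemma Z_localized_uminus: "x \<in> Z_localized l \<Longrightarrow> - x \<in> Z_localized l"
  using Z_localized_mult[OF Z_localized_of_int[of "-1"]] by simp

lemma Z_localized_diff: "x \<in> Z_localized l \<Longrightarrow> y \<in> Z_localized l \<Longrightarrow> x - y \<in> Z_localized l"
  using Z_localized_add[OF _ Z_localized_uminus] by fastforce

lemma Z_localized_Ints: "x \<in> \<int> \<Longrightarrow> x \<in> Z_localized l"
  by (auto elim!: Ints_cases intro: Z_localized_of_int)

text \<open>One coefficient of \<open>fps_cong_mod\<close>. Membership of both sides in Z_(l) is
  built in: it makes the relation compatible with products, at the price that reflexivity requires
  integrality.\<close>

definition lcong :: "complex \<Rightarrow> complex \<Rightarrow> bool" where
  "lcong x y \<longleftrightarrow> x \<in> Z_localized l \<and> y \<in> Z_localized l \<and> (\<exists>z\<in>Z_localized l. x - y = of_nat l * z)"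

lemma lcong_refl: "x \<in> Z_localized l \<Longrightarrow> lcong x x"
  unfolding lcong_def using Z_localized_of_int[of 0] by force

lemma lcong_Ints: "x \<in> \<int> \<Longrightarrow> lcong x x"
  by (intro lcong_refl Z_localized_Ints)

lemma lcongI:
  "x \<in> Z_localized l \<Longrightarrow> y \<in> Z_localized l \<Longrightarrow> z \<in> Z_localized l \<Longrightarrow> x - y = of_nat l * z \<Longrightarrow> lcong x y"
  unfolding lcong_def by blast

lemma lcong_sym: "lcong x y \<Longrightarrow> lcong y x"
  unfolding lcong_def using Z_localized_uminus by (metis minus_diff_eq mult_minus_right)

lemma lcong_trans [trans]:
  assumes "lcong x y" "lcong y u"
  shows "lcong x u"
proof -
  from assms obtain z z' where "z \<in> Z_localized l" "x - y = of_nat l * z"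
    "z' \<in> Z_localized l" "y - u = of_nat l * z'" unfolding lcong_def by blast
  thus ?thesis using assms Z_localized_add[of z z']
    by (intro lcongI[of _ _ "z + z'"]) (auto simp: lcong_def algebra_simps)
qed

lemma lcong_add:
  assumes "lcong x y" "lcong x' y'"
  shows "lcong (x + x') (y + y')"
proof -
  from assms obtain z z' where z: "z \<in> Z_localized l" "x - y = of_nat l * z"
    "z' \<in> Z_localized l" "x' - y' = of_nat l * z'" unfolding lcong_def by blast
  have "x + x' - (y + y') = (x - y) + (x' - y')" by simp
  also have "\<dots> = of_nat l * (z + z')" unfolding z by (simp only: distrib_left)
  finally show ?thesis using assms z
    by (intro lcongI[of _ _ "z + z'"]) (auto simp: lcong_def intro!: Z_localized_add)
qed

lemma lcong_mult:
  assumes "lcong x y" "lcong x' y'"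
  shows "lcong (x * x') (y * y')"
proof -
  from assms obtain z z' where z: "z \<in> Z_localized l" "x - y = of_nat l * z"
    "z' \<in> Z_localized l" "x' - y' = of_nat l * z'" unfolding lcong_def by blast
  have "x * x' - y * y' = (x - y) * x' + y * (x' - y')" by (simp add: algebra_simps)
  also have "\<dots> = of_nat l * (z * x' + y * z')" unfolding z by (simp add: algebra_simps)
  finally show ?thesis using assms z
    by (intro lcongI[of _ _ "z * x' + y * z'"])
       (auto simp: lcong_def intro!: Z_localized_add Z_localized_mult)
qed

lemma lcong_minus: "lcong x y \<Longrightarrow> lcong (- x) (- y)"
  using lcong_mult[OF lcong_Ints[of "-1"]] by auto

lemma lcong_diff: "lcong x y \<Longrightarrow> lcong x' y' \<Longrightarrow> lcong (x - x') (y - y')"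
  using lcong_add[OF _ lcong_minus] by fastforce

lemma lcong_power: "lcong x y \<Longrightarrow> lcong (x ^ n) (y ^ n)"
  by (induction n) (auto intro: lcong_mult lcong_Ints)

lemma lcong_sum: "(\<And>i. i \<in> A \<Longrightarrow> lcong (f i) (g i)) \<Longrightarrow> lcong (\<Sum>i\<in>A. f i) (\<Sum>i\<in>A. g i)"
  by (induction A rule: infinite_finite_induct) (auto intro: lcong_add lcong_Ints)

lemma lcong_prod: "(\<And>i. i \<in> A \<Longrightarrow> lcong (f i) (g i)) \<Longrightarrow> lcong (\<Prod>i\<in>A. f i) (\<Prod>i\<in>A. g i)"
  by (induction A rule: infinite_finite_induct) (auto intro: lcong_mult lcong_Ints)

lemma lcong_of_int:
  assumes "[m = n] (mod int l)"
  shows "lcong (of_int m) (of_int n)"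
proof -
  obtain k where "m - n = int l * k" using assms by (auto simp: cong_iff_dvd_diff)
  hence "of_int (m - n) = (of_int (int l * k) :: complex)" by simp
  thus ?thesis
    by (intro lcongI[of _ _ "of_int k"]) (auto intro: Z_localized_of_int)
qed

lemma lcong_divide_const:
  assumes "lcong x y" "\<not> int l dvd d"
  shows "lcong (x / of_int d) (y / of_int d)"
  using lcong_mult[OF assms(1) lcong_refl[OF Z_localizedI[OF assms(2), of _ 1]]] by simp

text \<open>For k < l the factorial of k is prime to l, so dividing congruent falling factorials by
  it keeps them congruent.\<close>

lemma lcong_gbinomial:
  assumes "lcong x y" "k < l"
  shows "lcong (x gchoose k) (y gchoose k)"
proof -
  have "\<not> l dvd fact k" using prime_l assms(2) by (simp add: prime_dvd_fact_iff)
  hence "\<not> int l dvd fact k" by (metis of_nat_dvd_iff of_nat_fact)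
  moreover have "lcong (\<Prod>i = 0..<k. x - of_nat i) (\<Prod>i = 0..<k. y - of_nat i)"
    by (intro lcong_prod lcong_diff assms(1) lcong_Ints) auto
  ultimately have "lcong ((\<Prod>i = 0..<k. x - of_nat i) / of_int (fact k)) ((\<Prod>i = 0..<k. y - of_nat i) / of_int (fact k))"
    by (rule lcong_divide_const[rotated])
  thus ?thesis by (simp add: gbinomial_prod_rev)
qed

section \<open>The Rankin--Cohen symbol modulo a prime l \<ge> 5\<close>

context
  assumes l5: "l \<ge> 5"
begin

lemma odd_l: "odd l"
  using prime_l l5 by (intro prime_odd_nat) auto

lemma not_dvd_small: "d > 0 \<Longrightarrow> d < int l \<Longrightarrow> \<not> int l dvd d"
  using zdvd_imp_le by fastforce

text \<open>The parameters of the two binomial coefficients are congruent to \<open>- 2\<close> and \<open>- 1\<close>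
  because \<open>v = (l - 1) / 2\<close>.\<close>

lemma lcong_rankin_cohen_symbol:
  fixes x y :: complex
  assumes x: "x \<in> Z_localized l" and y: "y \<in> Z_localized l" and xy: "lcong (x + y) 0"
    and v: "2 * v + 1 = l"
  shows "lcong (8 / 3 * rankin_cohen_symbol (- 1 / 2) (1 / 2) v x y) ((-1) ^ v * y ^ v)"
proof -
  have v': "(of_nat v :: complex) = (of_nat l - 1) / 2" using arg_cong[OF v, of "of_nat :: nat \<Rightarrow> complex"] by (simp add: field_simps)
  have half: "1 / 2 \<in> Z_localized l"
    by (rule Z_localizedI[of l 2 _ 1]) (use not_dvd_small[of 2] l5 in auto)
  have mem: "of_nat l * (1 / 2) - of_int n \<in> Z_localized l" for n
    using Z_localized_diff[OF Z_localized_mult[OF Z_localized_of_int[of "int l"] half] Z_localized_of_int[of n]]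
    by simp
  have A: "lcong (of_real (- 1 / 2 + real v - 1)) (- 2)"
  proof -
    have "of_real (- 1 / 2 + real v - 1) = of_nat l * (1 / 2) - (of_int 2 :: complex)"
      by (simp add: v' field_simps)
    thus ?thesis using mem[of 2] Z_localized_of_int[of "-2"] half
      by (intro lcongI[of _ _ "1 / 2"]) simp_all
  qed
  have B: "lcong (of_real (1 / 2 + real v - 1)) (- 1)"
  proof -
    have "of_real (1 / 2 + real v - 1) = of_nat l * (1 / 2) - (of_int 1 :: complex)"
      by (simp add: v' field_simps)
    thus ?thesis using mem[of 1] Z_localized_of_int[of "-1"] half
      by (intro lcongI[of _ _ "1 / 2"]) simp_all
  qed
  have xmy: "lcong x (- y)"
    using lcong_diff[OF xy lcong_refl[OF y]] by simp
  have bin2: "(- 2 :: complex) gchoose k = (-1) ^ k * (of_nat k + 1)" for k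
  proof -
    have "((2::complex) + of_nat k - 1) gchoose k = of_nat (Suc k) gchoose k" by (simp add: algebra_simps)
    also have "\<dots> = of_nat (Suc k choose k)" by (rule binomial_gbinomial[symmetric])
    finally show ?thesis using gbinomial_minus[of "2 :: complex" k] by simp
  qed
  have bin1: "(- 1 :: complex) gchoose k = (-1) ^ k" for k
    using gbinomial_minus[of "1 :: complex" k] binomial_gbinomial[of k k, where ?'a = complex] by simp
  have "lcong (rankin_cohen_symbol (- 1 / 2) (1 / 2) v x y)
     (\<Sum>j\<le>v. (-1) ^ j * ((-2) gchoose (v - j)) * ((-1) gchoose j) * (- y) ^ j * y ^ (v - j))"
    unfolding rankin_cohen_symbol_def of_real_gbinomial
    by (intro lcong_sum lcong_mult lcong_power lcong_gbinomial A B xmy lcong_refl[OF y] lcong_Ints)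
       (use v in auto)
  \<comment> \<open>The powers of y combine to y^v and the four signs to (-1)^v, independently of j;
    only the factor v - j + 1 of the first binomial is left to be summed.\<close>
  also have "(\<Sum>j\<le>v. (-1) ^ j * ((-2) gchoose (v - j)) * ((-1) gchoose j) * (- y) ^ j * y ^ (v - j)) =
             (\<Sum>j\<le>v. (-1) ^ v * y ^ v * (of_nat (v - j) + 1))"
  proof (intro sum.cong refl)
    fix j assume "j \<in> {..v}"
    hence j: "v = j + (v - j)" by simp
    have "(-1) ^ v * y ^ v = (-1) ^ j * (-1) ^ (v - j) * (y ^ j * y ^ (v - j))"
      by (subst (1 2) j) (simp only: power_add)
    moreover have "(- y) ^ j = (-1) ^ j * y ^ j" by (rule power_minus)
    moreover have "(-1) ^ j * ((-1) ^ j * z) = z" for z :: complex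
      by (simp flip: mult.assoc power_add)
    ultimately show "(-1) ^ j * ((-2) gchoose (v - j)) * ((-1) gchoose j) * (- y) ^ j * y ^ (v - j)
        = (-1) ^ v * y ^ v * (of_nat (v - j) + 1)"
      by (simp add: bin1 bin2 mult_ac)
  qed
  also have "\<dots> = (-1) ^ v * y ^ v * ((of_nat v + 1) * (of_nat v + 2) / 2)"
  proof -
    have "(\<Sum>j\<le>v. of_nat (v - j) + 1 :: complex) = (\<Sum>j\<le>v. of_nat j + 1)"
      by (rule sum.reindex_bij_witness[of _ "\<lambda>j. v - j" "\<lambda>j. v - j"]) auto
    also have "\<dots> = (of_nat v + 1) * (of_nat v + 2) / 2"
      by (induction v) (simp_all add: field_simps)
    finally show ?thesis by (simp only: sum_distrib_left[symmetric])
  qed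
  finally have S: "lcong (rankin_cohen_symbol (- 1 / 2) (1 / 2) v x y)
      ((-1) ^ v * y ^ v * ((of_nat v + 1) * (of_nat v + 2) / 2))" .
  have third: "1 / 3 \<in> Z_localized l"
    by (rule Z_localizedI[of l 3 _ 1]) (use not_dvd_small[of 3] l5 in auto)
  have "8 / 3 \<in> Z_localized l"
    using Z_localized_mult[OF third Z_localized_of_int[of 8]] by simp
  hence "lcong (8 / 3 * rankin_cohen_symbol (- 1 / 2) (1 / 2) v x y)
      (8 / 3 * ((-1) ^ v * y ^ v * ((of_nat v + 1) * (of_nat v + 2) / 2)))"
    by (intro lcong_mult[OF lcong_refl S])
  \<comment> \<open>Origin of 8/3: with v = (l - 1) / 2 the sum (v + 1)(v + 2) / 2 equals (l + 1)(l
    + 3) / 8, which is 3/8 modulo l.\<close>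
  also have "8 / 3 * ((-1) ^ v * y ^ v * ((of_nat v + 1) * (of_nat v + 2) / 2)) =
      (-1) ^ v * y ^ v * ((of_nat l + 1) * (of_nat l + 3) * (1 / 3))"
    by (simp add: v' field_simps)
  also have "lcong \<dots> ((-1) ^ v * y ^ v * 1)"
  proof (intro lcong_mult lcong_power lcong_refl[OF y])
    have "(of_nat l + 1) * (of_nat l + 3) * (1 / 3) - 1 = of_nat l * (of_nat l + 4) * (1 / 3 :: complex)"
      by (simp add: field_simps)
    hence e: "(of_nat l + 1) * (of_nat l + 3) * (1 / 3) - 1 = of_nat l * ((of_nat l + 4) * (1 / 3) :: complex)"
      by (simp only: mult.assoc)
    have "(of_nat l + 1) * (of_nat l + 3) * (1 / 3) \<in> Z_localized l" "(of_nat l + 4) * (1 / 3) \<in> Z_localized l"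
      by (intro Z_localized_mult third Z_localized_Ints; simp)+
    thus "lcong ((of_nat l + 1) * (of_nat l + 3) * (1 / 3)) 1"
      using Z_localized_of_int[of 1] by (intro lcongI[OF _ _ _ e]) simp_all
  qed (auto intro: lcong_Ints)
  finally show ?thesis by simp
qed

text \<open>The Legendre symbol is (-w)^v modulo l, and (-w)^v (-y)^v = (w y)^v = m^(2 v) = m^(l -
  1), which Fermat's theorem evaluates.\<close>

lemma lcong_twisted_rankin_cohen_symbol:
  fixes x y :: complex and m w :: int
  assumes x: "x \<in> Z_localized l" and y: "y \<in> Z_localized l" and xy: "lcong (x + y) 0"
    and v: "2 * v + 1 = l" and wy: "of_int w * y = of_int (m\<^sup>2)"
  shows "lcong (of_int (Legendre (- w) (int l)) * (8 / 3) * rankin_cohen_symbol (- 1 / 2) (1 / 2) v x y)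
               (if int l dvd m then 0 else 1)"
proof -
  have vl: "(nat (int l) - 1) div 2 = v" "(l - 1) div 2 = v" using v by auto
  have "[Legendre (- w) (int l) = (- w) ^ ((l - 1) div 2)] (mod (int l))"
    using euler_criterion[of l "- w"] prime_l l5 by simp
  hence L: "lcong (of_int (Legendre (- w) (int l))) (of_int ((- w) ^ v))"
    unfolding vl by (rule lcong_of_int)
  have "lcong (of_int (Legendre (- w) (int l)) * (8 / 3 * rankin_cohen_symbol (- 1 / 2) (1 / 2) v x y))
         (of_int ((- w) ^ v) * ((-1) ^ v * y ^ v))"
    by (rule lcong_mult[OF L lcong_rankin_cohen_symbol[OF x y xy v]])
  also have "of_int ((- w) ^ v) * ((-1) ^ v * y ^ v) = (of_int w * y) ^ v"
    by (simp flip: power_mult_distrib)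
  also have "\<dots> = of_int (m ^ (l - 1))"
  proof -
    have "l - 1 = 2 * v" using v by simp
    thus ?thesis unfolding wy by (simp add: power_mult)
  qed
  also have "lcong \<dots> (of_int (if int l dvd m then 0 else 1))"
  proof (rule lcong_of_int)
    show "[m ^ (l - 1) = (if int l dvd m then 0 else 1)] (mod int l)"
    proof (cases "int l dvd m")
      case True
      hence "int l dvd m ^ (l - 1)" using l5 by (intro dvd_trans[OF True dvd_power]) auto
      thus ?thesis using True by (simp add: cong_0_iff)
    next
      case False
      \<comment> \<open>Fermat's theorem is applied to naturals, so m is replaced by its
        residue.\<close>
      define k where "k = nat (m mod int l)"
      have k: "int k = m mod int l" using l5 by (simp add: k_def)
      have "\<not> int l dvd int k" using False by (simp add: k dvd_mod_iff)
      hence "\<not> l dvd k" by simp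
      from fermat_theorem[OF prime_l this] have "[int k ^ (l - 1) = 1] (mod int l)"
        by (metis cong_int_iff of_nat_1 of_nat_power)
      moreover have "[m ^ (l - 1) = int k ^ (l - 1)] (mod int l)"
        by (intro cong_pow) (simp add: k cong_def)
      ultimately show ?thesis using False cong_trans by auto
    qed
  qed
  finally show ?thesis by (simp add: mult.assoc split: if_splits)
qed

end

end

subsection \<open>The congruence for the coefficients of an eta quotient\<close>

text \<open>Squaring removes the root: for the lower triangular matrix with entry N, the constant g
  = 1 would give \<nu>(\<gamma>)^2 (N \<tau> + 1) = 1 for all \<tau>.\<close>

lemma modular_form_half_not_const_1:
  assumes "modular_form (1 / 2) N \<nu> g" "N \<ge> 1" "\<And>\<tau>. \<tau> \<in> upper_half_plane \<Longrightarrow> g \<tau> = 1"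
  shows False
proof -
  define \<gamma> :: "int^2^2" where "\<gamma> = vector [vector [1, 0], vector [int N, 1]]"
  have \<gamma>_nth: "\<gamma> $ 1 $ 1 = 1" "\<gamma> $ 1 $ 2 = 0" "\<gamma> $ 2 $ 1 = int N" "\<gamma> $ 2 $ 2 = 1"
    by (simp_all add: \<gamma>_def vector_2)
  hence \<gamma>: "\<gamma> \<in> Gamma0 N" by (simp add: Gamma0_def SL2Z_def det_2)
  note \<gamma>' = Gamma0_subset_SL2Z[OF \<gamma>]
  have eq: "1 = \<nu> \<gamma> ^ 2 * aut_denom \<gamma> \<tau>" if \<tau>: "\<tau> \<in> upper_half_plane" for \<tau>
  proof -
    have "g (moebius_act \<gamma> \<tau>) = \<nu> \<gamma> * aut_denom \<gamma> \<tau> powr (1 / 2) * g \<tau>"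
      using assms(1) \<gamma> \<tau> unfolding modular_form_def by simp
    hence "1 = \<nu> \<gamma> * aut_denom \<gamma> \<tau> powr (1 / 2)"
      by (simp add: assms(3) \<tau> moebius_act_in_upper_half_plane[OF \<gamma>' \<tau>])
    hence "1 ^ 2 = (\<nu> \<gamma> * aut_denom \<gamma> \<tau> powr (1 / 2)) ^ 2" by simp
    also have "\<dots> = \<nu> \<gamma> ^ 2 * aut_denom \<gamma> \<tau>"
      using aut_denom_nonzero[OF \<gamma>' \<tau>] by (simp add: power2_eq_square flip: powr_add)
    finally show ?thesis by simp
  qed
  have "\<nu> \<gamma> ^ 2 * aut_denom \<gamma> \<i> = \<nu> \<gamma> ^ 2 * aut_denom \<gamma> (2 * \<i>)"
    using eq[of \<i>] eq[of "2 * \<i>"] by (simp add: upper_half_plane_iff)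
  moreover have "\<nu> \<gamma> ^ 2 \<noteq> 0" using eq[of \<i>] by (auto simp: upper_half_plane_iff)
  ultimately have "aut_denom \<gamma> \<i> = aut_denom \<gamma> (2 * \<i>)" by simp
  thus False using assms(2) by (simp add: aut_denom_def \<gamma>_nth)
qed

section \<open>Divisibility by 24 and descent on square exponents\<close>

lemma prime_not_dvd_24:
  assumes "prime l" "l \<ge> 5"
  shows "\<not> int l dvd 24"
proof
  assume "int l dvd 24"
  hence "int l dvd int (2 ^ 3 * 3)" by simp
  hence "l dvd 2 ^ 3 * 3" by (simp only: of_nat_dvd_iff)
  from prime_dvd_multD[OF assms(1) this] have "l dvd 2 \<or> l dvd 3"
    using prime_dvd_power[OF assms(1), of 2 3] by blast
  thus False using assms(2) by (auto dest: dvd_imp_le)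
qed

text \<open>Every unit modulo 24 has square 1. As t / w is an integer over 24, this makes t (l^2 -
  1) / w an integer.\<close>

lemma prime_square_minus_1_dvd_24:
  assumes "prime l" "l \<ge> 5"
  shows "24 dvd (int l ^ 2 - 1)"
proof -
  have 3: "\<not> 3 dvd l" and 2: "\<not> 2 dvd l"
    using assms primes_dvd_imp_eq[of 3 l] primes_dvd_imp_eq[of 2 l] by auto
  define m where "m = l mod 24"
  have "m < 24" "\<not> 3 dvd m" "\<not> 2 dvd m" using 2 3 by (auto simp: m_def dvd_mod_iff)
  hence "m \<in> {1, 5, 7, 11, 13, 17, 19, 23}" by (simp add: numeral_eq_Suc less_Suc_eq) presburger
  hence "m ^ 2 mod 24 = 1" by auto
  hence "l ^ 2 mod 24 = 1" by (simp add: m_def power_mod)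
  hence "int (l ^ 2 mod 24) = 1" by simp
  hence "int l ^ 2 mod 24 = 1" by (simp add: zmod_int)
  thus ?thesis by (simp add: mod_eq_dvd_iff flip: mod_eq_dvd_iff[where b = 1])
qed

text \<open>If l divides w, then 24 t = s w puts l into t, so l divides every exponent t + k w. One
  with nonzero coefficient is a square, hence divisible by l^2, and the scaling relation carries
  nonvanishing down to the exponent divided by l^2. Only the exponent 0 can end this descent, which
  leaves t = 0 and B = 1.\<close>

lemma theta_denominator_coprime:
  fixes b :: "int \<Rightarrow> complex" and t w :: int and B :: "complex fps"
  assumes l: "prime l" "l \<ge> 5" and w: "w > 0" and t: "t \<ge> 0" and tw: "24 * t = s * w"
    and C: "\<And>e. square_fibre_sum b e = (if nat t \<le> e \<and> nat w dvd (e - nat t)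
           then fps_nth B ((e - nat t) div nat w) else 0)"
    and chi: "\<And>m. b (int l * m) = c * b m" and B0: "fps_nth B 0 = 1" and B1: "B \<noteq> 1 \<or> t \<noteq> 0"
  shows "\<not> int l dvd w"
proof
  assume lw: "int l dvd w"
  hence "int l dvd 24 * t" unfolding tw by simp
  hence lt: "int l dvd t" using l prime_not_dvd_24[OF l] by (simp add: prime_dvd_mult_iff)
  have zero: "e = 0" if "square_fibre_sum b e \<noteq> 0" for e
    using that
  proof (induction e rule: less_induct)
    case (less e)
    have e: "nat t \<le> e" "nat w dvd e - nat t" using less.prems C[of e] by (auto split: if_splits)
    have "int l dvd int (nat w)" "int l dvd int (nat t)" using lw lt w t by simp_all
    hence "l dvd nat w" "l dvd nat t" by (simp_all only: of_nat_dvd_iff)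
    hence "l dvd e" using e by (metis dvd_diffD dvd_trans)
    obtain m where m: "e = m\<^sup>2" using square_fibre_sum_nonzero[OF less.prems] by blast
    with \<open>l dvd e\<close> l have "l dvd m" by (auto dest: prime_dvd_power)
    then obtain m' where m': "m = l * m'" by blast
    have e': "e = l\<^sup>2 * m'\<^sup>2" by (simp add: m m' power_mult_distrib)
    have "square_fibre_sum b e = c * square_fibre_sum b (m'\<^sup>2)"
      unfolding e' by (rule square_fibre_sum_scale) (use l chi in auto)
    hence nz: "square_fibre_sum b (m'\<^sup>2) \<noteq> 0" using less.prems by auto
    show ?case
    proof (rule ccontr)
      assume "e \<noteq> 0"
      hence "m' > 0" using e' by auto
      have "1 < l\<^sup>2" using l by (intro one_less_power) auto
      hence "m'\<^sup>2 < e" using \<open>m' > 0\<close> by (simp add: e')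
      from less.IH[OF this nz] \<open>m' > 0\<close> show False by simp
    qed
  qed
  have CB: "square_fibre_sum b (nat t + nat w * k) = fps_nth B k" for k
    using w by (simp add: C)
  have "square_fibre_sum b (nat t) \<noteq> 0" using CB[of 0] B0 by simp
  hence "nat t = 0" by (rule zero)
  moreover have "fps_nth B k = 0" if "k > 0" for k
    using zero[of "nat t + nat w * k"] CB[of k] w that by auto
  hence "B = 1" using B0 by (intro fps_ext) auto
  ultimately show False using B1 t by simp
qed

text \<open>The terms with \<open>l\<close> dividing \<open>t + k w = m\<^sup>2\<close> are exactly the terms with \<open>l\<close> dividing \<open>m\<close>,
  and there \<open>b (l m) = c b m\<close> collapses the sum to a product.\<close>

lemma theta_coefficient_convolution:
  fixes b :: "int \<Rightarrow> complex" and t w K :: int and B :: "complex fps" and a :: "int \<Rightarrow> complex"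
  assumes l: "prime l" and w: "w > 0" and t: "t \<ge> 0" and K: "w * K = t * (int l ^ 2 - 1)"
    and C: "\<And>e. square_fibre_sum b e = (if nat t \<le> e \<and> nat w dvd (e - nat t)
           then fps_nth B ((e - nat t) div nat w) else 0)"
    and chi: "\<And>m. b (int l * m) = c * b m" and a: "\<And>n. n < 0 \<Longrightarrow> a n = 0"
  shows "c * (\<Sum>i\<le>M. fps_nth (fps_expand l B) i * a (int l * int (M - i) - K)) =
         (\<Sum>k\<le>l * M. if int l dvd t + int k * w then a (int (l * M - k)) * fps_nth B k else 0)"
proof -
  define k0 where "k0 = nat K"
  have l0: "l > 0" using l by (simp add: prime_gt_0_nat)
  have "int l ^ 2 - 1 \<ge> 0" using l0 by (simp add: one_le_power)
  hence "w * K \<ge> 0" unfolding K using t by simp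
  hence "K \<ge> 0" using w by (simp add: zero_le_mult_iff)
  hence K': "K = int k0" by (simp add: k0_def)
  define t0 w0 where "t0 = nat t" "w0 = nat w"
  have tw: "t = int t0" "w = int w0" "w0 > 0" using t w by (auto simp: t0_w0_def)
  have CB: "square_fibre_sum b (t0 + w0 * k) = fps_nth B k" for k
    using w by (simp add: C t0_w0_def)
  have CE: "\<exists>k. e = t0 + w0 * k" if "square_fibre_sum b e \<noteq> 0" for e
    using that C[of e] by (auto split: if_splits simp: t0_w0_def dvd_def) (metis le_add_diff_inverse)
  have scale: "square_fibre_sum b (l\<^sup>2 * e) = c * square_fibre_sum b e" for e
    by (rule square_fibre_sum_scale[where b = b and c = c, OF l0 chi])
  \<comment> \<open>The shift K is made for this: the index K carries the exponent t + w K = l^2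
    t.\<close>
  have wk: "w0 * k0 + t0 = l\<^sup>2 * t0"
  proof -
    have "int (w0 * k0 + t0) = int (l\<^sup>2 * t0)"
      using K by (simp add: K' tw algebra_simps)
    thus ?thesis by (simp only: of_nat_eq_iff)
  qed
  \<comment> \<open>The exponents t + w j and t + w (l^2 j + K) differ by the factor l^2, so the
    scaling relation connects the two coefficients.\<close>
  have key: "c * fps_nth B j = fps_nth B (l\<^sup>2 * j + k0)" for j
  proof -
    have "t0 + w0 * (l\<^sup>2 * j + k0) = (w0 * k0 + t0) + l\<^sup>2 * (w0 * j)" by (simp add: algebra_simps)
    also have "\<dots> = l\<^sup>2 * (t0 + w0 * j)" unfolding wk by (simp add: algebra_simps)
    finally show ?thesis using CB[of "l\<^sup>2 * j + k0"] scale[of "t0 + w0 * j"] CB[of j] by simp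
  qed
  \<comment> \<open>The terms correspond through i = l j and k = l i + K; the bound l i + K \<le> l
    M keeps the natural subtraction in the argument of \<open>a\<close> from truncating.\<close>
  define S where "S = {i. i \<le> M \<and> l dvd i \<and> l * i + k0 \<le> l * M}"
  define T where "T = {k. k \<le> l * M \<and> int l dvd t + int k * w}"
  have "(\<Sum>k\<le>l * M. if int l dvd t + int k * w then a (int (l * M - k)) * fps_nth B k else 0) =
        (\<Sum>k\<in>T. a (int (l * M - k)) * fps_nth B k)"
    by (rule sum.mono_neutral_cong_right) (auto simp: T_def)
  also have "\<dots> = (\<Sum>k\<in>(\<lambda>i. l * i + k0) ` S. a (int (l * M - k)) * fps_nth B k)"
  proof (rule sum.mono_neutral_right)
    show "finite T" by (rule finite_subset[of _ "{..l * M}"]) (auto simp: T_def)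
    show "(\<lambda>i. l * i + k0) ` S \<subseteq> T"
    proof (safe)
      fix i assume i: "i \<in> S"
      have "t + int (l * i + k0) * w = int ((w0 * k0 + t0) + l * (i * w0))"
        by (simp add: tw algebra_simps)
      also have "int l dvd \<dots>" unfolding wk power2_eq_square by (simp only: of_nat_dvd_iff) (auto simp: mult.assoc)
      finally show "l * i + k0 \<in> T" using i by (auto simp: T_def S_def)
    qed
    show "\<forall>k\<in>T - (\<lambda>i. l * i + k0) ` S. a (int (l * M - k)) * fps_nth B k = 0"
    proof (rule ballI, rule ccontr)
      fix k assume k: "k \<in> T - (\<lambda>i. l * i + k0) ` S" and "a (int (l * M - k)) * fps_nth B k \<noteq> 0"
      hence nz: "square_fibre_sum b (t0 + w0 * k) \<noteq> 0" by (simp add: CB)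
      have "int l dvd int (t0 + w0 * k)" using k by (simp add: T_def tw mult.commute)
      hence dvd: "l dvd t0 + w0 * k" by (simp only: of_nat_dvd_iff)
      obtain m where m: "t0 + w0 * k = m\<^sup>2" using square_fibre_sum_nonzero[OF nz] by blast
      with dvd l have "l dvd m" by (auto dest: prime_dvd_power)
      then obtain m' where m': "m = l * m'" by blast
      have e: "t0 + w0 * k = l\<^sup>2 * m'\<^sup>2" by (simp add: m m' power_mult_distrib)
      have "square_fibre_sum b (m'\<^sup>2) \<noteq> 0" using nz unfolding e scale by auto
      \<comment> \<open>After division by l^2 the exponent still has a nonzero coefficient, so it is
        again of the form t + w j; this forces k to be l^2 j + K.\<close>
      from CE[OF this] obtain j where j: "m'\<^sup>2 = t0 + w0 * j" by blast
      have "t0 + w0 * k = (w0 * k0 + t0) + w0 * (l\<^sup>2 * j)"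
        unfolding e j wk by (simp add: algebra_simps)
      hence "w0 * k = w0 * (k0 + l\<^sup>2 * j)" by (simp add: algebra_simps)
      hence "k = k0 + l\<^sup>2 * j" using tw(3) by simp
      hence kj: "k = l * (l * j) + k0" by (simp add: power2_eq_square mult.assoc)
      have kM: "k \<le> l * M" using k by (simp add: T_def)
      with kj have "l * (l * j) \<le> l * M" by linarith
      hence "l * j \<le> M" using l0 by simp
      with kM have "l * j \<in> S" by (simp add: S_def kj)
      with k kj show False by blast
    qed
  qed
  also have "\<dots> = (\<Sum>i\<in>S. a (int (l * M - (l * i + k0))) * fps_nth B (l * i + k0))"
    by (subst sum.reindex) (use l0 in \<open>auto simp: inj_on_def\<close>)
  also have "\<dots> = (\<Sum>i\<le>M. c * (fps_nth (fps_expand l B) i * a (int l * int (M - i) - K)))"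
  proof (rule sum.mono_neutral_cong_left)
    show "S \<subseteq> {..M}" by (auto simp: S_def)
    show "\<forall>i\<in>{..M} - S. c * (fps_nth (fps_expand l B) i * a (int l * int (M - i) - K)) = 0"
    proof
      fix i assume i: "i \<in> {..M} - S"
      show "c * (fps_nth (fps_expand l B) i * a (int l * int (M - i) - K)) = 0"
      proof (cases "l dvd i")
        case True
        \<comment> \<open>For these i the argument of \<open>a\<close> is negative, and the
          convention a(n) = 0 for n < 0 removes the term.\<close>
        hence "l * i + k0 > l * M" using i by (auto simp: S_def)
        hence "int (l * i + k0) > int (l * M)" by (simp only: of_nat_less_iff)
        hence "int l * int (M - i) - K < 0" using i by (simp add: K' of_nat_diff algebra_simps)
        thus ?thesis by (simp add: a)
      qed (simp add: fps_expand_def)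
    qed
    fix i assume i: "i \<in> S"
    then obtain j where j: "i = l * j" by (auto simp: S_def)
    have "int (l * M - (l * i + k0)) = int l * int (M - i) - K"
      using i by (simp add: S_def K' of_nat_diff algebra_simps)
    thus "a (int (l * M - (l * i + k0))) * fps_nth B (l * i + k0) =
            c * (fps_nth (fps_expand l B) i * a (int l * int (M - i) - K))"
      using key[of j] l0 by (simp add: fps_expand_def j power2_eq_square mult_ac)
  qed simp
  finally show ?thesis by (simp only: sum_distrib_left)
qed


theorem theorem1:
  fixes N :: nat and r :: "nat \<Rightarrow> int" and t w :: int
    and a :: "int \<Rightarrow> complex" and b :: "int \<Rightarrow> complex" and chi :: "nat \<Rightarrow> complex"
    and f g :: "complex \<Rightarrow> complex" and \<nu> :: "int^2^2 \<Rightarrow> complex" and l :: nat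
  assumes "N \<ge> 1"
    and "w > 0"
    and "of_int t / of_int w = (\<Sum>\<delta> | \<delta> dvd N. real \<delta> * of_int (r \<delta>)) / (24 :: real)"
    and "f = eta_quotient N (\<lambda>\<delta>. - r \<delta>)"
    and "\<And>n. n < 0 \<Longrightarrow> a n = 0"
    and "\<And>\<tau>. \<tau> \<in> upper_half_plane \<Longrightarrow>
           ((\<lambda>n. a n * q_pow (of_int n - of_int t / of_int w) \<tau>) has_sum f \<tau>) {0..}"
    and "Gcd {\<delta>. \<delta> dvd N \<and> r \<delta> \<noteq> 0} = 1"
    and "g = (\<lambda>\<tau>. 1 / f \<tau>)"
    and "modular_form (1 / 2) N \<nu> g"
    and "\<And>\<tau>. \<tau> \<in> upper_half_plane \<Longrightarrow>
           ((\<lambda>m. b m * q_pow (of_int (m ^ 2) / of_int w) \<tau>) has_sum g \<tau>) UNIV"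
    and "\<And>p m. prime p \<Longrightarrow> p \<ge> 5 \<Longrightarrow> b (int p * m) = chi p * b m"
    and "prime l" and "l \<ge> 5"
  shows "(\<exists>P. has_q_expansion (rankin_cohen (- 1 / 2) f (1 / 2) g ((l - 1) div 2)) P \<and>
            fps_cong_mod l
              (fps_const (chi l) * (\<Prod>\<delta> | \<delta> dvd N. q_poch_inf (l * \<delta>) powi r \<delta>)
                 * Abs_fps (\<lambda>n. a (int l * int n - t * (int l ^ 2 - 1) div w)))
              (1 - fps_const (of_int (Legendre (- w) (int l)) * (8 / 3)) * U_op l P))
       \<and> rankin_cohen (- 1 / 2) f (1 / 2) g ((l - 1) div 2) \<in> M_Gamma0 (l - 1) N"
proof -
  note N = assms(1) and w = assms(2) and tw = assms(3) and f_def = assms(4) and a_neg = assms(5)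
    and a = assms(6) and g_def = assms(8) and mf = assms(9) and b = assms(10)
    and l = assms(12,13)
  note chi = assms(11)[OF l]
  define \<alpha> :: real where "\<alpha> = of_int t / of_int w"
  define v where "v = (l - 1) div 2"
  have v: "2 * v + 1 = l" using odd_l[OF l] l(2) by (auto simp: v_def elim!: oddE)
  have l0: "l > 0" using l(2) by simp
  define A where "A = Abs_fps (\<lambda>n. a (int n))"
  define B where "B = euler_quotient_fps 1 N r"
  define s where "s = (\<Sum>\<delta> | \<delta> dvd N. int \<delta> * r \<delta>)"

  have \<alpha>: "\<alpha> = (\<Sum>\<delta> | \<delta> dvd N. real \<delta> * of_int (r \<delta>)) / 24" using tw by (simp add: \<alpha>_def)
  \<comment> \<open>The denominator 24 is what puts \<alpha> into Z_(l) for every prime l \<ge>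
    5.\<close>
  have \<alpha>s: "\<alpha> = of_int s / 24" by (simp add: \<alpha> s_def)
  hence "24 * real_of_int t = of_int s * of_int w" using w by (simp add: \<alpha>_def field_simps)
  hence ts: "24 * t = s * w" by (metis of_int_eq_iff of_int_mult of_int_numeral)

  have g: "g \<tau> = eta_quotient N r \<tau>" for \<tau>
    by (simp add: g_def f_def eta_quotient_eq euler_quotient_uminus[OF N] sum_negf q_pow_minus)
  have f_eq: "f = (\<lambda>\<tau>. 1 / g \<tau>)" by (simp add: g_def)

  have A: "A = euler_quotient_fps 1 N (\<lambda>\<delta>. - r \<delta>)"
    unfolding A_def
    by (rule eta_quotient_coefficients[OF N, where \<alpha> = "- \<alpha>"])
       (use a in \<open>simp_all add: \<alpha> f_def sum_negf flip: tw\<close>)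
  have AB: "A * B = 1" unfolding A B_def by (rule euler_quotient_fps_inverse[OF N])
  have intA: "fps_nth A n \<in> \<int>" and intB: "fps_nth B n \<in> \<int>" for n
    using int_euler_quotient_fps[OF N, of 1] by (auto simp: A B_def int_fps_def)
  have R: "fps_conv_radius (euler_quotient_fps 1 N r) \<ge> 1" for r
    by (rule fps_conv_radius_ge_1I) (use euler_quotient_sums[OF N] in \<open>auto simp: sums_iff\<close>)
  have eval: "eval_fps (euler_quotient_fps 1 N r) (q_pow 1 \<tau>) = euler_quotient N r (q_pow 1 \<tau>)"
    if "\<tau> \<in> upper_half_plane" for r \<tau>
    using euler_quotient_sums[OF N norm_q_pow_less_1[OF _ that, of 1], of r] by (simp add: eval_fps_def sums_iff)
  have g_q: "g \<tau> = q_pow \<alpha> \<tau> * eval_fps B (q_pow 1 \<tau>)" if "\<tau> \<in> upper_half_plane" for \<tau>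
    by (simp add: g eta_quotient_eq \<alpha> B_def eval[OF that, unfolded One_nat_def])
  have f_q: "f \<tau> = q_pow (- \<alpha>) \<tau> * eval_fps A (q_pow 1 \<tau>)" if "\<tau> \<in> upper_half_plane" for \<tau>
    by (simp add: f_def eta_quotient_eq \<alpha> A eval[OF that, unfolded One_nat_def] sum_negf)
  have g_nz: "g \<tau> \<noteq> 0" if "\<tau> \<in> upper_half_plane" for \<tau>
    using euler_quotient_nonzero[OF N norm_q_pow_less_1[OF _ that, of 1], of r] by (simp add: g eta_quotient_eq)

  have b': "((\<lambda>m. b m * q_pow (of_int (m ^ 2) / of_int w) \<tau>) has_sum eta_quotient N r \<tau>) UNIV"
    if "\<tau> \<in> upper_half_plane" for \<tau>
    using b[OF that] unfolding g .
  have th: "t \<ge> 0" by (rule theta_coefficients(1)[OF N w tw b'])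
  have C: "\<And>e. square_fibre_sum b e = (if nat t \<le> e \<and> nat w dvd (e - nat t)
           then fps_nth B ((e - nat t) div nat w) else 0)"
    unfolding B_def by (rule theta_coefficients(2)[OF N w tw b'])
  have B1: "B \<noteq> 1 \<or> t \<noteq> 0"
  proof (rule ccontr)
    assume "\<not> (B \<noteq> 1 \<or> t \<noteq> 0)"
    hence "g \<tau> = 1" if "\<tau> \<in> upper_half_plane" for \<tau> using g_q[OF that] by (simp add: \<alpha>_def)
    with modular_form_half_not_const_1[OF mf N] show False by blast
  qed
  have B0: "fps_nth B 0 = 1" using euler_quotient_fps_nth_0[OF N, of 1 r] by (simp add: B_def)
  have lw: "\<not> int l dvd w"
    by (rule theta_denominator_coprime[OF l w th ts C chi B0 B1])

  define K where "K = t * (int l ^ 2 - 1) div w"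
  obtain k where k: "int l ^ 2 - 1 = 24 * k" using prime_square_minus_1_dvd_24[OF l] by blast
  \<comment> \<open>The integer division by w in the statement is exact: the 24 in l^2 - 1 cancels
    the denominator of t / w = s / 24.\<close>
  have "t * (int l ^ 2 - 1) = w * (s * k)" using ts by (simp add: k algebra_simps)
  hence K: "w * K = t * (int l ^ 2 - 1)" using w by (simp add: K_def)

  define P where "P = rankin_cohen_fps (- 1 / 2) (1 / 2) v \<alpha> A B"
  have P: "has_q_expansion (rankin_cohen (- 1 / 2) f (1 / 2) g v) P"
    unfolding P_def
    by (rule rankin_cohen_has_q_expansion[OF _ _ f_q g_q]) (unfold A B_def, (rule R)+)

  define L where "L = of_int (Legendre (- w) (int l)) * (8 / 3 :: complex)"
  have "fps_cong_mod l
     (fps_const (chi l) * euler_quotient_fps l N r * Abs_fps (\<lambda>n. a (int l * int n - K)))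
     (1 - fps_const L * U_op l P)"
    unfolding fps_cong_mod_def
  proof
    fix M :: nat
    \<comment> \<open>Coefficient M after U_l is coefficient l M of the bracket.\<close>
    define n where "n = l * M"
    define sym where "sym = (\<lambda>k. rankin_cohen_symbol (- 1 / 2) (1 / 2) v (of_nat (n - k) - of_real \<alpha>) (of_nat k + of_real \<alpha>))"
    define F where "F = fps_const (chi l) * euler_quotient_fps l N r * Abs_fps (\<lambda>n. a (int l * int n - K))"
    have "fps_nth F M = chi l * (\<Sum>i\<le>M. fps_nth (fps_expand l B) i * a (int l * int (M - i) - K))"
      unfolding F_def mult.assoc fps_mult_left_const_nth
      by (simp add: fps_mult_nth atLeast0AtMost B_def euler_quotient_fps_expand[OF N l0])
    also have "\<dots> = (\<Sum>k\<le>n. if int l dvd t + int k * w then a (int (n - k)) * fps_nth B k else 0)"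
      unfolding n_def by (rule theta_coefficient_convolution[OF l(1) w th K C chi a_neg])
    finally have lhs: "fps_nth F M =
        (\<Sum>k\<le>n. fps_nth A (n - k) * fps_nth B k * (if int l dvd t + int k * w then 1 else 0))"
      by (simp add: A_def if_distrib cong: if_cong)
    have flip: "(\<Sum>i\<le>n. h i (n - i)) = (\<Sum>k\<le>n. h (n - k) k)" for h :: "nat \<Rightarrow> nat \<Rightarrow> complex"
      by (rule sum.reindex_bij_witness[of _ "\<lambda>i. n - i" "\<lambda>i. n - i"]) auto
    have Pn: "fps_nth P n = (\<Sum>k\<le>n. fps_nth A (n - k) * fps_nth B k * sym k)"
      unfolding P_def rankin_cohen_fps_def fps_nth_Abs_fps sym_def
      by (rule flip[of "\<lambda>i k. fps_nth A i * fps_nth B k *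
            rankin_cohen_symbol (- 1 / 2) (1 / 2) v (of_nat i - of_real \<alpha>) (of_nat k + of_real \<alpha>)"])
    \<comment> \<open>The series 1 has the same coefficient at M as at l M, both being 0 unless M =
      0. Read off from A B at l M, it becomes a sum over the same pairs as the bracket
      coefficient.\<close>
    have one: "fps_nth 1 M = (\<Sum>k\<le>n. fps_nth A (n - k) * fps_nth B k)"
    proof -
      have "fps_nth 1 M = fps_nth (A * B) n" using l0 by (simp add: AB n_def)
      also have "\<dots> = (\<Sum>k\<le>n. fps_nth A (n - k) * fps_nth B k)"
        by (simp add: fps_mult_nth atLeast0AtMost flip[of "\<lambda>i k. fps_nth A i * fps_nth B k"])
      finally show ?thesis .
    qed
    have rhs: "fps_nth (1 - fps_const L * U_op l P) M =
        (\<Sum>k\<le>n. fps_nth A (n - k) * fps_nth B k * (1 - L * sym k))"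
    proof -
      have "fps_nth (1 - fps_const L * U_op l P) M = fps_nth 1 M - L * fps_nth P n"
        by (simp add: U_op_def n_def)
      thus ?thesis
        unfolding Pn one
        by (simp only: right_diff_distrib sum_subtractf sum_distrib_left mult_1_left mult_1_right mult_ac)
    qed
    \<comment> \<open>The congruence holds for each k separately: where B has a nonzero coefficient,
      so that t + k w = m^2, the factor 1 - L sym is 1 modulo l if l divides m, and 0
      otherwise.\<close>
    have "lcong l (fps_nth A (n - k) * fps_nth B k * (if int l dvd t + int k * w then 1 else 0))
             (fps_nth A (n - k) * fps_nth B k * (1 - L * sym k))" if "k \<le> n" for k
    proof (cases "fps_nth B k = 0")
      case True
      \<comment> \<open>Such a k need not come with a square t + k w, but then both terms are
        0.\<close>
      thus ?thesis using lcong_Ints[OF l(1), of 0] by simp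
    next
      case False
      have "square_fibre_sum b (nat t + nat w * k) = fps_nth B k" using w by (simp add: C)
      with False obtain m where m: "nat t + nat w * k = m\<^sup>2" using square_fibre_sum_nonzero by metis
      have m': "t + int k * w = int m ^ 2"
        using arg_cong[OF m, of int] th w by (simp add: mult.commute)
      have \<alpha>Z: "of_real \<alpha> \<in> Z_localized l"
        by (rule Z_localizedI[OF prime_not_dvd_24[OF l], of _ s]) (simp add: \<alpha>s)
      have xZ: "of_nat (n - k) - of_real \<alpha> \<in> Z_localized l" and yZ: "of_nat k + of_real \<alpha> \<in> Z_localized l"
        using Z_localized_diff[OF l(1) Z_localized_of_int[OF l(1), of "int (n - k)"] \<alpha>Z]
          Z_localized_add[OF l(1) Z_localized_of_int[OF l(1), of "int k"] \<alpha>Z] by simp_all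
      have "of_nat (n - k) - of_real \<alpha> + (of_nat k + of_real \<alpha>) = (of_int (int n) :: complex)"
        using that by (simp add: of_nat_diff)
      moreover have "lcong l (of_int (int n)) (of_int 0)"
        by (rule lcong_of_int[OF l(1)]) (simp add: n_def cong_0_iff)
      ultimately have xy: "lcong l (of_nat (n - k) - of_real \<alpha> + (of_nat k + of_real \<alpha>)) 0" by simp
      have wy: "of_int w * (of_nat k + of_real \<alpha>) = (of_int (int m ^ 2) :: complex)"
        using w by (simp add: \<alpha>_def field_simps flip: m')
      have "lcong l (L * sym k) (if int l dvd int m then 0 else 1)"
        unfolding L_def sym_def
        by (rule lcong_twisted_rankin_cohen_symbol[OF l xZ yZ xy v wy])
      hence "lcong l (fps_nth A (n - k) * fps_nth B k * (1 - L * sym k))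
               (fps_nth A (n - k) * fps_nth B k * (1 - (if int l dvd int m then 0 else 1)))"
        by (intro lcong_mult[OF l(1)] lcong_diff[OF l(1)] lcong_Ints[OF l(1)] intA intB) auto
      moreover have "int l dvd t + int k * w \<longleftrightarrow> int l dvd int m"
        using l(1) unfolding m' by (simp add: prime_dvd_power_iff)
      ultimately show ?thesis by (auto intro: lcong_sym[OF l(1)] split: if_splits)
    qed
    hence "lcong l (fps_nth F M) (fps_nth (1 - fps_const L * U_op l P) M)"
      unfolding lhs rhs by (intro lcong_sum[OF l(1)]) auto
    thus "fps_nth (fps_const (chi l) * euler_quotient_fps l N r * Abs_fps (\<lambda>n. a (int l * int n - K))) M \<in> Z_localized l \<and>
       fps_nth (1 - fps_const L * U_op l P) M \<in> Z_localized l \<and>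
       (\<exists>z\<in>Z_localized l. fps_nth (fps_const (chi l) * euler_quotient_fps l N r * Abs_fps (\<lambda>n. a (int l * int n - K))) M -
          fps_nth (1 - fps_const L * U_op l P) M = of_nat l * z)"
      unfolding F_def lcong_def[OF l(1)] .
  qed
  with P have "\<exists>P. has_q_expansion (rankin_cohen (- 1 / 2) f (1 / 2) g v) P \<and>
     fps_cong_mod l (fps_const (chi l) * euler_quotient_fps l N r * Abs_fps (\<lambda>n. a (int l * int n - K)))
       (1 - fps_const L * U_op l P)" by blast
  moreover have "rankin_cohen (- 1 / 2) f (1 / 2) g v \<in> M_Gamma0 (2 * v) N"
    unfolding f_eq by (rule rankin_cohen_reciprocal_modular[OF N mf g_nz])
  moreover have "2 * v = l - 1" using v by simp
  ultimately show ?thesis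
    unfolding v_def[symmetric] K_def[symmetric] L_def[symmetric] euler_quotient_fps_def[symmetric] by simp
qed

end
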